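(* Assume the following testing one-vs-two hypothesis: whenever $k$ and $\lambda$ scale with $n$ such that $\lambda^2(k^2/n\vee 1)=o(1)$, no sequence of randomized polynomial-time algorithms $B_n=B_n(Y)$ strongly distinguishes between $H_0: Y\sim\mathbb{P}_{\rm Gaussian}(n,k,\lambda,1)$ and $H_1: Y\sim\mathbb{P}_{\rm Gaussian}(n,k,\lambda,2)$. If $k$ and $\tilde\lambda$ scale with $n$ such that $$k\ge\log\log n,\qquad \tilde\lambda^2\left(\frac{k^2}{n}\vee1\right)=o(1)\qquad\text{and}\qquad \tilde\lambda\ge 2k^{-1/2}\log n,$$ then no sequence of randomized polynomial-time algorithms $A_n$ achieves weak recovery in $\mathbb{P}_{\rm Gaussian}(n,k,\tilde\lambda,1)$.
   Context: Notation: $[n]=\{1,\dots,n\}$, $a\vee b=\max\{a,b\}$; asymptotics are as $n\to\infty$ and "w.h.p." means with probability $1-o(1)$. Model. For $0<k\le n$, $\lambda>0$ and $M\ge1$, $\mathbb{P}_{\rm Gaussian}(n,k,\lambda,M)$ denotes the following distribution of a symmetric matrix $Y\in\mathbb{R}^{n\times n}$ (the case of equal community proportions $x_\ell=1/M$). Independently for each $i\in[n]$, a label $\sigma_i$ is sampled with $\sigma_i=\ell$ with probability $k/(Mn)$ for each $\ell\in[M]$ and $\sigma_i=\star$ (no community) with probability $1-k/n$. Given the labels, independently for $i\le j$, $Y_{ij}\sim\mathcal{N}(M\lambda,1)$ if $\sigma_i=\sigma_j=\ell$ for some $\ell\in[M]$, and $Y_{ij}\sim\mathcal{N}(0,1)$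 otherwise; for $i>j$, $Y_{ij}=Y_{ji}$. Strongly distinguishing. An algorithm $B=B(Y)\in\{0,1\}$ strongly distinguishes between $H_0$ and $H_1$ if $\mathbb{P}_0(B=1)=o(1)$ and $\mathbb{P}_1(B=0)=o(1)$, where $\mathbb{P}_0,\mathbb{P}_1$ denote probabilities under $H_0,H_1$. Weak recovery. An algorithm $A_n$ achieves weak recovery in $\mathbb{P}_{\rm Gaussian}(n,k,\lambda,1)$ if there exists $\varepsilon>0$, not dependent on $n$, such that on input $Y\sim\mathbb{P}_{\rm Gaussian}(n,k,\lambda,1)$ the algorithm returns a set $I\subseteq[n]$ such that w.h.p. $|I\cap S|\ge\varepsilon k$ and $|I|\le1.1k$, where $S=\{i:\sigma_i=1\}$ is the planted community. *)

theory Defs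
  imports "HOL-Probability.Probability"
begin

section \<open>The planted community model\<close>

text \<open>A label is \<open>Some l\<close> for membership in community \<open>l \<in> {1..M}\<close> and \<open>None\<close> for the
  label \<open>\<star>\<close> (no community).  The size parameter \<open>k\<close> is a real number.\<close>

definition label_pmf :: "nat \<Rightarrow> real \<Rightarrow> nat \<Rightarrow> nat option pmf" where
  "label_pmf n k M = embed_pmf (\<lambda>x. case x of
      None \<Rightarrow> 1 - k / real n
    | Some l \<Rightarrow> if l \<in> {1..M} then k / (real M * real n) else 0)"

lemma pmf_label_pmf:
  assumes "0 < k" "k \<le> real n" "M \<ge> 1"
  shows "pmf (label_pmf n k M) x = (case x of
      None \<Rightarrow> 1 - k / real n
    | Some l \<Rightarrow> if l \<in> {1..M} then k / (real M * real n) else 0)" (is "_ = ?f x")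
  unfolding label_pmf_def
proof (rule pmf_embed_pmf)
  have n: "real n > 0" using assms by linarith
  show nn: "0 \<le> ?f x" for x
    using assms n by (auto split: option.split)
  let ?A = "insert None (Some ` {1..M})"
  have "(\<integral>\<^sup>+ x. ennreal (?f x) \<partial>count_space UNIV) = (\<Sum>x\<in>?A. ennreal (?f x))"
    by (rule nn_integral_count_space') (auto split: option.splits if_splits)
  also have "\<dots> = ennreal (\<Sum>x\<in>?A. ?f x)"
    using nn by (intro sum_ennreal) auto
  also have "(\<Sum>x\<in>?A. ?f x) = 1"
    using assms n by (subst sum.insert) (auto simp: sum.reindex field_simps)
  finally show "(\<integral>\<^sup>+ x. ennreal (?f x) \<partial>count_space UNIV) = 1" by simp
qed

definition labels_pmf :: "nat \<Rightarrow> real \<Rightarrow> nat \<Rightarrow> (nat \<Rightarrow> nat option) pmf" where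
  "labels_pmf n k M = Pi_pmf {1..n} None (\<lambda>_. label_pmf n k M)"

text \<open>An \<open>n \<times> n\<close> matrix is a function on index pairs, living on the product space below.\<close>

definition matrix_space :: "nat \<Rightarrow> (nat \<times> nat \<Rightarrow> real) measure" where
  "matrix_space n = PiM ({1..n} \<times> {1..n}) (\<lambda>_. borel)"

definition entry_mean :: "real \<Rightarrow> nat \<Rightarrow> (nat \<Rightarrow> nat option) \<Rightarrow> nat \<times> nat \<Rightarrow> real" where
  "entry_mean lam M \<sigma> = (\<lambda>(i, j).
     if \<exists>l\<in>{1..M}. \<sigma> i = Some l \<and> \<sigma> j = Some l then real M * lam else 0)"

text \<open>The conditional law of the upper triangle (diagonal included) given the labels.\<close>

definition upper_given_labels ::
    "nat \<Rightarrow> real \<Rightarrow> nat \<Rightarrow> (nat \<Rightarrow> nat option) \<Rightarrow> (nat \<times> nat \<Rightarrow> real) measure" where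
  "upper_given_labels n lam M \<sigma> =
     PiM {(i, j). 1 \<le> i \<and> i \<le> j \<and> j \<le> n}
       (\<lambda>p. density lborel (\<lambda>x. ennreal (normal_density (entry_mean lam M \<sigma> p) 1 x)))"

definition symmetrize :: "nat \<Rightarrow> (nat \<times> nat \<Rightarrow> real) \<Rightarrow> (nat \<times> nat \<Rightarrow> real)" where
  "symmetrize n X = (\<lambda>(i, j) \<in> {1..n} \<times> {1..n}. X (min i j, max i j))"

text \<open>The joint law of the labels and the matrix, and its matrix marginal.\<close>

definition P_Gaussian_joint :: "nat \<Rightarrow> real \<Rightarrow> real \<Rightarrow> nat \<Rightarrow>
    ((nat \<Rightarrow> nat option) \<times> (nat \<times> nat \<Rightarrow> real)) measure" where
  "P_Gaussian_joint n k lam M =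
     measure_pmf (labels_pmf n k M) \<bind> (\<lambda>\<sigma>.
       distr (upper_given_labels n lam M \<sigma>)
         (count_space UNIV \<Otimes>\<^sub>M matrix_space n) (\<lambda>X. (\<sigma>, symmetrize n X)))"

definition P_Gaussian :: "nat \<Rightarrow> real \<Rightarrow> real \<Rightarrow> nat \<Rightarrow> (nat \<times> nat \<Rightarrow> real) measure" where
  "P_Gaussian n k lam M = distr (P_Gaussian_joint n k lam M) (matrix_space n) snd"

definition community :: "nat \<Rightarrow> (nat \<Rightarrow> nat option) \<Rightarrow> nat set" where
  "community n \<sigma> = {i \<in> {1..n}. \<sigma> i = Some 1}"

lemma prob_space_upper_given_labels: "prob_space (upper_given_labels n lam M \<sigma>)"
  unfolding upper_given_labels_def
  by (intro prob_space_PiM prob_space_normal_density) simp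

lemma measurable_symmetrize:
  "symmetrize n \<in> measurable (upper_given_labels n lam M \<sigma>) (matrix_space n)"
proof -
  have "(\<lambda>X. X (min (fst p) (snd p), max (fst p) (snd p)))
      \<in> borel_measurable (upper_given_labels n lam M \<sigma>)" if "p \<in> {1..n} \<times> {1..n}" for p
    unfolding upper_given_labels_def using that
    by (intro measurable_compose[OF measurable_component_singleton]) auto
  then show ?thesis
    unfolding matrix_space_def symmetrize_def case_prod_beta by (rule measurable_restrict)
qed

lemma prob_space_P_Gaussian_joint: "prob_space (P_Gaussian_joint n k lam M)"
  and sets_P_Gaussian_joint:
    "sets (P_Gaussian_joint n k lam M) = sets (count_space UNIV \<Otimes>\<^sub>M matrix_space n)"
proof -
  let ?N = "count_space UNIV \<Otimes>\<^sub>M matrix_space n :: ((nat \<Rightarrow> nat option) \<times> _) measure"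
  let ?K = "\<lambda>\<sigma>. distr (upper_given_labels n lam M \<sigma>) ?N (\<lambda>X. (\<sigma>, symmetrize n X))"
  have K: "prob_space (?K \<sigma>)" for \<sigma>
    by (intro prob_space.prob_space_distr prob_space_upper_given_labels measurable_Pair
        measurable_symmetrize) simp
  have meas: "?K \<in> measurable (measure_pmf (labels_pmf n k M)) (subprob_algebra ?N)"
    using K by (auto simp: space_subprob_algebra prob_space_imp_subprob_space)
  show "prob_space (P_Gaussian_joint n k lam M)"
    unfolding P_Gaussian_joint_def
    by (rule measure_pmf.prob_space_bind[OF _ meas]) (simp add: K)
  show "sets (P_Gaussian_joint n k lam M) = sets ?N"
    unfolding P_Gaussian_joint_def by (rule sets_bind) auto
qed

lemma prob_space_P_Gaussian: "prob_space (P_Gaussian n k lam M)"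
proof -
  have "snd \<in> measurable (P_Gaussian_joint n k lam M) (matrix_space n)"
    by (subst measurable_cong_sets[OF sets_P_Gaussian_joint refl]) simp
  then show ?thesis
    unfolding P_Gaussian_def by (rule prob_space.prob_space_distr[OF prob_space_P_Gaussian_joint])
qed

section \<open>Randomized polynomial-time algorithms on real matrices\<close>

text \<open>
  The inputs are real matrices, so the machine model is the randomized real random access machine
  (real RAM): exact real arithmetic and comparisons, indirect addressing through natural-number
  index registers, and a fresh sample from the standard normal distribution, each at unit cost.
  Index registers can only be added and subtracted, and there is no conversion (rounding) from
  reals to indices: rounding at unit cost would make the model unreasonably powerful.

  The real memory is a family of two-dimensional arrays.  A cell is given by an array name, which
  is fixed in the program, and by two operands, each a literal or an index register.
\<close>

datatype operand = Lit nat | Ireg nat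

type_synonym cell = "nat \<times> operand \<times> operand"

datatype instr =
    Const cell real
  | Copy cell cell
  | Add cell cell cell
  | Sub cell cell cell
  | Mul cell cell cell
  | Div cell cell cell
  | Less cell cell cell  \<comment> \<open>stores 1 or 0, according to the outcome of the comparison\<close>
  | Gauss cell
  | IConst nat nat
  | IAdd nat nat nat
  | ISub nat nat nat
  | JumpPos cell nat
  | IJumpLess nat nat nat

type_synonym program = "instr list"

record config =
  pcount :: nat
  iregs :: "nat \<Rightarrow> nat"
  mem :: "nat \<Rightarrow> nat \<Rightarrow> nat \<Rightarrow> real"
  tapepos :: nat

fun operand_val :: "config \<Rightarrow> operand \<Rightarrow> nat" where
  "operand_val s (Lit c) = c"
| "operand_val s (Ireg r) = iregs s r"

definition rd :: "config \<Rightarrow> cell \<Rightarrow> real" where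
  "rd s = (\<lambda>(a, u, v). mem s a (operand_val s u) (operand_val s v))"

definition wr :: "cell \<Rightarrow> real \<Rightarrow> config \<Rightarrow> config" where
  "wr = (\<lambda>(a, u, v) x s. s\<lparr>mem := (\<lambda>b i j.
     if b = a \<and> i = operand_val s u \<and> j = operand_val s v then x else mem s b i j)\<rparr>)"

definition iwr :: "nat \<Rightarrow> nat \<Rightarrow> config \<Rightarrow> config" where
  "iwr r x s = s\<lparr>iregs := (iregs s)(r := x)\<rparr>"

definition next_instr :: "config \<Rightarrow> config" where
  "next_instr s = s\<lparr>pcount := Suc (pcount s)\<rparr>"

text \<open>The random samples are supplied by a tape \<open>\<omega>\<close>, which is read from left to right.\<close>

fun exec_instr :: "(nat \<Rightarrow> real) \<Rightarrow> instr \<Rightarrow> config \<Rightarrow> config" where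
  "exec_instr \<omega> (Const c x) s = next_instr (wr c x s)"
| "exec_instr \<omega> (Copy c d) s = next_instr (wr c (rd s d) s)"
| "exec_instr \<omega> (Add c d e) s = next_instr (wr c (rd s d + rd s e) s)"
| "exec_instr \<omega> (Sub c d e) s = next_instr (wr c (rd s d - rd s e) s)"
| "exec_instr \<omega> (Mul c d e) s = next_instr (wr c (rd s d * rd s e) s)"
| "exec_instr \<omega> (Div c d e) s = next_instr (wr c (rd s d / rd s e) s)"
| "exec_instr \<omega> (Less c d e) s = next_instr (wr c (if rd s d < rd s e then 1 else 0) s)"
| "exec_instr \<omega> (Gauss c) s =
     next_instr ((wr c (\<omega> (tapepos s)) s)\<lparr>tapepos := Suc (tapepos s)\<rparr>)"
| "exec_instr \<omega> (IConst r m) s = next_instr (iwr r m s)"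
| "exec_instr \<omega> (IAdd r p q) s = next_instr (iwr r (iregs s p + iregs s q) s)"
| "exec_instr \<omega> (ISub r p q) s = next_instr (iwr r (iregs s p - iregs s q) s)"
| "exec_instr \<omega> (JumpPos c l) s = (if rd s c > 0 then s\<lparr>pcount := l\<rparr> else next_instr s)"
| "exec_instr \<omega> (IJumpLess p q l) s =
     (if iregs s p < iregs s q then s\<lparr>pcount := l\<rparr> else next_instr s)"

definition halted :: "program \<Rightarrow> config \<Rightarrow> bool" where
  "halted P s \<longleftrightarrow> pcount s \<ge> length P"

definition step :: "(nat \<Rightarrow> real) \<Rightarrow> program \<Rightarrow> config \<Rightarrow> config" where
  "step \<omega> P s = (if halted P s then s else exec_instr \<omega> (P ! pcount s) s)"

text \<open>The input matrix is stored in array 0; everything else is initially 0.\<close>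

definition init_config :: "nat \<Rightarrow> (nat \<times> nat \<Rightarrow> real) \<Rightarrow> config" where
  "init_config n Y = \<lparr>pcount = 0, iregs = (\<lambda>_. 0),
     mem = (\<lambda>a i j. if a = 0 \<and> i \<in> {1..n} \<and> j \<in> {1..n} then Y (i, j) else 0),
     tapepos = 0\<rparr>"

definition config_after ::
    "nat \<Rightarrow> program \<Rightarrow> (nat \<times> nat \<Rightarrow> real) \<Rightarrow> (nat \<Rightarrow> real) \<Rightarrow> nat \<Rightarrow> config" where
  "config_after n P Y \<omega> t = (step \<omega> P ^^ t) (init_config n Y)"

definition final_config ::
    "nat \<Rightarrow> program \<Rightarrow> (nat \<times> nat \<Rightarrow> real) \<Rightarrow> (nat \<Rightarrow> real) \<Rightarrow> config" where
  "final_config n P Y \<omega> =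
     config_after n P Y \<omega> (LEAST t. halted P (config_after n P Y \<omega> t))"

text \<open>
  A sequence of algorithms provides one program for each \<open>n\<close>; it may depend on \<open>n\<close> and on the
  parameters of the model in an arbitrary way.  The length of the program is bounded along with
  the running time: otherwise a decision tree of exponential size that is hard-wired into the
  program would count as a polynomial-time algorithm.  The bound on the running time is worst
  case, over all symmetric input matrices and all random tapes.
\<close>

definition randomized_poly_time :: "(nat \<Rightarrow> program) \<Rightarrow> bool" where
  "randomized_poly_time A \<longleftrightarrow> (\<exists>p :: nat poly. \<forall>n.
     length (A n) \<le> poly p n \<and>
     (\<forall>Y \<omega>. (\<forall>i j. Y (i, j) = Y (j, i)) \<longrightarrow>
        (\<exists>t \<le> poly p n. halted (A n) (config_after n (A n) Y \<omega> t))))"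

definition random_tape :: "(nat \<Rightarrow> real) measure" where
  "random_tape = PiM UNIV (\<lambda>_. density lborel (\<lambda>x. ennreal (std_normal_density x)))"

text \<open>Outputs are read off array 1: a bit from its cell (0, 0), a vertex set from its cells
  (i, 0) for \<open>i \<in> {1..n}\<close>; a positive entry encodes the bit 1, resp. membership.\<close>

definition output_bit ::
    "nat \<Rightarrow> program \<Rightarrow> (nat \<times> nat \<Rightarrow> real) \<Rightarrow> (nat \<Rightarrow> real) \<Rightarrow> nat" where
  "output_bit n P Y \<omega> = (if mem (final_config n P Y \<omega>) 1 0 0 > 0 then 1 else 0)"

definition output_set ::
    "nat \<Rightarrow> program \<Rightarrow> (nat \<times> nat \<Rightarrow> real) \<Rightarrow> (nat \<Rightarrow> real) \<Rightarrow> nat set" where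
  "output_set n P Y \<omega> = {i \<in> {1..n}. mem (final_config n P Y \<omega>) 1 i 0 > 0}"

section \<open>Strong distinguishing and weak recovery\<close>

definition prob_output_bit ::
    "nat \<Rightarrow> program \<Rightarrow> (nat \<times> nat \<Rightarrow> real) measure \<Rightarrow> nat \<Rightarrow> real" where
  "prob_output_bit n P H b =
     measure (H \<Otimes>\<^sub>M random_tape)
       {(Y, \<omega>) \<in> space (H \<Otimes>\<^sub>M random_tape). output_bit n P Y \<omega> = b}"

definition strongly_distinguishes :: "(nat \<Rightarrow> program) \<Rightarrow>
    (nat \<Rightarrow> (nat \<times> nat \<Rightarrow> real) measure) \<Rightarrow> (nat \<Rightarrow> (nat \<times> nat \<Rightarrow> real) measure) \<Rightarrow> bool" where
  "strongly_distinguishes B H0 H1 \<longleftrightarrow>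
     (\<lambda>n. prob_output_bit n (B n) (H0 n) 1) \<longlonglongrightarrow> 0 \<and>
     (\<lambda>n. prob_output_bit n (B n) (H1 n) 0) \<longlonglongrightarrow> 0"

definition achieves_weak_recovery ::
    "(nat \<Rightarrow> program) \<Rightarrow> (nat \<Rightarrow> real) \<Rightarrow> (nat \<Rightarrow> real) \<Rightarrow> bool" where
  "achieves_weak_recovery A k lam \<longleftrightarrow> (\<exists>\<epsilon>>0.
     (\<lambda>n. measure (P_Gaussian_joint n (k n) (lam n) 1 \<Otimes>\<^sub>M random_tape)
        {((\<sigma>, Y), \<omega>) \<in> space (P_Gaussian_joint n (k n) (lam n) 1 \<Otimes>\<^sub>M random_tape).
           real (card (output_set n (A n) Y \<omega> \<inter> community n \<sigma>)) \<ge> \<epsilon> * k n \<and>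
           real (card (output_set n (A n) Y \<omega>)) \<le> 1.1 * k n}) \<longlonglongrightarrow> 1)"

end

theory Submission
  imports Defs "HOL-Real_Asymp.Real_Asymp"
begin

text \<open>
  Suppose that \<open>A\<close> achieves weak recovery at signal strength \<open>\<lambda>\<close>.  Given a matrix \<open>Y\<close> of strength
  \<open>\<surd>2 \<lambda>\<close> and fresh symmetric Gaussian noise \<open>Z\<close>, the matrices \<open>(Y + Z) / \<surd>2\<close> and \<open>(Y - Z) / \<surd>2\<close>
  are, conditionally on the labels, independent and of strength \<open>\<lambda>\<close>.  Run \<open>A\<close> on the first one to get a
  set \<open>I\<close>.  In the second one, let \<open>E\<close> be the sum of the entries over the edges inside \<open>I\<close>, and \<open>T\<close>
  the sum over the triangles inside \<open>I\<close> of the product of the three entries.  If \<open>I\<close> meets the communities in sets of sizes \<open>a\<^sub>l\<close>, then \<open>E\<close> and \<open>T\<close>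
  are concentrated at \<open>M \<lambda> \<Sum> a\<^sub>l\<^sup>2 / 2\<close> and \<open>(M \<lambda>)\<^sup>3 \<Sum> a\<^sub>l\<^sup>3 / 6\<close>, up to lower order
  terms, as soon as \<open>\<lambda>\<^sup>2 k\<close> tends to infinity and the sizes are not too small.
  Hence \<open>T\<^sup>2 / E\<^sup>3\<close> is about \<open>2/9 \<lambda>\<^sup>3\<close> for one community, whereas the power mean inequality
  bounds it from below by about \<open>8/9 \<lambda>\<^sup>3\<close> for two communities, whatever \<open>I\<close> is.  So comparing
  \<open>T\<^sup>2\<close> with \<open>4/9 \<lambda>\<^sup>3 E\<^sup>3\<close>, and rejecting when \<open>I\<close> is too large or \<open>E\<close> too small, separates the
  two hypotheses at strength \<open>\<surd>2 \<lambda>\<close>.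
\<close>

section \<open>Straight-line programs\<close>

text \<open>Passing to strength \<surd>2 \<lambda> is harmless because the assumption only concerns
  quantities of order o(1). What cloning buys is independence: \<open>I\<close> may depend on its
  own matrix in any way, but given the labels it is independent of the second one, so Chebyshev for
  one fixed set suffices. The ratio T^2 / E^3 is chosen because both parts have degree 6 in the
  unknown overlap, which therefore cancels; the threshold 4/9 is the geometric mean of 2/9 and 8/9.
  The lower bound on \<open>E\<close> makes the test sound for two communities, where nothing is
  known about \<open>I\<close>: it forces an overlap of order k, so that deviations are of lower
  order. The machine model adds two obstacles. \<open>A\<close> has to run as a subroutine that
  finds its memory and registers as in a fresh start and an unread part of the tape, and its running
  time is guaranteed on symmetric matrices only. All other code is branch-free, with real constants
  such as \<surd>2 and the thresholds built in.\<close>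

fun jump_free :: "instr \<Rightarrow> bool" where
  "jump_free (JumpPos c l) = False"
| "jump_free (IJumpLess p q l) = False"
| "jump_free _ = True"

lemma config_update_simps [simp]:
  "pcount (wr c x s) = pcount s" "iregs (wr c x s) = iregs s" "tapepos (wr c x s) = tapepos s"
  "pcount (iwr r y s) = pcount s" "mem (iwr r y s) = mem s" "tapepos (iwr r y s) = tapepos s"
  "iregs (iwr r y s) = (iregs s)(r := y)"
  "pcount (next_instr s) = Suc (pcount s)" "iregs (next_instr s) = iregs s"
  "mem (next_instr s) = mem s" "tapepos (next_instr s) = tapepos s"
  by (auto simp: wr_def iwr_def next_instr_def split: prod.splits)

lemma mem_wr:
  "mem (wr (a, u, v) x s) b i j =
     (if b = a \<and> i = operand_val s u \<and> j = operand_val s v then x else mem s b i j)"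
  by (simp add: wr_def)

lemma pcount_exec_jump_free:
  "jump_free ins \<Longrightarrow> pcount (exec_instr \<omega> ins s) = Suc (pcount s)"
  by (cases ins) auto

text \<open>Without jumps the program counter only advances, so the surrounding code
  \<open>p1\<close> and \<open>p2\<close> is not executed. In the induction each executed
  instruction moves from the block to the prefix, hence the arbitrary \<open>p1\<close>.\<close>

lemma steps_jump_free:
  assumes "list_all jump_free q" "pcount s = length p1"
  shows "(step \<omega> (p1 @ q @ p2) ^^ length q) s = fold (exec_instr \<omega>) q s"
  using assms
proof (induction q arbitrary: p1 s)
  case (Cons i q)
  have "step \<omega> (p1 @ (i # q) @ p2) s = exec_instr \<omega> i s"
    using Cons.prems by (simp add: step_def halted_def)
  then show ?case
    using Cons.IH[of "exec_instr \<omega> i s" "p1 @ [i]"] Cons.prems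
    by (simp add: funpow_Suc_right pcount_exec_jump_free del: funpow.simps)
qed simp

lemma pcount_fold_jump_free:
  "list_all jump_free q \<Longrightarrow> pcount (fold (exec_instr \<omega>) q s) = pcount s + length q"
  by (induction q arbitrary: s) (auto simp: pcount_exec_jump_free)

lemma halted_funpow_step: "halted P s \<Longrightarrow> (step \<omega> P ^^ t) s = s"
  by (induction t) (auto simp: step_def)

text \<open>Halted configurations are fixed points of \<open>step\<close>, so running on from the
  least halting time changes nothing and any halting time may be exhibited.\<close>

lemma final_config_eq:
  assumes "halted P (config_after n P Y \<omega> t)"
  shows "final_config n P Y \<omega> = config_after n P Y \<omega> t"
proof -
  let ?h = "\<lambda>t. halted P (config_after n P Y \<omega> t)"
  have h: "?h (LEAST t. ?h t)" and le: "(LEAST t. ?h t) \<le> t"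
    using assms by (rule LeastI, rule Least_le)
  obtain d where d: "t = d + (LEAST t. ?h t)"
    using le by (metis le_iff_add add.commute)
  have "config_after n P Y \<omega> t = (step \<omega> P ^^ d) (config_after n P Y \<omega> (LEAST t. ?h t))"
    by (subst d) (simp add: config_after_def funpow_add)
  also have "\<dots> = final_config n P Y \<omega>"
    using halted_funpow_step[OF h] by (simp add: final_config_def)
  finally show ?thesis by simp
qed

section \<open>Compilation of arithmetic expressions\<close>

datatype expr = EConst real | ECell nat nat nat | EAdd expr expr | EMul expr expr | ELess expr expr

fun expr_val :: "(nat \<Rightarrow> nat \<Rightarrow> nat \<Rightarrow> real) \<Rightarrow> expr \<Rightarrow> real" where
  "expr_val m (EConst c) = c"
| "expr_val m (ECell a i j) = m a i j"
| "expr_val m (EAdd x y) = expr_val m x + expr_val m y"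
| "expr_val m (EMul x y) = expr_val m x * expr_val m y"
| "expr_val m (ELess x y) = (if expr_val m x < expr_val m y then 1 else 0)"

fun expr_arrays :: "expr \<Rightarrow> nat set" where
  "expr_arrays (EConst c) = {}"
| "expr_arrays (ECell a i j) = {a}"
| "expr_arrays (EAdd x y) = expr_arrays x \<union> expr_arrays y"
| "expr_arrays (EMul x y) = expr_arrays x \<union> expr_arrays y"
| "expr_arrays (ELess x y) = expr_arrays x \<union> expr_arrays y"

text \<open>Column 0 of array \<open>f\<close> is used as a stack: the value of the expression is
  left at height \<open>d\<close>, and only cells at height \<open>d\<close> or above are
  touched.\<close>

fun expr_code :: "nat \<Rightarrow> expr \<Rightarrow> nat \<Rightarrow> instr list" where
  "expr_code f (EConst c) d = [Const (f, Lit d, Lit 0) c]"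
| "expr_code f (ECell a i j) d = [Copy (f, Lit d, Lit 0) (a, Lit i, Lit j)]"
| "expr_code f (EAdd x y) d = expr_code f x d @ expr_code f y (Suc d) @
     [Add (f, Lit d, Lit 0) (f, Lit d, Lit 0) (f, Lit (Suc d), Lit 0)]"
| "expr_code f (EMul x y) d = expr_code f x d @ expr_code f y (Suc d) @
     [Mul (f, Lit d, Lit 0) (f, Lit d, Lit 0) (f, Lit (Suc d), Lit 0)]"
| "expr_code f (ELess x y) d = expr_code f x d @ expr_code f y (Suc d) @
     [Less (f, Lit d, Lit 0) (f, Lit d, Lit 0) (f, Lit (Suc d), Lit 0)]"

fun expr_size :: "expr \<Rightarrow> nat" where
  "expr_size (EAdd x y) = expr_size x + expr_size y + 1"
| "expr_size (EMul x y) = expr_size x + expr_size y + 1"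
| "expr_size (ELess x y) = expr_size x + expr_size y + 1"
| "expr_size _ = 1"

lemma length_expr_code: "length (expr_code f e d) = expr_size e"
  by (induction e arbitrary: d) auto

lemma jump_free_expr_code: "list_all jump_free (expr_code f e d)"
  by (induction e arbitrary: d) auto

lemma expr_val_cong:
  "(\<And>a i j. a \<in> expr_arrays e \<Longrightarrow> m a i j = m' a i j) \<Longrightarrow> expr_val m e = expr_val m' e"
  by (induction e) auto

text \<open>The last conjunct is the stack invariant: evaluating the right operand at height
  \<open>Suc d\<close> leaves the left one in cell \<open>d\<close>. As the expression does not read
  array \<open>f\<close>, the intermediate results cannot change its value.\<close>

lemma fold_expr_code:
  assumes "f \<notin> expr_arrays e"
  shows "iregs (fold (exec_instr \<omega>) (expr_code f e d) s) = iregs s \<and>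
    tapepos (fold (exec_instr \<omega>) (expr_code f e d) s) = tapepos s \<and>
    mem (fold (exec_instr \<omega>) (expr_code f e d) s) f d 0 = expr_val (mem s) e \<and>
    (\<forall>a i j. a \<noteq> f \<or> i < d \<longrightarrow> mem (fold (exec_instr \<omega>) (expr_code f e d) s) a i j = mem s a i j)"
  using assms
proof (induction e arbitrary: d s)
  case (EAdd x y)
  define s1 where "s1 = fold (exec_instr \<omega>) (expr_code f x d) s"
  have "expr_val (mem s1) y = expr_val (mem s) y"
    using EAdd.IH(1)[of d s] EAdd.prems by (intro expr_val_cong) (metis s1_def expr_arrays.simps UnCI)
  then show ?case
    using EAdd.IH(1)[of d s] EAdd.IH(2)[of "Suc d" s1] EAdd.prems
    by (auto simp: mem_wr rd_def s1_def)
next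
  case (EMul x y)
  define s1 where "s1 = fold (exec_instr \<omega>) (expr_code f x d) s"
  have "expr_val (mem s1) y = expr_val (mem s) y"
    using EMul.IH(1)[of d s] EMul.prems by (intro expr_val_cong) (metis s1_def expr_arrays.simps UnCI)
  then show ?case
    using EMul.IH(1)[of d s] EMul.IH(2)[of "Suc d" s1] EMul.prems
    by (auto simp: mem_wr rd_def s1_def)
next
  case (ELess x y)
  define s1 where "s1 = fold (exec_instr \<omega>) (expr_code f x d) s"
  have "expr_val (mem s1) y = expr_val (mem s) y"
    using ELess.IH(1)[of d s] ELess.prems by (intro expr_val_cong) (metis s1_def expr_arrays.simps UnCI)
  then show ?case
    using ELess.IH(1)[of d s] ELess.IH(2)[of "Suc d" s1] ELess.prems
    by (auto simp: mem_wr rd_def s1_def)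
qed (auto simp: mem_wr rd_def)

definition store :: "nat \<Rightarrow> nat \<Rightarrow> nat \<Rightarrow> nat \<Rightarrow> expr \<Rightarrow> instr list" where
  "store f a i j e = expr_code f e 0 @ [Copy (a, Lit i, Lit j) (f, Lit 0, Lit 0)]"

lemma jump_free_store: "list_all jump_free (store f a i j e)"
  by (simp add: store_def jump_free_expr_code)

lemma length_store: "length (store f a i j e) = Suc (expr_size e)"
  by (simp add: store_def length_expr_code)

lemma fold_store:
  assumes "f \<notin> expr_arrays e" "a \<noteq> f"
  shows "iregs (fold (exec_instr \<omega>) (store f a i j e) s) = iregs s"
    and "tapepos (fold (exec_instr \<omega>) (store f a i j e) s) = tapepos s"
    and "b \<noteq> f \<Longrightarrow> mem (fold (exec_instr \<omega>) (store f a i j e) s) b u v =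
       (if b = a \<and> u = i \<and> v = j then expr_val (mem s) e else mem s b u v)"
  using fold_expr_code[OF assms(1), of \<omega> 0 s] assms(2)
  by (auto simp: store_def mem_wr rd_def)

definition stores :: "nat \<Rightarrow> nat \<Rightarrow> (nat \<times> nat \<Rightarrow> expr) \<Rightarrow> (nat \<times> nat) list \<Rightarrow> instr list" where
  "stores f a e ps = concat (map (\<lambda>p. store f a (fst p) (snd p) (e p)) ps)"

lemma jump_free_stores: "list_all jump_free (stores f a e ps)"
  by (induction ps) (auto simp: stores_def jump_free_store)

lemma length_stores:
  "(\<And>p. expr_size (e p) = d) \<Longrightarrow> length (stores f a e ps) = length ps * Suc d"
  by (induction ps) (auto simp: stores_def length_store)

text \<open>No expression reads the array that is written, so the sequential stores amount to one
  simultaneous assignment, and the order of \<open>ps\<close> does not matter.\<close>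

lemma fold_stores:
  assumes "\<And>p. f \<notin> expr_arrays (e p)" "\<And>p. a \<notin> expr_arrays (e p)" "a \<noteq> f"
  shows "iregs (fold (exec_instr \<omega>) (stores f a e ps) s) = iregs s \<and>
    tapepos (fold (exec_instr \<omega>) (stores f a e ps) s) = tapepos s \<and>
    (\<forall>b u v. b \<noteq> f \<longrightarrow> mem (fold (exec_instr \<omega>) (stores f a e ps) s) b u v =
       (if b = a \<and> (u, v) \<in> set ps then expr_val (mem s) (e (u, v)) else mem s b u v))"
proof (induction ps arbitrary: s)
  case (Cons p ps)
  let ?s = "fold (exec_instr \<omega>) (store f a (fst p) (snd p) (e p)) s"
  have st: "fold (exec_instr \<omega>) (stores f a e (p # ps)) s = fold (exec_instr \<omega>) (stores f a e ps) ?s"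
    by (simp add: stores_def)
  note * = fold_store[OF assms(1,3), where \<omega>=\<omega> and s=s]
  have "expr_val (mem ?s) (e q) = expr_val (mem s) (e q)" for q
  proof (rule expr_val_cong)
    fix b i j assume "b \<in> expr_arrays (e q)"
    then have "b \<noteq> a" "b \<noteq> f" using assms by metis+
    then show "mem ?s b i j = mem s b i j" by (simp add: *)
  qed
  then show ?case
    unfolding st using Cons.IH[of ?s] * by (cases p) auto
qed (simp add: stores_def)

definition gausses :: "nat \<Rightarrow> (nat \<times> nat) list \<Rightarrow> instr list" where
  "gausses a ps = map (\<lambda>p. Gauss (a, Lit (fst p), Lit (snd p))) ps"

lemma jump_free_gausses: "list_all jump_free (gausses a ps)"
  by (induction ps) (auto simp: gausses_def)

text \<open>In a list with repetitions a later sample would overwrite an earlier one;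
  \<open>distinct\<close> ensures that cell number q keeps sample number q.\<close>

lemma fold_gausses:
  assumes "distinct ps"
  shows "iregs (fold (exec_instr \<omega>) (gausses a ps) s) = iregs s \<and>
    tapepos (fold (exec_instr \<omega>) (gausses a ps) s) = tapepos s + length ps \<and>
    (\<forall>b u v. b \<noteq> a \<or> (u, v) \<notin> set ps \<longrightarrow>
       mem (fold (exec_instr \<omega>) (gausses a ps) s) b u v = mem s b u v) \<and>
    (\<forall>q < length ps.
       mem (fold (exec_instr \<omega>) (gausses a ps) s) a (fst (ps ! q)) (snd (ps ! q)) = \<omega> (tapepos s + q))"
  using assms
proof (induction ps arbitrary: s)
  case (Cons p ps)
  let ?s = "exec_instr \<omega> (Gauss (a, Lit (fst p), Lit (snd p))) s"
  have st: "fold (exec_instr \<omega>) (gausses a (p # ps)) s = fold (exec_instr \<omega>) (gausses a ps) ?s"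
    by (simp add: gausses_def)
  have s: "iregs ?s = iregs s" "tapepos ?s = Suc (tapepos s)"
    "mem ?s b u v = (if b = a \<and> (u, v) = p then \<omega> (tapepos s) else mem s b u v)" for b u v
    by (auto simp: mem_wr)
  have dist: "distinct ps" and p: "(fst p, snd p) \<notin> set ps"
    using Cons.prems by auto
  note IH = Cons.IH[OF dist, of ?s, unfolded s]
  have "mem (fold (exec_instr \<omega>) (gausses a ps) ?s) a (fst ((p # ps) ! q)) (snd ((p # ps) ! q)) =
     \<omega> (tapepos s + q)" if "q < length (p # ps)" for q
    using that IH p by (cases q) auto
  moreover have "mem (fold (exec_instr \<omega>) (gausses a ps) ?s) b u v = mem s b u v"
    if "b \<noteq> a \<or> (u, v) \<notin> set (p # ps)" for b u v
    using IH that by auto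
  ultimately show ?case
    unfolding st using IH by auto
qed (simp add: gausses_def)

section \<open>Relocating a program\<close>

fun cells :: "instr \<Rightarrow> cell set" where
  "cells (Const c x) = {c}"
| "cells (Copy c d) = {c, d}"
| "cells (Add c d e) = {c, d, e}"
| "cells (Sub c d e) = {c, d, e}"
| "cells (Mul c d e) = {c, d, e}"
| "cells (Div c d e) = {c, d, e}"
| "cells (Less c d e) = {c, d, e}"
| "cells (Gauss c) = {c}"
| "cells (JumpPos c l) = {c}"
| "cells _ = {}"

fun relocate :: "nat \<Rightarrow> nat \<Rightarrow> instr \<Rightarrow> instr" where
  "relocate off L (JumpPos c l) = JumpPos c (off + min l L)"
| "relocate off L (IJumpLess p q l) = IJumpLess p q (off + min l L)"
| "relocate off L i = i"

text \<open>The program counter is truncated because a program may halt by jumping beyond its end.\<close>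

definition simulates :: "nat \<Rightarrow> nat \<Rightarrow> nat \<Rightarrow> nat \<Rightarrow> config \<Rightarrow> config \<Rightarrow> config \<Rightarrow> bool" where
  "simulates off L f m s0 s s' \<longleftrightarrow> iregs s' = iregs s \<and> tapepos s' = m + tapepos s \<and>
     pcount s' = off + min (pcount s) L \<and>
     (\<forall>a i j. mem s' a i j = (if a < f then mem s a i j else mem s0 a i j))"

lemma operand_val_cong: "iregs s' = iregs s \<Longrightarrow> operand_val s' u = operand_val s u"
  by (cases u) auto

lemma simulates_rd:
  "simulates off L f m s0 s s' \<Longrightarrow> fst c < f \<Longrightarrow> rd s' c = rd s c"
  by (cases c) (auto simp: rd_def simulates_def operand_val_cong[of s' s])

lemma simulates_wr:
  "simulates off L f m s0 s s' \<Longrightarrow> fst c < f \<Longrightarrow> pcount s < L \<Longrightarrow>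
     simulates off L f m s0 (next_instr (wr c x s)) (next_instr (wr c x s'))"
  by (cases c) (auto simp: simulates_def mem_wr operand_val_cong[of s' s])

text \<open>Both runs have equal index registers and agree on the arrays below \<open>f\<close>; the
  subroutine sees the tape shifted by \<open>m\<close> because \<open>m\<close> samples have been
  consumed before it starts. Hence an instruction that mentions only arrays below \<open>f\<close>
  acts in the same way on both sides.\<close>

lemma simulates_exec:
  assumes sim: "simulates off L f m s0 s s'" and lt: "pcount s < L"
    and c: "\<And>c. c \<in> cells ins \<Longrightarrow> fst c < f"
  shows "simulates off L f m s0 (exec_instr (\<lambda>t. \<omega> (m + t)) ins s) (exec_instr \<omega> (relocate off L ins) s')"
proof -
  have rd: "rd s' c = rd s c" if "c \<in> cells ins" for c
    using simulates_rd[OF sim c[OF that]] .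
  note wr = simulates_wr[OF sim _ lt]
  have tp: "tapepos s' = m + tapepos s"
    using sim by (simp add: simulates_def)
  show ?thesis
  proof (cases ins)
    case (Gauss c)
    have "simulates off L f m s0 (next_instr (wr c (\<omega> (m + tapepos s)) s))
        (next_instr (wr c (\<omega> (m + tapepos s)) s'))"
      using c Gauss by (intro wr) auto
    then show ?thesis by (simp add: Gauss tp simulates_def next_instr_def)
  next
    case (IConst r x)
    then show ?thesis using sim lt by (auto simp: simulates_def)
  next
    case (IAdd r p q)
    then show ?thesis using sim lt by (auto simp: simulates_def)
  next
    case (ISub r p q)
    then show ?thesis using sim lt by (auto simp: simulates_def)
  next
    case (JumpPos c l)
    then show ?thesis using sim lt rd[of c] by (auto simp: simulates_def)
  next
    case (IJumpLess p q l)
    then show ?thesis using sim lt by (auto simp: simulates_def)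
  qed (use c rd wr in \<open>auto\<close>)
qed

lemma simulates_step:
  assumes sim: "simulates (length p1) (length A) f m s0 s s'"
    and c: "\<And>ins c. ins \<in> set A \<Longrightarrow> c \<in> cells ins \<Longrightarrow> fst c < f"
    and nh: "\<not> halted A s"
  shows "simulates (length p1) (length A) f m s0 (step (\<lambda>t. \<omega> (m + t)) A s)
     (step \<omega> (p1 @ map (relocate (length p1) (length A)) A @ p2) s')"
proof -
  have lt: "pcount s < length A" using nh by (simp add: halted_def)
  have pc: "pcount s' = length p1 + pcount s" using sim lt by (simp add: simulates_def)
  have "step \<omega> (p1 @ map (relocate (length p1) (length A)) A @ p2) s' =
      exec_instr \<omega> (relocate (length p1) (length A) (A ! pcount s)) s'"
    using lt pc by (simp add: step_def halted_def nth_append)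
  moreover have "step (\<lambda>t. \<omega> (m + t)) A s = exec_instr (\<lambda>t. \<omega> (m + t)) (A ! pcount s) s"
    using nh by (simp add: step_def)
  ultimately show ?thesis
    using simulates_exec[OF sim lt, of "A ! pcount s"] c[of "A ! pcount s"] lt by simp
qed

text \<open>The comparison stops at the first halting time of \<open>A\<close>: from then on
  \<open>A\<close> stands still, whereas the embedded copy goes on into \<open>p2\<close>.\<close>

lemma simulates_steps:
  assumes sim: "simulates (length p1) (length A) f m s0 s s'"
    and c: "\<And>ins c. ins \<in> set A \<Longrightarrow> c \<in> cells ins \<Longrightarrow> fst c < f"
    and nh: "\<And>u. u < t \<Longrightarrow> \<not> halted A ((step (\<lambda>t. \<omega> (m + t)) A ^^ u) s)"
  shows "simulates (length p1) (length A) f m s0 ((step (\<lambda>t. \<omega> (m + t)) A ^^ t) s)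
     ((step \<omega> (p1 @ map (relocate (length p1) (length A)) A @ p2) ^^ t) s')"
  using nh by (induction t) (auto intro!: simulates_step sim c)

text \<open>The sum of all array names is a crude bound for each of them; the two successors make it
  strict and keep the input array 0 and the output array 1 below it, even when the program mentions
  neither.\<close>

definition fresh_array :: "program \<Rightarrow> nat" where
  "fresh_array A = Suc (Suc (\<Sum>ins\<leftarrow>A. \<Sum>c\<in>cells ins. fst c))"

lemma finite_cells: "finite (cells ins)"
  by (cases ins) auto

lemma fresh_array_gt:
  assumes "ins \<in> set A" "c \<in> cells ins"
  shows "fst c < fresh_array A"
proof -
  have "fst c \<le> (\<Sum>c\<in>cells ins. fst c)"
    using assms finite_cells by (intro member_le_sum) auto
  also have "\<dots> \<le> (\<Sum>ins\<leftarrow>A. \<Sum>c\<in>cells ins. fst c)"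
    using assms by (intro member_le_sum_list) auto
  finally show ?thesis by (simp add: fresh_array_def)
qed

section \<open>Two clones of the input matrix\<close>

definition index_pairs :: "nat \<Rightarrow> (nat \<times> nat) list" where
  "index_pairs n = List.product [1..<Suc n] [1..<Suc n]"

lemma index_pairs [simp]:
  "set (index_pairs n) = {1..n} \<times> {1..n}" "distinct (index_pairs n)" "length (index_pairs n) = n\<^sup>2"
  unfolding index_pairs_def
  by (auto simp del: upt_Suc intro!: distinct_product simp: power2_eq_square)

text \<open>The Gaussians are drawn in the order of \<open>index_pairs n\<close>, so this inverse of
  the enumeration is the tape position of the sample for a given entry.\<close>

definition noise_index :: "nat \<Rightarrow> nat \<times> nat \<Rightarrow> nat" where
  "noise_index n = inv_into {..<n\<^sup>2} ((!) (index_pairs n))"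

lemma noise_index:
  assumes "p \<in> {1..n} \<times> {1..n}"
  shows "index_pairs n ! noise_index n p = p" "noise_index n p < n\<^sup>2"
proof -
  have "p \<in> (!) (index_pairs n) ` {..<n\<^sup>2}"
    using assms index_pairs(1,3)[of n] by (metis in_set_conv_nth imageI lessThan_iff)
  from f_inv_into_f[OF this] inv_into_into[OF this]
  show "index_pairs n ! noise_index n p = p" "noise_index n p < n\<^sup>2"
    by (auto simp: noise_index_def)
qed

lemma inj_on_noise_index: "inj_on (noise_index n) ({1..n} \<times> {1..n})"
  by (rule inj_on_inverseI[where g="(!) (index_pairs n)"]) (rule noise_index)

text \<open>Only the upper triangle of samples is used. This keeps both clones symmetric, as the
  time bound of \<open>A\<close> requires, and matches the model, which draws one Gaussian for each
  pair with i \<le> j.\<close>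

definition noise :: "nat \<Rightarrow> (nat \<Rightarrow> real) \<Rightarrow> nat \<times> nat \<Rightarrow> real" where
  "noise n \<omega> p = \<omega> (noise_index n (min (fst p) (snd p), max (fst p) (snd p)))"

definition first_clone :: "nat \<Rightarrow> (nat \<times> nat \<Rightarrow> real) \<Rightarrow> (nat \<Rightarrow> real) \<Rightarrow> nat \<times> nat \<Rightarrow> real" where
  "first_clone n Y \<omega> p = (Y p + noise n \<omega> p) / sqrt 2"

definition second_clone :: "nat \<Rightarrow> (nat \<times> nat \<Rightarrow> real) \<Rightarrow> (nat \<Rightarrow> real) \<Rightarrow> nat \<times> nat \<Rightarrow> real" where
  "second_clone n Y \<omega> p = (Y p - noise n \<omega> p) / sqrt 2"

definition second_clone_expr :: "nat \<Rightarrow> nat \<times> nat \<Rightarrow> expr" where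
  "second_clone_expr f = (\<lambda>(i, j). EMul (EConst (1 / sqrt 2))
     (EAdd (ECell 0 i j) (EMul (EConst (-1)) (ECell (f + 1) (min i j) (max i j)))))"

text \<open>The first clone is recovered from the second as (Y - Z) / \<surd>2 + \<surd>2 Z instead
  of being computed from \<open>Y\<close>, so that array 0 can be overwritten in place without being
  read.\<close>

definition first_clone_expr :: "nat \<Rightarrow> nat \<times> nat \<Rightarrow> expr" where
  "first_clone_expr f = (\<lambda>(i, j).
     EAdd (ECell (f + 2) i j) (EMul (EConst (sqrt 2)) (ECell (f + 1) (min i j) (max i j))))"

text \<open>Array \<open>f + 1\<close> holds the noise, of which only the upper triangle is used, array \<open>f + 2\<close> the
  second clone, and array \<open>f\<close> intermediate results.  The first clone overwrites the input.\<close>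

definition cloning_code :: "nat \<Rightarrow> nat \<Rightarrow> instr list" where
  "cloning_code n f = gausses (f + 1) (index_pairs n) @
     stores f (f + 2) (second_clone_expr f) (index_pairs n) @
     stores f 0 (first_clone_expr f) (index_pairs n)"

lemma jump_free_cloning_code: "list_all jump_free (cloning_code n f)"
  by (simp add: cloning_code_def jump_free_gausses jump_free_stores)

lemma length_cloning_code: "length (cloning_code n f) = 15 * n\<^sup>2"
  by (simp add: cloning_code_def gausses_def length_stores[where d=7] length_stores[where d=5]
      second_clone_expr_def first_clone_expr_def split: prod.splits)

text \<open>The fourth claim is where the simulation of \<open>A\<close> starts: below
  \<open>f\<close> the memory cannot be told apart from an initial configuration whose input is the
  first clone.\<close>

lemma fold_cloning_code:
  fixes n f Y \<omega>
  assumes f: "f \<ge> 2"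
  defines "s \<equiv> fold (exec_instr \<omega>) (cloning_code n f) (init_config n Y)"
  shows "iregs s = (\<lambda>_. 0)" "tapepos s = n\<^sup>2" "pcount s = 15 * n\<^sup>2"
    and "a < f \<Longrightarrow> mem s a i j = mem (init_config n (first_clone n Y \<omega>)) a i j"
    and "i \<in> {1..n} \<Longrightarrow> j \<in> {1..n} \<Longrightarrow> mem s (f + 2) i j = second_clone n Y \<omega> (i, j)"
proof -
  define s1 where "s1 = fold (exec_instr \<omega>) (gausses (f + 1) (index_pairs n)) (init_config n Y)"
  define s2 where "s2 = fold (exec_instr \<omega>) (stores f (f + 2) (second_clone_expr f) (index_pairs n)) s1"
  have s: "s = fold (exec_instr \<omega>) (stores f 0 (first_clone_expr f) (index_pairs n)) s2"
    by (simp add: s_def s1_def s2_def cloning_code_def)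
  have arr: "expr_arrays (second_clone_expr f p) = {0, f + 1}"
    "expr_arrays (first_clone_expr f p) = {f + 1, f + 2}" for p
    by (auto simp: second_clone_expr_def first_clone_expr_def split: prod.splits)
  note f1 = fold_gausses[OF index_pairs(2)[of n], where s="init_config n Y" and \<omega>=\<omega> and a="f + 1", folded s1_def]
  have f2: "iregs s2 = iregs s1 \<and> tapepos s2 = tapepos s1 \<and>
    (\<forall>b u v. b \<noteq> f \<longrightarrow> mem s2 b u v = (if b = f + 2 \<and> (u, v) \<in> set (index_pairs n)
        then expr_val (mem s1) (second_clone_expr f (u, v)) else mem s1 b u v))"
    unfolding s2_def using f by (intro fold_stores) (auto simp: arr)
  have f3: "iregs s = iregs s2 \<and> tapepos s = tapepos s2 \<and>
    (\<forall>b u v. b \<noteq> f \<longrightarrow> mem s b u v = (if b = 0 \<and> (u, v) \<in> set (index_pairs n)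
        then expr_val (mem s2) (first_clone_expr f (u, v)) else mem s2 b u v))"
    unfolding s using f by (intro fold_stores) (auto simp: arr)
  have noise: "mem s1 (f + 1) (min i j) (max i j) = noise n \<omega> (i, j)"
    if "i \<in> {1..n}" "j \<in> {1..n}" for i j
  proof -
    have p: "(min i j, max i j) \<in> {1..n} \<times> {1..n}" using that by auto
    show ?thesis
      using f1[THEN conjunct2, THEN conjunct2, THEN conjunct2, rule_format, of "noise_index n (min i j, max i j)"]
        noise_index[OF p] by (simp add: noise_def init_config_def)
  qed
  show "iregs s = (\<lambda>_. 0)" "tapepos s = n\<^sup>2"
    using f1 f2 f3 by (simp_all add: init_config_def)
  show "pcount s = 15 * n\<^sup>2"
    using pcount_fold_jump_free[OF jump_free_cloning_code, of \<omega> n f "init_config n Y"]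
    by (simp add: s_def length_cloning_code init_config_def)
  have s2: "mem s2 (f + 2) i j = second_clone n Y \<omega> (i, j)" "mem s1 0 i j = Y (i, j)"
     "mem s2 (f + 1) (min i j) (max i j) = noise n \<omega> (i, j)"
    if ij: "i \<in> {1..n}" "j \<in> {1..n}" for i j
  proof -
    show s1: "mem s1 0 i j = Y (i, j)"
      using f1 ij by (simp add: init_config_def)
    show "mem s2 (f + 2) i j = second_clone n Y \<omega> (i, j)"
      using f2 noise[OF ij] ij s1 by (simp add: second_clone_expr_def second_clone_def)
    show "mem s2 (f + 1) (min i j) (max i j) = noise n \<omega> (i, j)"
      using f2 noise[OF ij] by simp
  qed
  show "mem s (f + 2) i j = second_clone n Y \<omega> (i, j)" if "i \<in> {1..n}" "j \<in> {1..n}"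
    using f3 s2[OF that] f by simp
  show "mem s a i j = mem (init_config n (first_clone n Y \<omega>)) a i j" if a: "a < f"
  proof (cases "a = 0 \<and> i \<in> {1..n} \<and> j \<in> {1..n}")
    case True
    then have "mem s a i j = second_clone n Y \<omega> (i, j) + sqrt 2 * noise n \<omega> (i, j)"
      using f3 f s2[of i j] by (simp add: first_clone_expr_def)
    also have "\<dots> = first_clone n Y \<omega> (i, j)"
      by (simp add: second_clone_def first_clone_def field_simps)
    finally show ?thesis using True by (simp add: init_config_def)
  next
    case False
    have "mem s a i j = mem (init_config n Y) a i j"
      using False f3 f2 f1 a by auto
    then show ?thesis using False by (auto simp: init_config_def)
  qed
qed

section \<open>The test program\<close>

definition edges :: "nat set \<Rightarrow> (nat \<times> nat) set" where
  "edges I = {(i, j). i \<in> I \<and> j \<in> I \<and> i < j}"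

definition triangles :: "nat set \<Rightarrow> (nat \<times> nat \<times> nat) set" where
  "triangles I = {(i, j, l). i \<in> I \<and> j \<in> I \<and> l \<in> I \<and> i < j \<and> j < l}"

definition edge_sum :: "nat set \<Rightarrow> (nat \<times> nat \<Rightarrow> real) \<Rightarrow> real" where
  "edge_sum I X = (\<Sum>p\<in>edges I. X p)"

definition triangle_sum :: "nat set \<Rightarrow> (nat \<times> nat \<Rightarrow> real) \<Rightarrow> real" where
  "triangle_sum I X = (\<Sum>(i, j, l)\<in>triangles I. X (i, j) * X (j, l) * X (i, l))"

text \<open>The third clause is T^2 / E^3 > c with the division cleared. The first two leave only
  sets for which this comparison is informative: the deviation bounds need a bound on |I|, and a
  small \<open>E\<close> could be pure noise.\<close>

definition rejects :: "real \<Rightarrow> real \<Rightarrow> real \<Rightarrow> nat set \<Rightarrow> (nat \<times> nat \<Rightarrow> real) \<Rightarrow> bool" where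
  "rejects r0 e0 c I X \<longleftrightarrow> r0 < real (card I) \<or> edge_sum I X < e0 \<or>
     c * edge_sum I X ^ 3 < (triangle_sum I X)\<^sup>2"

definition sum_expr :: "expr list \<Rightarrow> expr" where
  "sum_expr es = foldr EAdd es (EConst 0)"

lemma expr_val_sum_expr: "expr_val m (sum_expr es) = (\<Sum>e\<leftarrow>es. expr_val m e)"
  by (induction es) (auto simp: sum_expr_def)

lemma expr_arrays_sum_expr: "expr_arrays (sum_expr es) = (\<Union>e\<in>set es. expr_arrays e)"
  by (induction es) (auto simp: sum_expr_def)

lemma expr_size_sum_expr:
  "(\<And>e. e \<in> set es \<Longrightarrow> expr_size e = d) \<Longrightarrow> expr_size (sum_expr es) = length es * Suc d + 1"
  by (induction es) (auto simp: sum_expr_def)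

definition bit_expr :: "nat \<Rightarrow> expr" where
  "bit_expr i = ELess (EConst 0) (ECell 1 i 0)"

definition card_expr :: "nat \<Rightarrow> expr" where
  "card_expr n = sum_expr (map bit_expr [1..<Suc n])"

definition edge_expr :: "nat \<Rightarrow> nat \<Rightarrow> expr" where
  "edge_expr g n = sum_expr (map (\<lambda>(i, j). EMul (EMul (bit_expr i) (bit_expr j)) (ECell g i j))
     (filter (\<lambda>(i, j). i < j) (index_pairs n)))"

definition triangle_expr :: "nat \<Rightarrow> nat \<Rightarrow> expr" where
  "triangle_expr g n = sum_expr (map (\<lambda>(i, j, l).
       EMul (EMul (bit_expr i) (EMul (bit_expr j) (bit_expr l)))
         (EMul (EMul (ECell g i j) (ECell g j l)) (ECell g i l)))
     (filter (\<lambda>(i, j, l). i < j \<and> j < l) (List.product [1..<Suc n] (index_pairs n))))"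

text \<open>Adding the three indicators encodes the disjunction, since the output bit is read as
  positivity. Common subexpressions are repeated, which costs only a constant factor.\<close>

definition test_expr :: "nat \<Rightarrow> nat \<Rightarrow> real \<Rightarrow> real \<Rightarrow> real \<Rightarrow> expr" where
  "test_expr g n r0 e0 c =
     EAdd (ELess (EConst r0) (card_expr n))
    (EAdd (ELess (edge_expr g n) (EConst e0))
          (ELess (EMul (EConst c) (EMul (edge_expr g n) (EMul (edge_expr g n) (edge_expr g n))))
                 (EMul (triangle_expr g n) (triangle_expr g n))))"

lemma expr_arrays_test_expr: "expr_arrays (test_expr g n r0 e0 c) \<subseteq> {1, g}"
  by (auto simp: test_expr_def card_expr_def edge_expr_def triangle_expr_def bit_expr_def
      expr_arrays_sum_expr split: prod.splits)

lemma expr_size_test_expr: "expr_size (test_expr g n r0 e0 c) \<le> 200 * (n + 1) ^ 3"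
proof -
  have b: "expr_size (bit_expr i) = 3" for i by (simp add: bit_expr_def)
  have "expr_size (card_expr n) = n * 4 + 1"
    unfolding card_expr_def by (subst expr_size_sum_expr[where d=3]) (auto simp: b)
  moreover have "expr_size (edge_expr g n) \<le> n\<^sup>2 * 10 + 1"
    unfolding edge_expr_def
    by (subst expr_size_sum_expr[where d=9])
      (auto simp: b intro: order_trans[OF length_filter_le])
  moreover have "expr_size (triangle_expr g n) \<le> n ^ 3 * 18 + 1"
    unfolding triangle_expr_def
    by (subst expr_size_sum_expr[where d=17])
      (auto simp: b power3_eq_cube power2_eq_square simp del: upt_Suc
        intro!: order_trans[OF length_filter_le])
  \<comment> \<open>\<open>edge_expr\<close> occurs four times and \<open>triangle_expr\<close>
    twice.\<close>
  ultimately have "expr_size (test_expr g n r0 e0 c) \<le> 40 + 4 * n + 40 * n\<^sup>2 + 36 * n ^ 3"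
    by (simp add: test_expr_def)
  also have "\<dots> \<le> 200 * (n + 1) ^ 3"
    by (simp add: power3_eq_cube power2_eq_square algebra_simps)
  finally show ?thesis .
qed

lemma finite_edges: "finite I \<Longrightarrow> finite (edges I)"
  by (rule finite_subset[of _ "I \<times> I"]) (auto simp: edges_def)

lemma finite_triangles: "finite I \<Longrightarrow> finite (triangles I)"
  by (rule finite_subset[of _ "I \<times> I \<times> I"]) (auto simp: triangles_def)

lemma expr_val_test_expr:
  fixes m n g
  assumes X: "\<And>i j. i \<in> {1..n} \<Longrightarrow> j \<in> {1..n} \<Longrightarrow> m g i j = X (i, j)"
  defines "I \<equiv> {i \<in> {1..n}. m 1 i 0 > 0}"
  shows "expr_val m (test_expr g n r0 e0 c) > 0 \<longleftrightarrow> rejects r0 e0 c I X"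
proof -
  have b: "expr_val m (bit_expr i) = (if m 1 i 0 > 0 then 1 else 0)" for i
    by (simp add: bit_expr_def)
  have "expr_val m (card_expr n) = (\<Sum>i\<in>{1..n}. if m 1 i 0 > 0 then 1 else 0)"
    by (simp only: card_expr_def expr_val_sum_expr map_map comp_def distinct_upt
        sum_list_distinct_conv_sum_set set_upt atLeastLessThanSuc_atLeastAtMost b)
  also have "\<dots> = real (card I)"
    by (subst sum.inter_filter[symmetric]) (auto simp: I_def)
  finally have R: "expr_val m (card_expr n) = real (card I)" .
  have "expr_val m (edge_expr g n) =
      (\<Sum>(i, j)\<in>edges {1..n}. expr_val m (bit_expr i) * expr_val m (bit_expr j) * m g i j)"
    unfolding edge_expr_def expr_val_sum_expr map_map
    by (subst sum_list_distinct_conv_sum_set)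
      (auto simp: edges_def simp del: upt_Suc intro!: sum.cong)
  also have "\<dots> = edge_sum I X"
    unfolding edge_sum_def
    by (rule sum.mono_neutral_cong_right)
      (auto simp: finite_edges, auto simp: edges_def I_def X b)
  finally have E: "expr_val m (edge_expr g n) = edge_sum I X" .
  have "expr_val m (triangle_expr g n) = (\<Sum>(i, j, l)\<in>triangles {1..n}.
      (expr_val m (bit_expr i) * (expr_val m (bit_expr j) * expr_val m (bit_expr l))) *
      (m g i j * m g j l * m g i l))"
    unfolding triangle_expr_def expr_val_sum_expr map_map
    by (subst sum_list_distinct_conv_sum_set)
      (auto simp: triangles_def simp del: upt_Suc intro!: sum.cong distinct_filter distinct_product)
  also have "\<dots> = triangle_sum I X"
    unfolding triangle_sum_def
    by (rule sum.mono_neutral_cong_right)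
      (auto simp: finite_triangles, auto simp: triangles_def I_def X b)
  finally have T: "expr_val m (triangle_expr g n) = triangle_sum I X" .
  show ?thesis
    by (auto simp: test_expr_def R E T rejects_def power2_eq_square power3_eq_cube algebra_simps)
qed

text \<open>The second clone lies in array \<open>fresh_array A + 2\<close>, out of reach of
  \<open>A\<close>, and is therefore intact when the test reads it. The offset
  \<open>15 * n\<^sup>2\<close> is the length of the cloning code.\<close>

definition test_program :: "nat \<Rightarrow> program \<Rightarrow> real \<Rightarrow> real \<Rightarrow> real \<Rightarrow> program" where
  "test_program n A r0 e0 c =
     cloning_code n (fresh_array A) @
     map (relocate (15 * n\<^sup>2) (length A)) A @
     store (fresh_array A) 1 0 0 (test_expr (fresh_array A + 2) n r0 e0 c)"

lemma length_test_program: "length (test_program n A r0 e0 c) \<le> 216 * (n + 1) ^ 3 + length A"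
proof -
  \<comment> \<open>The budget: 16 (n + 1)^3 for the cloning code and the final \<open>Copy\<close>,
    200 (n + 1)^3 for the test expression.\<close>
  have "15 * n\<^sup>2 + 1 \<le> 16 * (n + 1) ^ 3"
    by (simp add: power3_eq_cube power2_eq_square algebra_simps)
  then show ?thesis
    using expr_size_test_expr[of "fresh_array A + 2" n r0 e0 c]
    by (simp add: test_program_def length_cloning_code length_store)
qed

lemma test_program_correct:
  fixes n A r0 e0 c Y and \<omega> :: "nat \<Rightarrow> real"
  defines "P \<equiv> test_program n A r0 e0 c"
  defines "Y1 \<equiv> first_clone n Y \<omega>" and "\<omega>' \<equiv> (\<lambda>t. \<omega> (n\<^sup>2 + t))"
  assumes t0: "t0 \<le> b" "halted A (config_after n A Y1 \<omega>' t0)"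
  shows "\<exists>t \<le> 216 * (n + 1) ^ 3 + b. halted P (config_after n P Y \<omega> t)"
    and "output_bit n P Y \<omega> =
      (if rejects r0 e0 c (output_set n A Y1 \<omega>') (second_clone n Y \<omega>) then 1 else 0)"
proof -
  define f where "f = fresh_array A"
  have f2: "f \<ge> 2" by (simp add: f_def fresh_array_def)
  define pre where "pre = cloning_code n f"
  define e where "e = test_expr (f + 2) n r0 e0 c"
  define post where "post = store f 1 0 0 e"
  define A' where "A' = map (relocate (length pre) (length A)) A"
  have len: "length pre = 15 * n\<^sup>2" by (simp add: pre_def length_cloning_code)
  have P: "P = pre @ A' @ post"
    unfolding P_def test_program_def pre_def post_def A'_def e_def f_def length_cloning_code ..
  \<comment> \<open>The simulation is valid only up to the first halting time, so the given time
    \<open>t0\<close> is replaced by the least one.\<close>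
  define t where "t = (LEAST t. halted A (config_after n A Y1 \<omega>' t))"
  have ht: "halted A (config_after n A Y1 \<omega>' t)" and tb: "t \<le> b"
    using t0 LeastI[of "\<lambda>t. halted A (config_after n A Y1 \<omega>' t)" t0]
      Least_le[of "\<lambda>t. halted A (config_after n A Y1 \<omega>' t)" t0]
    by (auto simp: t_def)
  have nh: "\<not> halted A ((step \<omega>' A ^^ u) (init_config n Y1))" if "u < t" for u
    using not_less_Least[of u "\<lambda>t. halted A (config_after n A Y1 \<omega>' t)"] that
    by (simp add: t_def config_after_def)
  define s0 where "s0 = fold (exec_instr \<omega>) pre (init_config n Y)"
  have s0: "(step \<omega> P ^^ length pre) (init_config n Y) = s0"
    using steps_jump_free[of pre "init_config n Y" "[]" \<omega> "A' @ post"] jump_free_cloning_code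
    by (simp add: s0_def P pre_def init_config_def)
  note cl = fold_cloning_code[OF f2, where \<omega>=\<omega> and n=n and Y=Y, folded pre_def, folded s0_def, folded Y1_def]
  have "simulates (length pre) (length A) f (n\<^sup>2) s0 (init_config n Y1) s0"
    unfolding simulates_def using cl by (simp add: init_config_def len)
  from simulates_steps[OF this, where \<omega>=\<omega> and t=t and ?p2.0=post, folded \<omega>'_def A'_def, folded P]
  have sim: "simulates (length pre) (length A) f (n\<^sup>2) s0 (config_after n A Y1 \<omega>' t) ((step \<omega> P ^^ t) s0)"
    using nh fresh_array_gt unfolding config_after_def f_def by blast
  define s1 where "s1 = (step \<omega> P ^^ t) s0"
  have "pcount s1 = length (pre @ A')"
    using sim ht by (simp add: s1_def simulates_def halted_def A'_def)
  from steps_jump_free[OF jump_free_store this, of f 1 0 0 e \<omega> "[]"]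
  have s2: "(step \<omega> P ^^ length post) s1 = fold (exec_instr \<omega>) post s1"
    by (simp add: P post_def)
  define T where "T = length post + t + length pre"
  have cT: "config_after n P Y \<omega> T = fold (exec_instr \<omega>) post s1"
    unfolding config_after_def T_def funpow_add comp_def s0 s1_def[symmetric] s2 ..
  have h: "halted P (config_after n P Y \<omega> T)"
    unfolding cT halted_def
    using pcount_fold_jump_free[OF jump_free_store, of \<omega> f 1 0 0 e s1] \<open>pcount s1 = _\<close>
    by (simp add: P post_def)
  have "length post + length pre \<le> 216 * (n + 1) ^ 3"
  proof -
    have "15 * n\<^sup>2 + 1 \<le> 16 * (n + 1) ^ 3"
      by (simp add: power3_eq_cube power2_eq_square algebra_simps)
    then show ?thesis
      using expr_size_test_expr[of "f + 2" n r0 e0 c]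
      by (simp add: post_def e_def length_store len)
  qed
  then show "\<exists>t \<le> 216 * (n + 1) ^ 3 + b. halted P (config_after n P Y \<omega> t)"
    using h tb by (intro exI[of _ T]) (auto simp: T_def)
  have ar: "f \<notin> expr_arrays e"
    using expr_arrays_test_expr[of "f + 2" n r0 e0 c] f2 by (auto simp: e_def)
  have "mem (final_config n P Y \<omega>) 1 0 0 = expr_val (mem s1) e"
    unfolding final_config_eq[OF h] cT post_def using fold_store(3)[OF ar, of 1] f2 by simp
  moreover have "expr_val (mem s1) e > 0 \<longleftrightarrow>
      rejects r0 e0 c {i \<in> {1..n}. mem s1 1 i 0 > 0} (second_clone n Y \<omega>)"
    unfolding e_def
    by (rule expr_val_test_expr) (use sim cl(5) in \<open>simp add: simulates_def s1_def\<close>)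
  moreover have "{i \<in> {1..n}. mem s1 1 i 0 > 0} = output_set n A Y1 \<omega>'"
    using sim f2 by (simp add: simulates_def s1_def output_set_def final_config_eq[OF ht])
  ultimately show "output_bit n P Y \<omega> =
      (if rejects r0 e0 c (output_set n A Y1 \<omega>') (second_clone n Y \<omega>) then 1 else 0)"
    by (simp add: output_bit_def)
qed

lemma randomized_poly_time_test_program:
  assumes "randomized_poly_time A"
  shows "randomized_poly_time (\<lambda>n. test_program n (A n) (r0 n) (e0 n) (c n))"
proof -
  obtain p :: "nat poly" where len: "length (A n) \<le> poly p n"
    and halt: "(\<And>i j. Y (i, j) = Y (j, i)) \<Longrightarrow> \<exists>t \<le> poly p n. halted (A n) (config_after n (A n) Y \<omega> t)"
    for n Y \<omega>
    using assms unfolding randomized_poly_time_def by metis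
  define q where "q = smult 216 ([:1, 1:] ^ 3) + p"
  have q: "poly q n = 216 * (n + 1) ^ 3 + poly p n" for n
    by (simp add: q_def poly_power)
  show ?thesis
    unfolding randomized_poly_time_def
  proof (intro exI[of _ q] allI conjI impI)
    fix n
    show "length (test_program n (A n) (r0 n) (e0 n) (c n)) \<le> poly q n"
      using length_test_program[of n "A n" "r0 n" "e0 n" "c n"] len[of n] by (simp add: q)
    fix Y :: "nat \<times> nat \<Rightarrow> real" and \<omega>
    assume Y: "\<forall>i j. Y (i, j) = Y (j, i)"
    \<comment> \<open>\<open>A\<close> has a time bound on symmetric inputs only, so the clone that
      it is given must be symmetric.\<close>
    have "first_clone n Y \<omega> (i, j) = first_clone n Y \<omega> (j, i)" for i j
      using Y by (simp add: first_clone_def noise_def min.commute max.commute)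
    then obtain t where "t \<le> poly p n"
      "halted (A n) (config_after n (A n) (first_clone n Y \<omega>) (\<lambda>t. \<omega> (n\<^sup>2 + t)) t)"
      using halt by blast
    from test_program_correct(1)[OF this]
    show "\<exists>t\<le>poly q n. halted (test_program n (A n) (r0 n) (e0 n) (c n))
        (config_after n (test_program n (A n) (r0 n) (e0 n) (c n)) Y \<omega> t)"
      by (simp add: q)
  qed
qed

section \<open>Measurability of the output\<close>

text \<open>The record type of configurations carries no sigma-algebra, so measurability is demanded
  of every coordinate, with discrete targets for the counters and registers.\<close>

definition measurable_config :: "'a measure \<Rightarrow> ('a \<Rightarrow> config) \<Rightarrow> bool" where
  "measurable_config N s \<longleftrightarrow>
     (\<lambda>x. pcount (s x)) \<in> measurable N (count_space UNIV) \<and>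
     (\<lambda>x. tapepos (s x)) \<in> measurable N (count_space UNIV) \<and>
     (\<forall>r. (\<lambda>x. iregs (s x) r) \<in> measurable N (count_space UNIV)) \<and>
     (\<forall>a i j. (\<lambda>x. mem (s x) a i j) \<in> borel_measurable N)"

lemma measurable_configD:
  assumes "measurable_config N s"
  shows "(\<lambda>x. pcount (s x)) \<in> measurable N (count_space UNIV)"
    "(\<lambda>x. tapepos (s x)) \<in> measurable N (count_space UNIV)"
    "(\<lambda>x. iregs (s x) r) \<in> measurable N (count_space UNIV)"
    "(\<lambda>x. mem (s x) a i j) \<in> borel_measurable N"
  using assms by (auto simp: measurable_config_def)

lemma measurable_operand_val:
  "measurable_config N s \<Longrightarrow> (\<lambda>x. operand_val (s x) u) \<in> measurable N (count_space UNIV)"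
  by (cases u) (auto intro: measurable_configD)

text \<open>Indirect addressing makes the cell that is read depend on the outcome, but there are
  only countably many addresses, and on each event of fixed address a fixed cell is read.\<close>

lemma measurable_rd:
  assumes "measurable_config N s"
  shows "(\<lambda>x. rd (s x) c) \<in> borel_measurable N"
proof -
  obtain a u v where c: "c = (a, u, v)" by (cases c)
  note [measurable] = measurable_configD[OF assms] measurable_operand_val[OF assms]
  have "(\<lambda>x. mem (s x) a (operand_val (s x) u) (operand_val (s x) v)) \<in> borel_measurable N"
    by (rule measurable_compose_countable[where g="\<lambda>x. operand_val (s x) u"],
        rule measurable_compose_countable[where g="\<lambda>x. operand_val (s x) v"]) measurable
  then show ?thesis by (simp add: c rd_def)
qed

lemma measurable_config_wr:
  assumes s: "measurable_config N s" and x: "f \<in> borel_measurable N"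
  shows "measurable_config N (\<lambda>x. wr c (f x) (s x))"
proof -
  obtain a u v where c: "c = (a, u, v)" by (cases c)
  note [measurable] = measurable_configD[OF s] measurable_operand_val[OF s] x
  show ?thesis
    unfolding measurable_config_def c wr_def by auto
qed

lemma measurable_config_cases:
  assumes g: "g \<in> measurable N (count_space (UNIV :: nat set))"
    and s: "\<And>i. measurable_config N (s i)"
  shows "measurable_config N (\<lambda>x. s (g x) x)"
  unfolding measurable_config_def
  by (intro conjI allI; rule measurable_compose_countable[OF _ g]; rule measurable_configD[OF s])

lemma measurable_config_If:
  assumes "Measurable.pred N b" "measurable_config N s" "measurable_config N s'"
  shows "measurable_config N (\<lambda>x. if b x then s x else s' x)"
proof -
  have "(\<lambda>x. if b x then 1 else 0 :: nat) \<in> measurable N (count_space UNIV)"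
    using assms(1) by measurable
  from measurable_config_cases[OF this, of "\<lambda>i. if i = 1 then s else s'"] assms(2,3)
  have "measurable_config N (\<lambda>x. (if (if b x then 1 else 0 :: nat) = 1 then s else s') x)"
    by simp
  moreover have "(\<lambda>x. (if (if b x then 1 else 0 :: nat) = 1 then s else s') x) = (\<lambda>x. if b x then s x else s' x)"
    by auto
  ultimately show ?thesis by simp
qed

lemma measurable_nat_less:
  assumes "f \<in> measurable N (count_space UNIV)" "g \<in> measurable N (count_space UNIV)"
  shows "Measurable.pred N (\<lambda>x. f x < (g x :: nat))"
  by (rule measurable_compose_countable[where g=f, OF _ assms(1)])
    (rule measurable_compose[OF assms(2)], simp)

lemma measurable_config_exec:
  assumes s: "measurable_config N s" and w: "\<And>t. (\<lambda>x. w x t) \<in> borel_measurable N"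
  shows "measurable_config N (\<lambda>x. exec_instr (w x) ins (s x))"
proof -
  note m [measurable] = measurable_configD[OF s] measurable_rd[OF s] w
  have nxt: "measurable_config N s' \<Longrightarrow> measurable_config N (\<lambda>x. next_instr (s' x))" for s'
    unfolding measurable_config_def next_instr_def by auto
  note wr = nxt[OF measurable_config_wr[OF s]]
  show ?thesis
  proof (cases ins)
    case (Gauss c)
    have "(\<lambda>x. w x (tapepos (s x))) \<in> borel_measurable N"
      by (rule measurable_compose_countable[where g="\<lambda>x. tapepos (s x)"]) measurable
    from measurable_config_wr[OF s this, of c]
    have "measurable_config N (\<lambda>x. (wr c (w x (tapepos (s x))) (s x))\<lparr>tapepos := Suc (tapepos (s x))\<rparr>)"
      unfolding measurable_config_def by auto
    then show ?thesis using nxt by (simp add: Gauss)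
  next
    case (JumpPos c l)
    have "measurable_config N (\<lambda>x. (s x)\<lparr>pcount := l\<rparr>)"
      using m unfolding measurable_config_def by simp
    then show ?thesis
      using nxt[OF s] by (auto simp: JumpPos intro!: measurable_config_If)
  next
    case (IJumpLess p q l)
    have "measurable_config N (\<lambda>x. (s x)\<lparr>pcount := l\<rparr>)"
      using m unfolding measurable_config_def by simp
    then show ?thesis
      using nxt[OF s] unfolding IJumpLess exec_instr.simps
      by (intro measurable_config_If measurable_nat_less m)
  next
    case (IConst r m)
    then show ?thesis
      unfolding measurable_config_def by (auto simp: next_instr_def iwr_def)
  next
    case (IAdd r m)
    then show ?thesis
      unfolding measurable_config_def by (auto simp: next_instr_def iwr_def)
  next
    case (ISub r m)
    then show ?thesis
      unfolding measurable_config_def by (auto simp: next_instr_def iwr_def)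
  qed (auto intro!: wr)
qed

lemma measurable_config_step:
  assumes s: "measurable_config N s" and w: "\<And>t. (\<lambda>x. w x t) \<in> borel_measurable N"
  shows "measurable_config N (\<lambda>x. step (w x) P (s x))"
proof -
  \<comment> \<open>For a fixed program counter the instruction is fixed as well, and the counter
    takes countably many values.\<close>
  have "measurable_config N (\<lambda>x. (\<lambda>pc x. if length P \<le> pc then s x else exec_instr (w x) (P ! pc) (s x)) (pcount (s x)) x)"
  proof (rule measurable_config_cases[OF measurable_configD(1)[OF s]])
    fix i show "measurable_config N (\<lambda>x. if length P \<le> i then s x else exec_instr (w x) (P ! i) (s x))"
      using s measurable_config_exec[OF s w] by (cases "length P \<le> i") auto
  qed
  then show ?thesis by (simp add: step_def halted_def)
qed

lemma measurable_config_after: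
  assumes Y: "\<And>i j. i \<in> {1..n} \<Longrightarrow> j \<in> {1..n} \<Longrightarrow> (\<lambda>x. Y x (i, j)) \<in> borel_measurable N"
    and w: "\<And>t. (\<lambda>x. w x t) \<in> borel_measurable N"
  shows "measurable_config N (\<lambda>x. config_after n P (Y x) (w x) t)"
proof (induction t)
  case 0
  show ?case
  proof -
    have "(\<lambda>x. if a = 0 \<and> i \<in> {1..n} \<and> j \<in> {1..n} then Y x (i, j) else 0) \<in> borel_measurable N"
      for a :: nat and i j
      by (cases "a = 0 \<and> i \<in> {1..n} \<and> j \<in> {1..n}") (auto simp: Y)
    then show ?thesis
      unfolding config_after_def init_config_def measurable_config_def by simp
  qed
next
  case (Suc t)
  then show ?case using measurable_config_step[OF Suc w] by (simp add: config_after_def)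
qed

text \<open>A countable case distinction on the halting time. Outcomes that never halt are covered
  too, as \<open>LEAST\<close> then has some fixed value.\<close>

lemma measurable_config_final:
  assumes Y: "\<And>i j. i \<in> {1..n} \<Longrightarrow> j \<in> {1..n} \<Longrightarrow> (\<lambda>x. Y x (i, j)) \<in> borel_measurable N"
    and w: "\<And>t. (\<lambda>x. w x t) \<in> borel_measurable N"
  shows "measurable_config N (\<lambda>x. final_config n P (Y x) (w x))"
proof -
  have m: "measurable_config N (\<lambda>x. config_after n P (Y x) (w x) t)" for t
    by (intro measurable_config_after Y w)
  have [measurable]: "Measurable.pred N (\<lambda>x. halted P (config_after n P (Y x) (w x) t))" for t
    unfolding halted_def by (rule measurable_compose[OF measurable_configD(1)[OF m]]) simp
  have "(\<lambda>x. LEAST t. halted P (config_after n P (Y x) (w x) t)) \<in> measurable N (count_space UNIV)"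
    by measurable
  then show ?thesis
    unfolding final_config_def by (rule measurable_config_cases) (rule m)
qed

lemma measurable_mem_output_set:
  assumes Y: "\<And>i j. i \<in> {1..n} \<Longrightarrow> j \<in> {1..n} \<Longrightarrow> (\<lambda>x. Y x (i, j)) \<in> borel_measurable N"
    and w: "\<And>t. (\<lambda>x. w x t) \<in> borel_measurable N"
  shows "Measurable.pred N (\<lambda>x. i \<in> output_set n P (Y x) (w x))"
    and "(\<lambda>x. output_bit n P (Y x) (w x)) \<in> measurable N (count_space UNIV)"
proof -
  have [measurable]: "(\<lambda>x. mem (final_config n P (Y x) (w x)) a i j) \<in> borel_measurable N" for a i j
    by (intro measurable_configD(4)[OF measurable_config_final] Y w)
  show "Measurable.pred N (\<lambda>x. i \<in> output_set n P (Y x) (w x))"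
    unfolding output_set_def by simp
  show "(\<lambda>x. output_bit n P (Y x) (w x)) \<in> measurable N (count_space UNIV)"
    unfolding output_bit_def by simp
qed

lemma measurable_output_set:
  assumes Y: "\<And>i j. i \<in> {1..n} \<Longrightarrow> j \<in> {1..n} \<Longrightarrow> (\<lambda>x. Y x (i, j)) \<in> borel_measurable N"
    and w: "\<And>t. (\<lambda>x. w x t) \<in> borel_measurable N"
  shows "(\<lambda>x. output_set n P (Y x) (w x)) \<in> measurable N (count_space (Pow {1..n}))"
proof (rule measurable_count_space_eq2[THEN iffD2])
  show "finite (Pow {1..n})" by simp
  have "(\<lambda>x. output_set n P (Y x) (w x)) -` {I} \<inter> space N \<in> sets N" if "I \<subseteq> {1..n}" for I
  proof -
    have [measurable]: "Measurable.pred N (\<lambda>x. i \<in> output_set n P (Y x) (w x))" for i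
      by (intro measurable_mem_output_set(1) Y w)
    have "(\<lambda>x. output_set n P (Y x) (w x)) -` {I} \<inter> space N =
       {x \<in> space N. \<forall>i\<in>{1..n}. i \<in> output_set n P (Y x) (w x) \<longleftrightarrow> i \<in> I}"
      using that unfolding output_set_def by blast
    also have "\<dots> \<in> sets N" by measurable
    finally show ?thesis .
  qed
  then show "(\<lambda>x. output_set n P (Y x) (w x)) \<in> space N \<rightarrow> Pow {1..n} \<and>
      (\<forall>a\<in>Pow {1..n}. (\<lambda>x. output_set n P (Y x) (w x)) -` {a} \<inter> space N \<in> sets N)"
    by (auto simp: output_set_def)
qed

section \<open>Gaussian cloning\<close>

abbreviation gaussian :: "real \<Rightarrow> real measure" where
  "gaussian m \<equiv> density lborel (\<lambda>x. ennreal (normal_density m 1 x))"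

lemma prob_space_gaussian: "prob_space (gaussian m)"
  by (intro prob_space_normal_density) simp

text \<open>The rotation is a composition of two affine substitutions in one variable each.\<close>

lemma nn_integral_gaussian_rotation:
  assumes [measurable]: "f \<in> borel_measurable (borel \<Otimes>\<^sub>M borel)"
  shows "(\<integral>\<^sup>+y. \<integral>\<^sup>+z. f ((y + z) / sqrt 2, (y - z) / sqrt 2) \<partial>gaussian 0 \<partial>gaussian (sqrt 2 * m)) =
    (\<integral>\<^sup>+u. \<integral>\<^sup>+v. f (u, v) \<partial>gaussian m \<partial>gaussian m)"
proof -
  let ?s = "sqrt 2 :: real"
  let ?d = "\<lambda>m x. ennreal (normal_density m 1 x)"
  have [measurable]: "(\<lambda>p. f (a p, b p)) \<in> borel_measurable N"
    if [measurable]: "a \<in> borel_measurable N" "b \<in> borel_measurable N" for a b N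
    by (rule measurable_compose[OF _ assms]) measurable
  have "(\<integral>\<^sup>+y. \<integral>\<^sup>+z. f ((y + z) / ?s, (y - z) / ?s) \<partial>gaussian 0 \<partial>gaussian (?s * m)) =
    (\<integral>\<^sup>+y. \<integral>\<^sup>+z. ?d (?s * m) y * (?d 0 z * f ((y + z) / ?s, (y - z) / ?s)) \<partial>lborel \<partial>lborel)"
    by (simp add: nn_integral_density nn_integral_cmult)
  also have "\<dots> = (\<integral>\<^sup>+z. \<integral>\<^sup>+y. ?d (?s * m) y * (?d 0 z * f ((y + z) / ?s, (y - z) / ?s)) \<partial>lborel \<partial>lborel)"
    by (rule lborel_pair.Fubini') measurable
  also have "\<dots> = (\<integral>\<^sup>+z. ennreal ?s * (\<integral>\<^sup>+u. ?d (?s * m) (?s * u - z) * (?d 0 z * f (u, u - ?s * z)) \<partial>lborel) \<partial>lborel)"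
  proof (rule nn_integral_cong)
    fix z
    have "(\<integral>\<^sup>+y. ?d (?s * m) y * (?d 0 z * f ((y + z) / ?s, (y - z) / ?s)) \<partial>lborel) =
      ennreal \<bar>?s\<bar> * (\<integral>\<^sup>+u. ?d (?s * m) (-z + ?s * u) * (?d 0 z * f ((-z + ?s * u + z) / ?s, (-z + ?s * u - z) / ?s)) \<partial>lborel)"
      by (rule nn_integral_real_affine) simp_all
    moreover have "(-z + ?s * u + z) / ?s = u" "(-z + ?s * u - z) / ?s = u - ?s * z" for u
      by (simp_all add: field_simps)
    ultimately show "(\<integral>\<^sup>+y. ?d (?s * m) y * (?d 0 z * f ((y + z) / ?s, (y - z) / ?s)) \<partial>lborel) =
      ennreal ?s * (\<integral>\<^sup>+u. ?d (?s * m) (?s * u - z) * (?d 0 z * f (u, u - ?s * z)) \<partial>lborel)"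
      by (simp only: abs_of_nonneg real_sqrt_ge_zero) simp
  qed
  also have "\<dots> = (\<integral>\<^sup>+z. \<integral>\<^sup>+u. ennreal ?s * (?d (?s * m) (?s * u - z) * (?d 0 z * f (u, u - ?s * z))) \<partial>lborel \<partial>lborel)"
    by (simp add: nn_integral_cmult)
  also have "\<dots> = (\<integral>\<^sup>+u. \<integral>\<^sup>+z. ennreal ?s * (?d (?s * m) (?s * u - z) * (?d 0 z * f (u, u - ?s * z))) \<partial>lborel \<partial>lborel)"
    by (rule lborel_pair.Fubini') measurable
  also have "\<dots> = (\<integral>\<^sup>+u. \<integral>\<^sup>+v. ?d m u * (?d m v * f (u, v)) \<partial>lborel \<partial>lborel)"
  proof (rule nn_integral_cong)
    fix u
    \<comment> \<open>Here y = (u + v) / \<surd>2 and z = (u - v) / \<surd>2. The rotation preserves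
      sums of squares and takes the mean vector (\<surd>2 m, 0) to (m, m), so the joint density is
      unchanged.\<close>
    have e: "normal_density (?s * m) 1 (?s * u - (u - v) / ?s) * normal_density 0 1 ((u - v) / ?s) =
       normal_density m 1 u * normal_density m 1 v" for v
    proof -
      have "?s * u - (u - v) / ?s - ?s * m = (u + v - 2 * m) / ?s"
        by (simp add: field_simps)
      then have "(?s * u - (u - v) / ?s - ?s * m)\<^sup>2 + ((u - v) / ?s)\<^sup>2 = (u - m)\<^sup>2 + (v - m)\<^sup>2"
        by (simp add: power_divide) (simp add: power2_eq_square field_simps)
      then show ?thesis
        by (simp add: normal_density_def exp_add[symmetric] add_divide_distrib[symmetric])
    qed
    let ?g = "\<lambda>v. ?d (?s * m) (?s * u - (u - v) / ?s) * (?d 0 ((u - v) / ?s) * f (u, v))"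
    have "(\<integral>\<^sup>+v. ?g v \<partial>lborel) = ennreal \<bar>- ?s\<bar> * (\<integral>\<^sup>+z. ?g (u + (- ?s) * z) \<partial>lborel)"
      by (rule nn_integral_real_affine) simp_all
    moreover have "?g (u + (- ?s) * z) = ?d (?s * m) (?s * u - z) * (?d 0 z * f (u, u - ?s * z))" for z
      by simp
    ultimately have "(\<integral>\<^sup>+z. ennreal ?s * (?d (?s * m) (?s * u - z) * (?d 0 z * f (u, u - ?s * z))) \<partial>lborel) =
      (\<integral>\<^sup>+v. ?g v \<partial>lborel)"
      by (simp add: nn_integral_cmult)
    also have "\<dots> = (\<integral>\<^sup>+v. ?d m u * (?d m v * f (u, v)) \<partial>lborel)"
      using e by (intro nn_integral_cong) (simp add: ennreal_mult'[symmetric] mult.assoc[symmetric])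
    finally show "(\<integral>\<^sup>+z. ennreal ?s * (?d (?s * m) (?s * u - z) * (?d 0 z * f (u, u - ?s * z))) \<partial>lborel) =
      (\<integral>\<^sup>+v. ?d m u * (?d m v * f (u, v)) \<partial>lborel)" .
  qed
  also have "\<dots> = (\<integral>\<^sup>+u. \<integral>\<^sup>+v. f (u, v) \<partial>gaussian m \<partial>gaussian m)"
    by (simp add: nn_integral_density nn_integral_cmult)
  finally show ?thesis .
qed

text \<open>Induction on the index set. Splitting off coordinate \<open>i\<close> from both products
  and exchanging integrals brings its two variables together innermost, where the two-dimensional
  rotation applies; the remaining coordinates are left to the induction hypothesis.\<close>

lemma nn_integral_PiM_gaussian_rotation:
  fixes f :: "('i \<Rightarrow> real) \<times> ('i \<Rightarrow> real) \<Rightarrow> ennreal"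
  assumes "finite I" "f \<in> borel_measurable (PiM I (\<lambda>_. borel) \<Otimes>\<^sub>M PiM I (\<lambda>_. borel))"
  shows "(\<integral>\<^sup>+x. \<integral>\<^sup>+z. f (\<lambda>i\<in>I. (x i + z i) / sqrt 2, \<lambda>i\<in>I. (x i - z i) / sqrt 2)
      \<partial>PiM I (\<lambda>_. gaussian 0) \<partial>PiM I (\<lambda>i. gaussian (sqrt 2 * m i))) =
    (\<integral>\<^sup>+u. \<integral>\<^sup>+v. f (u, v) \<partial>PiM I (\<lambda>i. gaussian (m i)) \<partial>PiM I (\<lambda>i. gaussian (m i)))"
  using assms
proof (induction I arbitrary: f)
  case empty
  show ?case by (simp add: PiM_empty nn_integral_count_space_finite restrict_def)
next
  case (insert i I)
  have fin: "finite I" and i: "i \<notin> I" by fact+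
  interpret g: prob_space "gaussian h" for h by (rule prob_space_gaussian)
  interpret Y: product_sigma_finite "\<lambda>i. gaussian (sqrt 2 * m i)" by standard
  interpret Z: product_sigma_finite "\<lambda>_::'i. gaussian 0" by standard
  interpret X: product_sigma_finite "\<lambda>i. gaussian (m i)" by standard
  interpret PY: sigma_finite_measure "PiM I (\<lambda>i. gaussian (sqrt 2 * m i))"
    by (rule Y.sigma_finite) fact
  interpret PZ: sigma_finite_measure "PiM I (\<lambda>i. gaussian 0)"
    by (rule Z.sigma_finite) fact
  interpret PZi: sigma_finite_measure "PiM (insert i I) (\<lambda>i. gaussian 0)"
    using fin by (intro Z.sigma_finite) simp
  interpret PX: sigma_finite_measure "PiM I (\<lambda>i. gaussian (m i))"
    by (rule X.sigma_finite) fact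
  interpret PXi: sigma_finite_measure "PiM (insert i I) (\<lambda>i. gaussian (m i))"
    using fin by (intro X.sigma_finite) simp
  interpret YZ: pair_sigma_finite "gaussian (sqrt 2 * m i)" "PiM I (\<lambda>i. gaussian 0)" ..
  interpret XX: pair_sigma_finite "gaussian (m i)" "PiM I (\<lambda>i. gaussian (m i))" ..
  have sets_gaussian [measurable_cong]: "sets (PiM J (\<lambda>i. gaussian (h i))) = sets (PiM J (\<lambda>_. borel))"
    for J :: "'i set" and h by (rule sets_PiM_cong) simp_all
  have space_gaussian [simp]: "space (PiM J (\<lambda>i. gaussian (h i))) = space (PiM J (\<lambda>_. borel))"
    for J :: "'i set" and h by (rule sets_eq_imp_space_eq) (rule sets_gaussian)
  note [measurable] = insert.prems
  have f' [measurable]: "(\<lambda>x. f ((a x)(i := b x), (a' x)(i := b' x))) \<in> borel_measurable N"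
    if [measurable]: "a \<in> measurable N (PiM I (\<lambda>_. borel))" "b \<in> borel_measurable N"
      "a' \<in> measurable N (PiM I (\<lambda>_. borel))" "b' \<in> borel_measurable N" for N a b a' b'
  proof -
    have "(\<lambda>x. (a x)(i := b x)) \<in> measurable N (PiM (insert i I) (\<lambda>_. borel))"
      "(\<lambda>x. (a' x)(i := b' x)) \<in> measurable N (PiM (insert i I) (\<lambda>_. borel))"
      by (rule measurable_fun_upd[where J=I]; (measurable | simp))+
    then show ?thesis by measurable
  qed
  let ?r1 = "\<lambda>J x z. \<lambda>i\<in>J. (x i + z i) / sqrt 2" and ?r2 = "\<lambda>J x z. \<lambda>i\<in>J. (x i - z i) / sqrt 2"
  have r [measurable]: "(\<lambda>x. ?r1 J (a x) (b x)) \<in> measurable N (PiM J (\<lambda>_. borel))"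
     "(\<lambda>x. ?r2 J (a x) (b x)) \<in> measurable N (PiM J (\<lambda>_. borel))"
    if [measurable]: "a \<in> measurable N (PiM J (\<lambda>_. borel))" "b \<in> measurable N (PiM J (\<lambda>_. borel))"
    for N a b and J :: "'i set" by measurable
  have up: "?r1 (insert i I) (x(i := y)) (z(i := w)) = (?r1 I x z)(i := (y + w) / sqrt 2)"
    "?r2 (insert i I) (x(i := y)) (z(i := w)) = (?r2 I x z)(i := (y - w) / sqrt 2)" for x z y w
    using i by (auto simp: fun_eq_iff restrict_def)
  \<comment> \<open>\<open>G\<close> has coordinate \<open>i\<close> already rotated and integrated
    out, so it depends on the other rotated coordinates only; the induction hypothesis is applied to
    it.\<close>
  define G where "G = (\<lambda>(a, b). \<integral>\<^sup>+u. \<integral>\<^sup>+v. f (a(i := u), b(i := v)) \<partial>gaussian (m i) \<partial>gaussian (m i))"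
  have G [measurable]: "G \<in> borel_measurable (PiM I (\<lambda>_. borel) \<Otimes>\<^sub>M PiM I (\<lambda>_. borel))"
    unfolding G_def by measurable
  have "(\<integral>\<^sup>+x. \<integral>\<^sup>+z. f (?r1 (insert i I) x z, ?r2 (insert i I) x z)
      \<partial>PiM (insert i I) (\<lambda>_. gaussian 0) \<partial>PiM (insert i I) (\<lambda>i. gaussian (sqrt 2 * m i))) =
    (\<integral>\<^sup>+x. \<integral>\<^sup>+y. \<integral>\<^sup>+z. \<integral>\<^sup>+w. f ((?r1 I x z)(i := (y + w) / sqrt 2), (?r2 I x z)(i := (y - w) / sqrt 2))
      \<partial>gaussian 0 \<partial>PiM I (\<lambda>_. gaussian 0) \<partial>gaussian (sqrt 2 * m i) \<partial>PiM I (\<lambda>i. gaussian (sqrt 2 * m i)))"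
    by (subst Y.product_nn_integral_insert[OF fin i], measurable)
      (intro nn_integral_cong, subst Z.product_nn_integral_insert[OF fin i], measurable, simp only: up)
  also have "\<dots> = (\<integral>\<^sup>+x. \<integral>\<^sup>+z. \<integral>\<^sup>+y. \<integral>\<^sup>+w. f ((?r1 I x z)(i := (y + w) / sqrt 2), (?r2 I x z)(i := (y - w) / sqrt 2))
      \<partial>gaussian 0 \<partial>gaussian (sqrt 2 * m i) \<partial>PiM I (\<lambda>_. gaussian 0) \<partial>PiM I (\<lambda>i. gaussian (sqrt 2 * m i)))"
    by (intro nn_integral_cong YZ.Fubini'[symmetric]) measurable
  also have "\<dots> = (\<integral>\<^sup>+x. \<integral>\<^sup>+z. G (?r1 I x z, ?r2 I x z)
      \<partial>PiM I (\<lambda>_. gaussian 0) \<partial>PiM I (\<lambda>i. gaussian (sqrt 2 * m i)))"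
  proof (intro nn_integral_cong)
    fix x z
    show "(\<integral>\<^sup>+y. \<integral>\<^sup>+w. f ((?r1 I x z)(i := (y + w) / sqrt 2), (?r2 I x z)(i := (y - w) / sqrt 2))
        \<partial>gaussian 0 \<partial>gaussian (sqrt 2 * m i)) = G (?r1 I x z, ?r2 I x z)"
      unfolding G_def prod.case
      by (rule nn_integral_gaussian_rotation[where f="\<lambda>(u, v). f ((?r1 I x z)(i := u), (?r2 I x z)(i := v))",
            unfolded prod.case])
        (simp add: case_prod_beta')
  qed
  also have "\<dots> = (\<integral>\<^sup>+a. \<integral>\<^sup>+b. G (a, b) \<partial>PiM I (\<lambda>i. gaussian (m i)) \<partial>PiM I (\<lambda>i. gaussian (m i)))"
    by (rule insert.IH) fact
  also have "\<dots> = (\<integral>\<^sup>+a. \<integral>\<^sup>+u. \<integral>\<^sup>+b. \<integral>\<^sup>+v. f (a(i := u), b(i := v)) \<partial>gaussian (m i)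
      \<partial>PiM I (\<lambda>i. gaussian (m i)) \<partial>gaussian (m i) \<partial>PiM I (\<lambda>i. gaussian (m i)))"
    unfolding G_def prod.case by (intro nn_integral_cong XX.Fubini') measurable
  also have "\<dots> = (\<integral>\<^sup>+a. \<integral>\<^sup>+b. f (a, b) \<partial>PiM (insert i I) (\<lambda>i. gaussian (m i)) \<partial>PiM (insert i I) (\<lambda>i. gaussian (m i)))"
    by (subst X.product_nn_integral_insert[OF fin i], measurable)
      (intro nn_integral_cong, subst X.product_nn_integral_insert[OF fin i], measurable)
  finally show ?case .
qed

section \<open>The law of the output of the test\<close>

abbreviation upper_indices :: "nat \<Rightarrow> (nat \<times> nat) set" where
  "upper_indices n \<equiv> {(i, j). 1 \<le> i \<and> i \<le> j \<and> j \<le> n}"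

lemma finite_upper_indices: "finite (upper_indices n)"
  by (rule finite_subset[of _ "{1..n} \<times> {1..n}"]) auto

lemma sets_PiM_gaussian [measurable_cong]:
  "sets (PiM J (\<lambda>i. gaussian (h i))) = sets (PiM J (\<lambda>_. borel))"
  by (rule sets_PiM_cong) simp_all

lemma sets_random_tape [measurable_cong]: "sets random_tape = sets (PiM UNIV (\<lambda>_. borel))"
  unfolding random_tape_def by (rule sets_PiM_gaussian)

lemma sets_upper_given_labels [measurable_cong]:
  "sets (upper_given_labels n lam M \<sigma>) = sets (PiM (upper_indices n) (\<lambda>_. borel))"
  unfolding upper_given_labels_def by (rule sets_PiM_gaussian)

lemma prob_space_random_tape: "prob_space random_tape"
  unfolding random_tape_def by (intro prob_space_PiM prob_space_gaussian)

text \<open>The tape is an i.i.d. sequence: its first \<open>m\<close> samples are independent of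
  the shifted rest, which is again distributed as a tape. Reading distinct positions below
  \<open>m\<close> gives independent Gaussians, one for each index in \<open>I\<close>.\<close>

lemma nn_integral_random_tape_split:
  assumes idx: "inj_on idx I" "\<And>p. p \<in> I \<Longrightarrow> idx p < m"
    and g [measurable]: "g \<in> borel_measurable (PiM I (\<lambda>_. borel) \<Otimes>\<^sub>M PiM UNIV (\<lambda>_. borel))"
  shows "(\<integral>\<^sup>+\<omega>. g (\<lambda>p\<in>I. \<omega> (idx p), \<lambda>t. \<omega> (m + t)) \<partial>random_tape) =
    (\<integral>\<^sup>+z. \<integral>\<^sup>+\<omega>. g (z, \<omega>) \<partial>random_tape \<partial>PiM I (\<lambda>_. gaussian 0))"
proof -
  interpret gauss: prob_space "gaussian h" for h by (rule prob_space_gaussian)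
  interpret S: sequence_space "gaussian 0" by standard
  interpret T: prob_space random_tape by (rule prob_space_random_tape)
  \<comment> \<open>\<open>comb_seq\<close> glues the first \<open>m\<close> samples of one tape to
    a second, independent tape.\<close>
  have T: "random_tape = distr (random_tape \<Otimes>\<^sub>M random_tape) random_tape (\<lambda>(\<omega>, \<omega>'). comb_seq m \<omega> \<omega>')"
    unfolding random_tape_def by (rule S.PiM_comb_seq[symmetric])
  have R: "PiM I (\<lambda>_. gaussian 0) = distr random_tape (PiM I (\<lambda>_. gaussian 0)) (\<lambda>\<omega>. \<lambda>p\<in>I. \<omega> (idx p))"
    unfolding random_tape_def
    by (rule distr_PiM_reindex[symmetric]) (use idx(1) prob_space_gaussian in auto)
  have r [measurable]: "(\<lambda>\<omega>. \<lambda>p\<in>I. \<omega> (idx p)) \<in> measurable random_tape (PiM I (\<lambda>_. borel))"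
    "(\<lambda>\<omega>. \<lambda>t. \<omega> (m + t)) \<in> measurable random_tape (PiM UNIV (\<lambda>_. borel))"
    by (measurable, rule measurable_abs_UNIV, measurable)
  have "(\<integral>\<^sup>+\<omega>. g (\<lambda>p\<in>I. \<omega> (idx p), \<lambda>t. \<omega> (m + t)) \<partial>random_tape) =
    (\<integral>\<^sup>+x. g (\<lambda>p\<in>I. comb_seq m (fst x) (snd x) (idx p), \<lambda>t. comb_seq m (fst x) (snd x) (m + t))
       \<partial>(random_tape \<Otimes>\<^sub>M random_tape))"
  proof -
    let ?h = "\<lambda>\<omega>. g (\<lambda>p\<in>I. \<omega> (idx p), \<lambda>t. \<omega> (m + t))"
    have h: "?h \<in> borel_measurable random_tape"
      by (rule measurable_compose[OF measurable_Pair[OF r] g])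
    have "(\<integral>\<^sup>+\<omega>. ?h \<omega> \<partial>random_tape) =
        (\<integral>\<^sup>+\<omega>. ?h \<omega> \<partial>distr (random_tape \<Otimes>\<^sub>M random_tape) random_tape (\<lambda>(\<omega>, \<omega>'). comb_seq m \<omega> \<omega>'))"
      using arg_cong[OF T, of "\<lambda>N. nn_integral N ?h"] .
    also have "\<dots> = (\<integral>\<^sup>+x. ?h ((\<lambda>(\<omega>, \<omega>'). comb_seq m \<omega> \<omega>') x) \<partial>(random_tape \<Otimes>\<^sub>M random_tape))"
    proof (rule nn_integral_distr)
      show "(\<lambda>(\<omega>, \<omega>'). comb_seq m \<omega> \<omega>') \<in> measurable (random_tape \<Otimes>\<^sub>M random_tape) random_tape"
        unfolding random_tape_def by (rule measurable_comb_seq)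
    qed (use h in \<open>simp only: measurable_distr_eq1\<close>)
    finally show ?thesis by (simp only: case_prod_beta')
  qed
  also have "\<dots> = (\<integral>\<^sup>+x. g (\<lambda>p\<in>I. fst x (idx p), snd x) \<partial>(random_tape \<Otimes>\<^sub>M random_tape))"
    by (intro nn_integral_cong arg_cong[where f=g])
      (auto simp: comb_seq_def fun_eq_iff restrict_def idx(2))
  also have "\<dots> = (\<integral>\<^sup>+a. \<integral>\<^sup>+\<omega>. g (\<lambda>p\<in>I. a (idx p), \<omega>) \<partial>random_tape \<partial>random_tape)"
    by (subst T.nn_integral_fst[symmetric]) simp_all
  also have "\<dots> = (\<integral>\<^sup>+z. \<integral>\<^sup>+\<omega>. g (z, \<omega>) \<partial>random_tape \<partial>PiM I (\<lambda>_. gaussian 0))"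
  proof -
    have "(\<integral>\<^sup>+z. \<integral>\<^sup>+\<omega>. g (z, \<omega>) \<partial>random_tape \<partial>PiM I (\<lambda>_. gaussian 0)) =
        (\<integral>\<^sup>+z. \<integral>\<^sup>+\<omega>. g (z, \<omega>) \<partial>random_tape
          \<partial>distr random_tape (PiM I (\<lambda>_. gaussian 0)) (\<lambda>\<omega>. \<lambda>p\<in>I. \<omega> (idx p)))"
      using arg_cong[OF R, of "\<lambda>N. nn_integral N (\<lambda>z. \<integral>\<^sup>+\<omega>. g (z, \<omega>) \<partial>random_tape)"] .
    also have "\<dots> = (\<integral>\<^sup>+a. \<integral>\<^sup>+\<omega>. g (\<lambda>p\<in>I. a (idx p), \<omega>) \<partial>random_tape \<partial>random_tape)"
      by (rule nn_integral_distr) measurable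
    finally show ?thesis ..
  qed
  finally show ?thesis .
qed

lemma nn_integral_P_Gaussian_joint:
  assumes [measurable]: "h \<in> borel_measurable (count_space UNIV \<Otimes>\<^sub>M matrix_space n)"
  shows "(\<integral>\<^sup>+x. h x \<partial>P_Gaussian_joint n k lam M) =
    (\<integral>\<^sup>+\<sigma>. \<integral>\<^sup>+X. h (\<sigma>, symmetrize n X) \<partial>upper_given_labels n lam M \<sigma> \<partial>labels_pmf n k M)"
proof -
  note [measurable] = measurable_symmetrize
  have meas: "(\<lambda>X. (\<sigma>, symmetrize n X)) \<in>
      measurable (upper_given_labels n lam M \<sigma>) (count_space UNIV \<Otimes>\<^sub>M matrix_space n)"
    for \<sigma> :: "nat \<Rightarrow> nat option" by (intro measurable_Pair) auto
  let ?K = "\<lambda>\<sigma>. distr (upper_given_labels n lam M \<sigma>) (count_space UNIV \<Otimes>\<^sub>M matrix_space n) (\<lambda>X. (\<sigma>, symmetrize n X))"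
  have "prob_space (?K \<sigma>)" for \<sigma>
    by (intro prob_space.prob_space_distr prob_space_upper_given_labels meas)
  then have "?K \<in> measurable (measure_pmf (labels_pmf n k M)) (subprob_algebra (count_space UNIV \<Otimes>\<^sub>M matrix_space n))"
    by (auto simp: space_subprob_algebra prob_space_imp_subprob_space)
  then show ?thesis
    unfolding P_Gaussian_joint_def
    by (subst nn_integral_bind) (simp_all add: nn_integral_distr meas)
qed

lemma nn_integral_P_Gaussian:
  assumes [measurable]: "h \<in> borel_measurable (matrix_space n)"
  shows "(\<integral>\<^sup>+Y. h Y \<partial>P_Gaussian n k lam M) =
    (\<integral>\<^sup>+\<sigma>. \<integral>\<^sup>+X. h (symmetrize n X) \<partial>upper_given_labels n lam M \<sigma> \<partial>labels_pmf n k M)"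
  unfolding P_Gaussian_def
  by (subst nn_integral_distr)
    (simp_all add: measurable_cong_sets[OF sets_P_Gaussian_joint refl] nn_integral_P_Gaussian_joint)

text \<open>The machine sees only the entries inside the index range, so a clone, which is defined
  on all pairs, may be exchanged for the symmetrization of a function on the upper triangle.\<close>

lemma output_set_cong:
  assumes "\<And>i j. i \<in> {1..n} \<Longrightarrow> j \<in> {1..n} \<Longrightarrow> Y (i, j) = Y' (i, j)"
  shows "output_set n A Y w = output_set n A Y' w"
proof -
  have "init_config n Y = init_config n Y'"
    using assms by (auto simp: init_config_def fun_eq_iff)
  then show ?thesis
    by (simp add: output_set_def final_config_def config_after_def)
qed

lemma rejects_cong:
  assumes "\<And>i j. i \<in> I \<Longrightarrow> j \<in> I \<Longrightarrow> i < j \<Longrightarrow> X (i, j) = X' (i, j)"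
  shows "rejects r0 e0 c I X = rejects r0 e0 c I X'"
proof -
  have "edge_sum I X = edge_sum I X'"
    unfolding edge_sum_def by (rule sum.cong) (auto simp: edges_def assms)
  moreover have "triangle_sum I X = triangle_sum I X'"
    unfolding triangle_sum_def by (rule sum.cong) (auto simp: triangles_def assms)
  ultimately show ?thesis by (simp add: rejects_def)
qed

lemma output_set_subset: "output_set n A Y \<omega> \<subseteq> {1..n}"
  by (auto simp: output_set_def)

text \<open>Both clones are rewritten as rotations of the upper triangle \<open>X\<close> and the
  noise, the form that \<open>nn_integral_PiM_gaussian_rotation\<close> expects.\<close>

lemma output_bit_test_program:
  assumes A: "randomized_poly_time A"
  shows "output_bit n (test_program n (A n) r0 e0 c) (symmetrize n X) \<omega> =
    (if rejects r0 e0 c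
       (output_set n (A n) (symmetrize n (\<lambda>p\<in>upper_indices n. (X p + \<omega> (noise_index n p)) / sqrt 2)) (\<lambda>t. \<omega> (n\<^sup>2 + t)))
       (\<lambda>p\<in>upper_indices n. (X p - \<omega> (noise_index n p)) / sqrt 2) then 1 else 0)"
proof -
  let ?Y = "symmetrize n X"
  have "first_clone n ?Y \<omega> (i, j) = first_clone n ?Y \<omega> (j, i)" for i j
    by (auto simp: first_clone_def noise_def symmetrize_def min.commute max.commute)
  then obtain b where "halted (A n) (config_after n (A n) (first_clone n ?Y \<omega>) (\<lambda>t. \<omega> (n\<^sup>2 + t)) b)"
    using A unfolding randomized_poly_time_def by metis
  note * = test_program_correct(2)[OF order.refl this, of r0 e0 c]
  have 1: "output_set n (A n) (first_clone n ?Y \<omega>) (\<lambda>t. \<omega> (n\<^sup>2 + t)) =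
    output_set n (A n) (symmetrize n (\<lambda>p\<in>upper_indices n. (X p + \<omega> (noise_index n p)) / sqrt 2)) (\<lambda>t. \<omega> (n\<^sup>2 + t))"
    by (rule output_set_cong) (auto simp: first_clone_def noise_def symmetrize_def)
  have "rejects r0 e0 c (output_set n (A n) Y w) (second_clone n ?Y \<omega>) =
    rejects r0 e0 c (output_set n (A n) Y w) (\<lambda>p\<in>upper_indices n. (X p - \<omega> (noise_index n p)) / sqrt 2)" for Y w
  proof (rule rejects_cong)
    fix i j assume "i \<in> output_set n (A n) Y w" "j \<in> output_set n (A n) Y w" "i < j"
    then have "i \<in> {1..n}" "j \<in> {1..n}" "i < j" using output_set_subset by blast+
    then show "second_clone n ?Y \<omega> (i, j) = (\<lambda>p\<in>upper_indices n. (X p - \<omega> (noise_index n p)) / sqrt 2) (i, j)"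
      by (simp add: second_clone_def noise_def symmetrize_def)
  qed
  then show ?thesis
    unfolding * 1 by (simp only:)
qed

lemma measurable_edge_triangle_sum:
  assumes f: "f \<in> measurable N (PiM (upper_indices n) (\<lambda>_. borel))" and I: "I \<subseteq> {1..n}"
  shows "(\<lambda>x. edge_sum I (f x)) \<in> borel_measurable N"
    and "(\<lambda>x. triangle_sum I (f x)) \<in> borel_measurable N"
proof -
  have *: "(\<lambda>x. f x p) \<in> borel_measurable N" if "p \<in> upper_indices n" for p
    by (rule measurable_compose[OF f]) (rule measurable_component_singleton[OF that])
  show "(\<lambda>x. edge_sum I (f x)) \<in> borel_measurable N"
    unfolding edge_sum_def using I by (intro borel_measurable_sum *) (auto simp: edges_def)
  show "(\<lambda>x. triangle_sum I (f x)) \<in> borel_measurable N"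
    unfolding triangle_sum_def using I
    by (intro borel_measurable_sum) (auto simp: triangles_def intro!: borel_measurable_times *)
qed

lemma measurable_rejects:
  assumes "g \<in> measurable N (count_space (Pow {1..n}))"
    "f \<in> measurable N (PiM (upper_indices n) (\<lambda>_. borel))"
  shows "Measurable.pred N (\<lambda>x. rejects r0 e0 c (g x) (f x))"
proof (rule measurable_compose_countable'[OF _ assms(1)])
  fix I assume I: "I \<in> Pow {1..n}"
  then have [measurable]: "(\<lambda>x. edge_sum I (f x)) \<in> borel_measurable N"
    "(\<lambda>x. triangle_sum I (f x)) \<in> borel_measurable N"
    using measurable_edge_triangle_sum[OF assms(2)] by auto
  show "Measurable.pred N (\<lambda>x. rejects r0 e0 c I (f x))"
    unfolding rejects_def by measurable
qed (simp add: countable_finite)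

lemma measurable_output_set_symmetrize:
  assumes [measurable]: "X \<in> measurable N (PiM (upper_indices n) (\<lambda>_. borel))"
    "w \<in> measurable N (PiM UNIV (\<lambda>_. borel))"
  shows "(\<lambda>x. output_set n A (symmetrize n (X x)) (w x)) \<in> measurable N (count_space (Pow {1..n}))"
proof (rule measurable_output_set)
  fix i j assume ij: "i \<in> {1..n}" "j \<in> {1..n}"
  then have "(\<lambda>x. X x (min i j, max i j)) \<in> borel_measurable N"
    by (intro measurable_compose[OF assms(1) measurable_component_singleton]) auto
  then show "(\<lambda>x. symmetrize n (X x) (i, j)) \<in> borel_measurable N"
    using ij by (simp add: symmetrize_def)
qed measurable

lemma upper_given_labels_eq:
  "upper_given_labels n lam M \<sigma> = PiM (upper_indices n) (\<lambda>p. gaussian (entry_mean lam M \<sigma> p))"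
  by (simp add: upper_given_labels_def)

lemma entry_mean_scale: "entry_mean (c * lam) M \<sigma> p = c * entry_mean lam M \<sigma> p"
  by (auto simp: entry_mean_def split: prod.splits)

text \<open>This is the decoupling: the set is computed from \<open>x\<close> and \<omega>, while
  the statistic is evaluated on \<open>x'\<close>, which is integrated innermost and independent of
  them given the labels. A bound for a fixed set thus passes through all outer integrals.\<close>

lemma prob_output_bit_test_program:
  assumes A: "randomized_poly_time A"
  shows "ennreal (prob_output_bit n (test_program n (A n) r0 e0 c) (P_Gaussian n k (sqrt 2 * lam) M) b) =
    (\<integral>\<^sup>+\<sigma>. \<integral>\<^sup>+x. \<integral>\<^sup>+\<omega>. \<integral>\<^sup>+x'.
       (if (if rejects r0 e0 c (output_set n (A n) (symmetrize n x) \<omega>) x' then 1 else 0) = b then 1 else 0)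
       \<partial>upper_given_labels n lam M \<sigma> \<partial>random_tape \<partial>upper_given_labels n lam M \<sigma> \<partial>labels_pmf n k M)"
proof -
  let ?P = "test_program n (A n) r0 e0 c"
  let ?H = "P_Gaussian n k (sqrt 2 * lam) M"
  interpret H: prob_space ?H by (rule prob_space_P_Gaussian)
  interpret T: prob_space random_tape by (rule prob_space_random_tape)
  interpret HT: pair_prob_space ?H random_tape ..
  interpret U: prob_space "upper_given_labels n lam M \<sigma>" for \<sigma> by (rule prob_space_upper_given_labels)
  interpret UT: pair_sigma_finite "upper_given_labels n lam M \<sigma>" random_tape for \<sigma> ..
  have [measurable_cong]: "sets ?H = sets (matrix_space n)" by (simp add: P_Gaussian_def)
  let ?D = "\<lambda>Y \<omega>. if output_bit n ?P Y \<omega> = b then 1 else 0 :: ennreal"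
  have ob [measurable]: "(\<lambda>x. output_bit n ?P (fst x) (snd x)) \<in> measurable (matrix_space n \<Otimes>\<^sub>M random_tape) (count_space UNIV)"
    by (rule measurable_mem_output_set(2)) (simp_all add: matrix_space_def)
  have [measurable]: "Measurable.pred (matrix_space n \<Otimes>\<^sub>M random_tape) (\<lambda>x. output_bit n ?P (fst x) (snd x) = b)"
    by (rule measurable_compose[OF ob]) simp
  have D [measurable]: "(\<lambda>x. ?D (fst x) (snd x)) \<in> borel_measurable (matrix_space n \<Otimes>\<^sub>M random_tape)"
    by measurable
  define F where "F = (\<lambda>(x, \<omega>, x'). (if (if rejects r0 e0 c (output_set n (A n) (symmetrize n x) \<omega>) x' then 1 else 0) = b then 1 else 0) :: ennreal)"
  have F [measurable]: "(\<lambda>y. F (f y, w y, f' y)) \<in> borel_measurable N"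
    if [measurable]: "f \<in> measurable N (PiM (upper_indices n) (\<lambda>_. borel))"
      "w \<in> measurable N (PiM UNIV (\<lambda>_. borel))" "f' \<in> measurable N (PiM (upper_indices n) (\<lambda>_. borel))" for f w f' N
  proof -
    have [measurable]: "Measurable.pred N (\<lambda>y. rejects r0 e0 c (output_set n (A n) (symmetrize n (f y)) (w y)) (f' y))"
      by (intro measurable_rejects[where n=n] measurable_output_set_symmetrize that)
    show ?thesis unfolding F_def by (cases "b = 0"; cases "b = 1") simp_all
  qed
  have "ennreal (prob_output_bit n ?P ?H b) =
      emeasure (?H \<Otimes>\<^sub>M random_tape) {x \<in> space (?H \<Otimes>\<^sub>M random_tape). output_bit n ?P (fst x) (snd x) = b}"
    unfolding prob_output_bit_def HT.emeasure_eq_measure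
    by (intro arg_cong[where f=ennreal] arg_cong2[where f=measure]) auto
  also have "\<dots> = (\<integral>\<^sup>+x. indicator {x \<in> space (?H \<Otimes>\<^sub>M random_tape). output_bit n ?P (fst x) (snd x) = b} x \<partial>(?H \<Otimes>\<^sub>M random_tape))"
    by (rule nn_integral_indicator[symmetric]) measurable
  also have "\<dots> = (\<integral>\<^sup>+x. ?D (fst x) (snd x) \<partial>(?H \<Otimes>\<^sub>M random_tape))"
    by (rule nn_integral_cong) (auto simp: indicator_def)
  also have "\<dots> = (\<integral>\<^sup>+Y. \<integral>\<^sup>+\<omega>. ?D Y \<omega> \<partial>random_tape \<partial>?H)"
    by (subst T.nn_integral_fst[symmetric]) simp_all
  also have "\<dots> = (\<integral>\<^sup>+\<sigma>. \<integral>\<^sup>+X. \<integral>\<^sup>+\<omega>. ?D (symmetrize n X) \<omega> \<partial>random_tape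
      \<partial>upper_given_labels n (sqrt 2 * lam) M \<sigma> \<partial>labels_pmf n k M)"
    using D by (subst nn_integral_P_Gaussian) (auto intro!: T.borel_measurable_nn_integral simp: case_prod_beta')
  also have "\<dots> = (\<integral>\<^sup>+\<sigma>. \<integral>\<^sup>+x. \<integral>\<^sup>+\<omega>. \<integral>\<^sup>+x'. F (x, \<omega>, x')
       \<partial>upper_given_labels n lam M \<sigma> \<partial>random_tape \<partial>upper_given_labels n lam M \<sigma> \<partial>labels_pmf n k M)"
  proof (rule nn_integral_cong)
    fix \<sigma>
    let ?U = "upper_indices n"
    let ?G = "\<lambda>(x, x'). \<integral>\<^sup>+\<omega>. F (x, \<omega>, x') \<partial>random_tape"
    have G: "?G \<in> borel_measurable (PiM ?U (\<lambda>_. borel) \<Otimes>\<^sub>M PiM ?U (\<lambda>_. borel))"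
      by measurable
    have "(\<integral>\<^sup>+X. \<integral>\<^sup>+\<omega>. ?D (symmetrize n X) \<omega> \<partial>random_tape \<partial>upper_given_labels n (sqrt 2 * lam) M \<sigma>) =
      (\<integral>\<^sup>+X. \<integral>\<^sup>+z. ?G (\<lambda>p\<in>?U. (X p + z p) / sqrt 2, \<lambda>p\<in>?U. (X p - z p) / sqrt 2)
        \<partial>PiM ?U (\<lambda>_. gaussian 0) \<partial>upper_given_labels n (sqrt 2 * lam) M \<sigma>)"
    proof (rule nn_integral_cong)
      fix X assume "X \<in> space (upper_given_labels n (sqrt 2 * lam) M \<sigma>)"
      then have X [measurable]: "X \<in> space (PiM ?U (\<lambda>_. borel))"
        by (simp add: upper_given_labels_def space_PiM)
      let ?r1 = "\<lambda>z. \<lambda>p\<in>?U. (X p + z p) / sqrt 2" and ?r2 = "\<lambda>z. \<lambda>p\<in>?U. (X p - z p) / sqrt 2"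
      let ?g = "\<lambda>(z, \<omega>). F (?r1 z, \<omega>, ?r2 z)"
      have [measurable]: "?g \<in> borel_measurable (PiM ?U (\<lambda>_. borel) \<Otimes>\<^sub>M PiM UNIV (\<lambda>_. borel))"
        by measurable
      have "?D (symmetrize n X) \<omega> = ?g (\<lambda>p\<in>?U. \<omega> (noise_index n p), \<lambda>t. \<omega> (n\<^sup>2 + t))" for \<omega>
        unfolding output_bit_test_program[OF A] F_def prod.case by (simp cong: restrict_cong)
      then have "(\<integral>\<^sup>+\<omega>. ?D (symmetrize n X) \<omega> \<partial>random_tape) =
          (\<integral>\<^sup>+\<omega>. ?g (\<lambda>p\<in>?U. \<omega> (noise_index n p), \<lambda>t. \<omega> (n\<^sup>2 + t)) \<partial>random_tape)"
        by simp
      also have "\<dots> = (\<integral>\<^sup>+z. \<integral>\<^sup>+\<omega>. ?g (z, \<omega>) \<partial>random_tape \<partial>PiM ?U (\<lambda>_. gaussian 0))"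
      proof (rule nn_integral_random_tape_split)
        show "inj_on (noise_index n) ?U"
          by (rule inj_on_subset[OF inj_on_noise_index]) auto
        show "noise_index n p < n\<^sup>2" if "p \<in> ?U" for p
          using that by (intro noise_index(2)) auto
      qed fact
      finally show "(\<integral>\<^sup>+\<omega>. ?D (symmetrize n X) \<omega> \<partial>random_tape) =
          (\<integral>\<^sup>+z. ?G (?r1 z, ?r2 z) \<partial>PiM ?U (\<lambda>_. gaussian 0))"
        by simp
    qed
    \<comment> \<open>Means at strength \<surd>2 \<lambda> are \<surd>2 times those at strength
      \<lambda>, as the rotation needs.\<close>
    also have "\<dots> = (\<integral>\<^sup>+x. \<integral>\<^sup>+x'. ?G (x, x') \<partial>upper_given_labels n lam M \<sigma> \<partial>upper_given_labels n lam M \<sigma>)"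
      unfolding upper_given_labels_eq entry_mean_scale
      by (rule nn_integral_PiM_gaussian_rotation[OF finite_upper_indices G])
    also have "\<dots> = (\<integral>\<^sup>+x. \<integral>\<^sup>+\<omega>. \<integral>\<^sup>+x'. F (x, \<omega>, x')
       \<partial>upper_given_labels n lam M \<sigma> \<partial>random_tape \<partial>upper_given_labels n lam M \<sigma>)"
      unfolding prod.case
    proof (rule nn_integral_cong)
      fix x assume "x \<in> space (upper_given_labels n lam M \<sigma>)"
      then have [measurable]: "x \<in> space (PiM ?U (\<lambda>_. borel))"
        by (simp add: upper_given_labels_def space_PiM)
      show "(\<integral>\<^sup>+x'. \<integral>\<^sup>+\<omega>. F (x, \<omega>, x') \<partial>random_tape \<partial>upper_given_labels n lam M \<sigma>) =
        (\<integral>\<^sup>+\<omega>. \<integral>\<^sup>+x'. F (x, \<omega>, x') \<partial>upper_given_labels n lam M \<sigma> \<partial>random_tape)"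
        by (rule UT.Fubini'[symmetric]) measurable
    qed
    finally show "(\<integral>\<^sup>+X. \<integral>\<^sup>+\<omega>. ?D (symmetrize n X) \<omega> \<partial>random_tape \<partial>upper_given_labels n (sqrt 2 * lam) M \<sigma>) =
      (\<integral>\<^sup>+x. \<integral>\<^sup>+\<omega>. \<integral>\<^sup>+x'. F (x, \<omega>, x')
       \<partial>upper_given_labels n lam M \<sigma> \<partial>random_tape \<partial>upper_given_labels n lam M \<sigma>)" .
  qed
  finally show ?thesis unfolding F_def prod.case .
qed

section \<open>Deviations of polynomials in Gaussians\<close>

lemma gaussian_moments:
  shows "has_bochner_integral (gaussian m) (\<lambda>x. x) m"
    and "has_bochner_integral (gaussian m) (\<lambda>x. x\<^sup>2) (m\<^sup>2 + 1)"
proof -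
  have 1: "has_bochner_integral lborel (\<lambda>x. normal_density m 1 x * x) m"
    by (rule normal_moment_nz_1) simp
  have 0: "has_bochner_integral lborel (\<lambda>x. normal_density m 1 x) 1"
    using normal_moment_even[of 1 m 0] by simp
  have 2: "has_bochner_integral lborel (\<lambda>x. normal_density m 1 x * (x - m)\<^sup>2) 1"
    using normal_moment_even[of 1 m 1] by simp
  have "has_bochner_integral lborel
      (\<lambda>x. (normal_density m 1 x * (x - m)\<^sup>2 + (2 * m) * (normal_density m 1 x * x)) - m\<^sup>2 * normal_density m 1 x)
      ((1 + (2 * m) * m) - m\<^sup>2 * 1)"
    by (intro has_bochner_integral_add has_bochner_integral_diff has_bochner_integral_mult_right 0 1 2)
  also have "(\<lambda>x. (normal_density m 1 x * (x - m)\<^sup>2 + (2 * m) * (normal_density m 1 x * x)) - m\<^sup>2 * normal_density m 1 x)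
      = (\<lambda>x. normal_density m 1 x * x\<^sup>2)"
    by (auto simp: fun_eq_iff power2_eq_square algebra_simps)
  also have "(1 + (2 * m) * m) - m\<^sup>2 * 1 = m\<^sup>2 + 1"
    by (simp add: power2_eq_square)
  finally have 3: "has_bochner_integral lborel (\<lambda>x. normal_density m 1 x * x\<^sup>2) (m\<^sup>2 + 1)" .
  show "has_bochner_integral (gaussian m) (\<lambda>x. x) m"
    by (rule has_bochner_integral_density) (use 1 in auto)
  show "has_bochner_integral (gaussian m) (\<lambda>x. x\<^sup>2) (m\<^sup>2 + 1)"
    by (rule has_bochner_integral_density) (use 3 in auto)
qed

lemma prod_over_superset:
  fixes f :: "'i \<Rightarrow> 'b :: comm_monoid_mult"
  assumes "finite U" "A \<subseteq> U"
  shows "(\<Prod>e\<in>A. f e) = (\<Prod>e\<in>U. if e \<in> A then f e else 1)"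
  using assms by (simp add: prod.If_cases Int_absorb1)

text \<open>By independence the integral factorises over \<open>U\<close>. An index in both sets
  contributes the second moment m^2 + 1, whence the extra 1; any other contributes its mean or
  1.\<close>

lemma has_bochner_integral_gaussian_prod_prod:
  fixes m :: "'i \<Rightarrow> real"
  assumes U: "finite U" "A \<subseteq> U" "B \<subseteq> U"
  shows "has_bochner_integral (PiM U (\<lambda>e. gaussian (m e))) (\<lambda>x. (\<Prod>e\<in>A. x e) * (\<Prod>e\<in>B. x e))
    (\<Prod>e\<in>U. (if e \<in> A then m e else 1) * (if e \<in> B then m e else 1) + (if e \<in> A \<inter> B then 1 else 0))"
proof -
  interpret gauss: prob_space "gaussian h" for h by (rule prob_space_gaussian)
  interpret product_sigma_finite "\<lambda>e. gaussian (m e)" by standard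
  let ?f = "\<lambda>e x :: real. (if e \<in> A then x else 1) * (if e \<in> B then x else 1)"
  have f: "has_bochner_integral (gaussian (m e)) (?f e)
     ((if e \<in> A then m e else 1) * (if e \<in> B then m e else 1) + (if e \<in> A \<inter> B then 1 else 0))" for e
    using gaussian_moments[of "m e"] gauss.prob_space[of "m e"]
    by (auto simp: power2_eq_square has_bochner_integral_iff)
  have eq: "(\<Prod>e\<in>A. x e) * (\<Prod>e\<in>B. x e) = (\<Prod>e\<in>U. ?f e (x e))" for x
    by (simp only: prod_over_superset[OF U(1,2)] prod_over_superset[OF U(1,3)] prod.distrib)
  show ?thesis
    unfolding eq has_bochner_integral_iff
    using f U(1) product_integrable_prod[of U ?f] product_integral_prod[of U ?f]
    by (simp add: has_bochner_integral_iff)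
qed

text \<open>Equal sets give at most 2 per factor, since the means are at most 1. If a single index
  is shared, the covariance is its variance 1 times the product of the other 2 (d - 1) means;
  disjoint sets are uncorrelated.\<close>

lemma gaussian_covariance_le:
  fixes m :: "'i \<Rightarrow> real" and \<mu> :: real
  assumes U: "finite U" "A \<subseteq> U" "B \<subseteq> U" and card: "card A = d" "card B = d"
    and m: "\<And>e. e \<in> U \<Longrightarrow> 0 \<le> m e \<and> m e \<le> \<mu>" "\<mu> \<le> 1" "0 \<le> \<mu>"
    and AB: "A = B \<or> card (A \<inter> B) \<le> 1"
  shows "(\<Prod>e\<in>U. (if e \<in> A then m e else 1) * (if e \<in> B then m e else 1) + (if e \<in> A \<inter> B then 1 else 0))
      - (\<Prod>e\<in>A. m e) * (\<Prod>e\<in>B. m e)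
    \<le> (if A = B then 2 ^ d else if A \<inter> B \<noteq> {} then \<mu> ^ (2 * (d - 1)) else 0)"
    (is "prod ?h U - _ \<le> _")
proof -
  let ?g = "\<lambda>e. (if e \<in> A then m e else 1) * (if e \<in> B then m e else 1)"
  have eq: "(\<Prod>e\<in>A. m e) * (\<Prod>e\<in>B. m e) = prod ?g U"
    by (simp only: prod_over_superset[OF U(1,2)] prod_over_superset[OF U(1,3)] prod.distrib)
  have fin: "finite A" "finite B" using U finite_subset by auto
  consider "A = B" | "A \<noteq> B" "A \<inter> B = {}" | e0 where "A \<noteq> B" "A \<inter> B = {e0}"
  proof -
    have "A \<inter> B = {} \<or> (\<exists>e0. A \<inter> B = {e0})" if "A \<noteq> B"
    proof -
      have "card (A \<inter> B) = 0 \<or> card (A \<inter> B) = 1" using AB that by auto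
      then show ?thesis using fin by (auto simp: card_1_singleton_iff)
    qed
    then show ?thesis using that by blast
  qed
  then show ?thesis
  proof cases
    case 1
    have "prod ?h U = (\<Prod>e\<in>A. (m e)\<^sup>2 + 1)"
      unfolding prod_over_superset[OF U(1,2)] using 1 by (intro prod.cong) (auto simp: power2_eq_square)
    also have "\<dots> \<le> (\<Prod>e\<in>A. 2)"
    proof (rule prod_mono)
      fix e assume "e \<in> A"
      then have "0 \<le> m e" "m e \<le> 1" using m U by force+
      then have "(m e)\<^sup>2 \<le> 1" by (simp add: power_le_one)
      then show "0 \<le> (m e)\<^sup>2 + 1 \<and> (m e)\<^sup>2 + 1 \<le> 2" by simp
    qed
    also have "\<dots> = 2 ^ d" using card by simp
    finally have "prod ?h U \<le> 2 ^ d" .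
    moreover have "0 \<le> prod ?g U"
      using m by (intro prod_nonneg) auto
    ultimately show ?thesis using 1 eq by simp
  next
    case 2
    then have "?h = ?g" by (auto simp: fun_eq_iff)
    then show ?thesis using 2 eq by simp
  next
    case (3 e0)
    have e0: "e0 \<in> U" "e0 \<in> A" "e0 \<in> B" using 3 U by auto
    have "prod ?h U = (m e0 * m e0 + 1) * prod ?h (U - {e0})"
      using U(1) e0 by (simp add: prod.remove)
    also have "prod ?h (U - {e0}) = prod ?g (U - {e0})"
      using 3 by (intro prod.cong) auto
    finally have h: "prod ?h U = (m e0 * m e0 + 1) * prod ?g (U - {e0})" .
    have g: "prod ?g U = (m e0 * m e0) * prod ?g (U - {e0})"
      using U(1) e0 by (simp add: prod.remove)
    have "prod ?g (U - {e0}) = (\<Prod>e\<in>A - {e0}. m e) * (\<Prod>e\<in>B - {e0}. m e)"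
    proof -
      have *: "A - {e0} \<subseteq> U - {e0}" "B - {e0} \<subseteq> U - {e0}" "finite (U - {e0})" using U by auto
      show ?thesis
        unfolding prod_over_superset[OF *(3,1)] prod_over_superset[OF *(3,2)] prod.distrib[symmetric]
        by (intro prod.cong) auto
    qed
    also have "\<dots> \<le> (\<Prod>e\<in>A - {e0}. \<mu>) * (\<Prod>e\<in>B - {e0}. \<mu>)"
      using m U by (intro mult_mono prod_mono prod_nonneg) auto
    also have "\<dots> = \<mu> ^ (2 * (d - 1))"
      using e0 fin card by (simp add: mult_2 power_add)
    finally have "prod ?g (U - {e0}) \<le> \<mu> ^ (2 * (d - 1))" .
    moreover have "prod ?h U - (\<Prod>e\<in>A. m e) * (\<Prod>e\<in>B. m e) = prod ?g (U - {e0})"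
      unfolding eq h g by (simp only: distrib_right mult_1_left add_diff_cancel_left')
    ultimately show ?thesis
      using 3 by simp
  qed
qed

text \<open>The sets \<open>ed t\<close> form a linear hypergraph, so only pairs of sets that share a single index,
  which is the variance of one Gaussian, contribute to the covariances off the diagonal.\<close>

lemma gaussian_polynomial_deviation:
  fixes m :: "'i \<Rightarrow> real" and \<mu> :: real and ed :: "'t \<Rightarrow> 'i set"
  assumes U: "finite U" "\<And>t. t \<in> J \<Longrightarrow> ed t \<subseteq> U" and J: "finite J"
    and card: "\<And>t. t \<in> J \<Longrightarrow> card (ed t) = d"
    and m: "\<And>e. e \<in> U \<Longrightarrow> 0 \<le> m e \<and> m e \<le> \<mu>" "\<mu> \<le> 1" "0 \<le> \<mu>"
    and inter: "\<And>t t'. t \<in> J \<Longrightarrow> t' \<in> J \<Longrightarrow> t \<noteq> t' \<Longrightarrow> ed t \<noteq> ed t' \<and> card (ed t \<inter> ed t') \<le> 1"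
    and \<delta>: "0 < \<delta>"
  defines "N \<equiv> PiM U (\<lambda>e. gaussian (m e))"
  shows "measure N {x \<in> space N. \<delta> \<le> \<bar>(\<Sum>t\<in>J. \<Prod>e\<in>ed t. x e) - (\<Sum>t\<in>J. \<Prod>e\<in>ed t. m e)\<bar>} \<le>
    (2 ^ d * card J + \<mu> ^ (2 * (d - 1)) * card {(t, t') \<in> J \<times> J. t \<noteq> t' \<and> ed t \<inter> ed t' \<noteq> {}}) / \<delta>\<^sup>2"
proof -
  interpret N: prob_space N
    unfolding N_def by (intro prob_space_PiM prob_space_gaussian)
  let ?S = "\<lambda>x. \<Sum>t\<in>J. \<Prod>e\<in>ed t. x e :: real"
  let ?h = "\<lambda>t t' e. (if e \<in> ed t then m e else 1) * (if e \<in> ed t' then m e else 1) + (if e \<in> ed t \<inter> ed t' then 1 else 0)"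
  let ?K = "{(t, t') \<in> J \<times> J. t \<noteq> t' \<and> ed t \<inter> ed t' \<noteq> {}}"
  have 1: "has_bochner_integral N (\<lambda>x. \<Prod>e\<in>ed t. x e) (\<Prod>e\<in>ed t. m e)" if "t \<in> J" for t
    using has_bochner_integral_gaussian_prod_prod[OF U(1) U(2)[OF that], of "{}" m]
    unfolding N_def prod_over_superset[OF U(1) U(2)[OF that], of m] by simp
  have 2: "has_bochner_integral N (\<lambda>x. (\<Prod>e\<in>ed t. x e) * (\<Prod>e\<in>ed t'. x e)) (\<Prod>e\<in>U. ?h t t' e)"
    if "t \<in> J" "t' \<in> J" for t t'
    unfolding N_def by (intro has_bochner_integral_gaussian_prod_prod U that)
  have S1: "has_bochner_integral N ?S (\<Sum>t\<in>J. \<Prod>e\<in>ed t. m e)"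
    by (intro has_bochner_integral_sum 1)
  have sq: "(?S x)\<^sup>2 = (\<Sum>t\<in>J. \<Sum>t'\<in>J. (\<Prod>e\<in>ed t. x e) * (\<Prod>e\<in>ed t'. x e))" for x
    by (simp add: power2_eq_square sum_product)
  have S2: "has_bochner_integral N (\<lambda>x. (?S x)\<^sup>2) (\<Sum>t\<in>J. \<Sum>t'\<in>J. \<Prod>e\<in>U. ?h t t' e)"
    unfolding sq by (intro has_bochner_integral_sum 2)
  note i = S1[unfolded has_bochner_integral_iff] S2[unfolded has_bochner_integral_iff]
  have "N.variance ?S = (\<Sum>t\<in>J. \<Sum>t'\<in>J. (\<Prod>e\<in>U. ?h t t' e) - (\<Prod>e\<in>ed t. m e) * (\<Prod>e\<in>ed t'. m e))"
    using i by (subst N.variance_eq) (auto simp: power2_eq_square sum_product sum_subtractf)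
  also have "\<dots> \<le> (\<Sum>t\<in>J. \<Sum>t'\<in>J. (if t = t' then (2::real) ^ d else 0) + (if (t, t') \<in> ?K then \<mu> ^ (2 * (d - 1)) else 0))"
  proof (intro sum_mono)
    fix t t' assume t: "t \<in> J" "t' \<in> J"
    have "(\<Prod>e\<in>U. ?h t t' e) - (\<Prod>e\<in>ed t. m e) * (\<Prod>e\<in>ed t'. m e) \<le>
      (if ed t = ed t' then (2::real) ^ d else if ed t \<inter> ed t' \<noteq> {} then \<mu> ^ (2 * (d - 1)) else 0)"
      using t inter[OF t] by (intro gaussian_covariance_le U card m) auto
    also have "\<dots> = (if t = t' then (2::real) ^ d else 0) + (if (t, t') \<in> ?K then \<mu> ^ (2 * (d - 1)) else 0)"
      using t inter[OF t] by auto
    finally show "(\<Prod>e\<in>U. ?h t t' e) - (\<Prod>e\<in>ed t. m e) * (\<Prod>e\<in>ed t'. m e) \<le>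
      (if t = t' then (2::real) ^ d else 0) + (if (t, t') \<in> ?K then \<mu> ^ (2 * (d - 1)) else 0)" .
  qed
  also have "\<dots> = 2 ^ d * card J + \<mu> ^ (2 * (d - 1)) * card ?K"
  proof -
    have "(\<Sum>t\<in>J. \<Sum>t'\<in>J. if (t, t') \<in> ?K then \<mu> ^ (2 * (d - 1)) else 0) =
        (\<Sum>p\<in>J \<times> J. if p \<in> ?K then \<mu> ^ (2 * (d - 1)) else 0)"
      by (simp only: sum.cartesian_product case_prod_beta' prod.collapse)
    also have "\<dots> = (\<Sum>p\<in>?K. \<mu> ^ (2 * (d - 1)))"
      using J by (intro sum.mono_neutral_cong_right) auto
    finally have "(\<Sum>t\<in>J. \<Sum>t'\<in>J. if (t, t') \<in> ?K then \<mu> ^ (2 * (d - 1)) else 0) = \<mu> ^ (2 * (d - 1)) * card ?K"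
      by simp
    then show ?thesis
      using J by (simp add: sum.distrib sum.delta)
  qed
  finally have v: "N.variance ?S \<le> 2 ^ d * card J + \<mu> ^ (2 * (d - 1)) * card ?K" .
  have "N.prob {x \<in> space N. \<delta> \<le> \<bar>?S x - N.expectation ?S\<bar>} \<le> N.variance ?S / \<delta>\<^sup>2"
    using i \<delta> by (intro N.Chebyshev_inequality) auto
  also have "\<dots> \<le> (2 ^ d * card J + \<mu> ^ (2 * (d - 1)) * card ?K) / \<delta>\<^sup>2"
    using v by (intro divide_right_mono) auto
  finally show ?thesis using i by simp
qed

section \<open>Edges and triangles\<close>

lemma card_edges: "finite A \<Longrightarrow> card (edges A) = card A choose 2"
proof (induction A rule: finite_linorder_max_induct)
  case (insert b A)
  have b: "b \<notin> A" using insert by auto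
  have "edges (insert b A) = edges A \<union> (\<lambda>i. (i, b)) ` A"
    using insert.hyps by (fastforce simp: edges_def)
  moreover have "edges A \<inter> (\<lambda>i. (i, b)) ` A = {}"
    using b by (auto simp: edges_def)
  ultimately have "card (edges (insert b A)) = card (edges A) + card A"
    using insert by (simp add: card_Un_disjoint finite_edges card_image inj_on_def)
  then show ?case
    using insert b by (simp add: numeral_2_eq_2)
qed (simp add: edges_def)

text \<open>The triangles through a new largest element \<open>b\<close> correspond to the edges of
  \<open>A\<close>, which is Pascal's rule.\<close>

lemma card_triangles: "finite A \<Longrightarrow> card (triangles A) = card A choose 3"
proof (induction A rule: finite_linorder_max_induct)
  case (insert b A)
  have b: "b \<notin> A" using insert by auto
  have "triangles (insert b A) = triangles A \<union> (\<lambda>(i, j). (i, j, b)) ` edges A"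
    using insert.hyps by (fastforce simp: triangles_def edges_def)
  moreover have "triangles A \<inter> (\<lambda>(i, j). (i, j, b)) ` edges A = {}"
    using b by (auto simp: triangles_def)
  moreover have "inj_on (\<lambda>(i, j). (i, j, b)) (edges A)"
    by (auto simp: inj_on_def)
  ultimately have "card (triangles (insert b A)) = card (triangles A) + card (edges A)"
    using insert by (simp add: card_Un_disjoint finite_triangles finite_edges card_image)
  then show ?case
    using insert b by (simp add: card_edges numeral_2_eq_2 numeral_3_eq_3)
qed (simp add: triangles_def case_prod_unfold)

definition triangle_edges :: "nat \<times> nat \<times> nat \<Rightarrow> (nat \<times> nat) set" where
  "triangle_edges = (\<lambda>(i, j, l). {(i, j), (j, l), (i, l)})"

lemma triangle_sum_eq:
  "triangle_sum I X = (\<Sum>t\<in>triangles I. \<Prod>e\<in>triangle_edges t. X e)"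
  unfolding triangle_sum_def
  by (rule sum.cong) (auto simp: triangles_def triangle_edges_def mult.assoc)

lemma card_triangle_edges: "t \<in> triangles I \<Longrightarrow> card (triangle_edges t) = 3"
  by (auto simp: triangles_def triangle_edges_def)

text \<open>Two edges of a triangle determine its three vertices, so distinct triangles share at
  most one edge: the linearity that the deviation bound asks for.\<close>

lemma triangle_edges_inter:
  assumes "t \<in> triangles I" "t' \<in> triangles I" "t \<noteq> t'"
  shows "triangle_edges t \<noteq> triangle_edges t' \<and> card (triangle_edges t \<inter> triangle_edges t') \<le> 1"
proof -
  have fin: "finite (triangle_edges t)" for t by (auto simp: triangle_edges_def split: prod.splits)
  have "e = e'" if "e \<in> triangle_edges t \<inter> triangle_edges t'" "e' \<in> triangle_edges t \<inter> triangle_edges t'" for e e'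
    using that assms by (auto simp: triangles_def triangle_edges_def)
  then have "card (triangle_edges t \<inter> triangle_edges t') \<le> 1"
    using fin by (auto simp: card_le_Suc0_iff_eq)
  moreover then have "triangle_edges t \<noteq> triangle_edges t'"
    using card_triangle_edges[OF assms(1)] by auto
  ultimately show ?thesis by simp
qed

lemma card_triangles_le:
  assumes "finite I"
  shows "card (triangles I) \<le> card I ^ 3"
proof -
  have "card (triangles I) \<le> card (I \<times> I \<times> I)"
    using assms by (intro card_mono) (auto simp: triangles_def)
  then show ?thesis by (simp add: card_cartesian_product power3_eq_cube mult.assoc)
qed

lemma card_edges_le:
  assumes "finite I"
  shows "card (edges I) \<le> card I ^ 2"
proof -
  have "card (edges I) \<le> card (I \<times> I)"
    using assms by (intro card_mono) (auto simp: edges_def)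
  then show ?thesis by (simp add: card_cartesian_product power2_eq_square)
qed

text \<open>An overlapping pair is determined by the first triangle, the shared edge, the remaining
  vertex of the second triangle and the position of that vertex in it, which gives |I|^3 times 3
  times |I| times 3.\<close>

lemma card_overlapping_triangles:
  assumes "finite I"
  shows "card {(t, t') \<in> triangles I \<times> triangles I. t \<noteq> t' \<and> triangle_edges t \<inter> triangle_edges t' \<noteq> {}}
    \<le> 9 * card I ^ 4" (is "card ?K \<le> _")
proof -
  define S where "S = Sigma (triangles I) (\<lambda>t. triangle_edges t \<times> I)"
  have fin: "finite (triangle_edges t)" for t by (auto simp: triangle_edges_def split: prod.splits)
  have S: "finite S"
    unfolding S_def using assms by (auto intro!: finite_SigmaI finite_triangles fin)
  have "card S = (\<Sum>t\<in>triangles I. card (triangle_edges t) * card I)"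
    unfolding S_def using assms by (subst card_SigmaI) (auto simp: finite_triangles fin card_cartesian_product)
  also have "\<dots> = card (triangles I) * (3 * card I)"
    by (simp add: card_triangle_edges)
  also have "\<dots> \<le> card I ^ 3 * (3 * card I)"
    using card_triangles_le[OF assms] by (rule mult_right_mono) simp
  finally have cS: "card S \<le> 3 * card I ^ 4" by (simp add: power3_eq_cube power4_eq_xxxx)
  \<comment> \<open>The three maps insert the vertex \<open>w\<close> as the last, the first and the
    middle one.\<close>
  let ?a = "\<lambda>(t, e, w). (t, fst e, snd e, w)" and ?b = "\<lambda>(t, e, w). (t, w, fst e, snd e)"
    and ?c = "\<lambda>(t, e, w). (t, fst e, w, snd e)"
  have "p \<in> ?a ` S \<union> ?b ` S \<union> ?c ` S" if K: "p \<in> ?K" for p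
  proof -
    obtain t i j l where p: "p = (t, i, j, l)" by (metis prod.exhaust)
    from K p have t: "t \<in> triangles I" and I: "i \<in> I" "j \<in> I" "l \<in> I"
      and "triangle_edges t \<inter> {(i, j), (j, l), (i, l)} \<noteq> {}"
      by (auto simp: triangles_def triangle_edges_def)
    then consider "(i, j) \<in> triangle_edges t" | "(j, l) \<in> triangle_edges t" | "(i, l) \<in> triangle_edges t"
      by blast
    then show ?thesis
    proof cases
      case 1
      then have "(t, (i, j), l) \<in> S" using t I by (simp add: S_def)
      then have "?a (t, (i, j), l) \<in> ?a ` S" by (rule imageI)
      then show ?thesis by (simp add: p)
    next
      case 2
      then have "(t, (j, l), i) \<in> S" using t I by (simp add: S_def)
      then have "?b (t, (j, l), i) \<in> ?b ` S" by (rule imageI)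
      then show ?thesis by (simp add: p)
    next
      case 3
      then have "(t, (i, l), j) \<in> S" using t I by (simp add: S_def)
      then have "?c (t, (i, l), j) \<in> ?c ` S" by (rule imageI)
      then show ?thesis by (simp add: p)
    qed
  qed
  then have "?K \<subseteq> ?a ` S \<union> ?b ` S \<union> ?c ` S"
    by (rule subsetI)
  then have "card ?K \<le> card (?a ` S \<union> ?b ` S \<union> ?c ` S)"
    using S by (intro card_mono finite_UnI finite_imageI)
  also have "\<dots> \<le> card (?a ` S) + card (?b ` S) + card (?c ` S)"
    by (meson add_right_mono card_Un_le le_trans)
  also have "\<dots> \<le> card S + card S + card S"
    using S by (intro add_mono card_image_le)
  finally show ?thesis using cS by simp
qed

text \<open>Edges are the case d = 1 with pairwise disjoint index sets, so only the diagonal 2 |I|^2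
  remains. Triangles are the case d = 3: 2^3 |I|^3 from the diagonal, and at most 9 |I|^4
  overlapping pairs with four remaining means each, bounded by M \<lambda>.\<close>

lemma edge_triangle_deviation:
  fixes \<sigma> lam M n I
  defines "N \<equiv> upper_given_labels n lam M \<sigma>" and "\<mu> \<equiv> entry_mean lam M \<sigma>"
  assumes I: "I \<subseteq> {1..n}" and lam: "0 \<le> lam" "real M * lam \<le> 1" and \<delta>: "0 < \<delta>" "0 < \<delta>'"
  shows "measure N {x \<in> space N. \<delta> \<le> \<bar>edge_sum I x - edge_sum I \<mu>\<bar> \<or> \<delta>' \<le> \<bar>triangle_sum I x - triangle_sum I \<mu>\<bar>}
    \<le> 2 * card I ^ 2 / \<delta>\<^sup>2 + (8 * card I ^ 3 + 9 * (real M * lam) ^ 4 * card I ^ 4) / \<delta>'\<^sup>2"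
proof -
  interpret N: prob_space N
    unfolding N_def by (rule prob_space_upper_given_labels)
  have fin: "finite I" using I finite_subset by blast
  have mu: "0 \<le> \<mu> e \<and> \<mu> e \<le> real M * lam" for e
    using lam by (auto simp: \<mu>_def entry_mean_def split: prod.splits)
  have N: "N = PiM (upper_indices n) (\<lambda>e. gaussian (\<mu> e))"
    by (simp add: N_def upper_given_labels_eq \<mu>_def)
  have M: "0 \<le> real M * lam" using lam by simp
  have empty: "{(t, t') \<in> edges I \<times> edges I. t \<noteq> t' \<and> {t} \<inter> {t'} \<noteq> {}} = {}" by auto
  have "measure N {x \<in> space N. \<delta> \<le> \<bar>edge_sum I x - edge_sum I \<mu>\<bar>} \<le> 2 * card (edges I) / \<delta>\<^sup>2"
  proof -
    have "measure N {x \<in> space N. \<delta> \<le> \<bar>(\<Sum>t\<in>edges I. \<Prod>e\<in>{t}. x e) - (\<Sum>t\<in>edges I. \<Prod>e\<in>{t}. \<mu> e)\<bar>} \<le>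
        (2 ^ 1 * card (edges I) + (real M * lam) ^ (2 * (1 - 1)) *
          card {(t, t') \<in> edges I \<times> edges I. t \<noteq> t' \<and> {t} \<inter> {t'} \<noteq> {}}) / \<delta>\<^sup>2"
      unfolding N
    proof (rule gaussian_polynomial_deviation)
      show "{t} \<subseteq> upper_indices n" if "t \<in> edges I" for t
        using that I by (auto simp: edges_def)
      show "finite (upper_indices n)" by (rule finite_upper_indices)
    qed (use mu M lam \<delta> fin in \<open>auto simp: finite_edges\<close>)
    then show ?thesis
      unfolding empty by (simp add: edge_sum_def)
  qed
  also have "\<dots> \<le> 2 * card I ^ 2 / \<delta>\<^sup>2"
  proof -
    have "real (card (edges I)) \<le> real (card I ^ 2)"
      using card_edges_le[OF fin] by (simp only: of_nat_le_iff)
    then show ?thesis by (intro divide_right_mono) auto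
  qed
  finally have E: "measure N {x \<in> space N. \<delta> \<le> \<bar>edge_sum I x - edge_sum I \<mu>\<bar>} \<le> 2 * card I ^ 2 / \<delta>\<^sup>2" .
  let ?K = "{(t, t') \<in> triangles I \<times> triangles I. t \<noteq> t' \<and> triangle_edges t \<inter> triangle_edges t' \<noteq> {}}"
  have "measure N {x \<in> space N. \<delta>' \<le> \<bar>triangle_sum I x - triangle_sum I \<mu>\<bar>} \<le>
      (2 ^ 3 * card (triangles I) + (real M * lam) ^ (2 * (3 - 1)) * card ?K) / \<delta>'\<^sup>2"
    unfolding triangle_sum_eq N
  proof (rule gaussian_polynomial_deviation)
    show "triangle_edges t \<subseteq> upper_indices n" if "t \<in> triangles I" for t
      using that I by (auto simp: triangles_def triangle_edges_def)
    show "finite (upper_indices n)" by (rule finite_upper_indices)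
  qed (use mu M lam \<delta> fin triangle_edges_inter in
      \<open>auto simp: finite_triangles card_triangle_edges\<close>)
  also have "\<dots> \<le> (8 * card I ^ 3 + 9 * (real M * lam) ^ 4 * card I ^ 4) / \<delta>'\<^sup>2"
  proof -
    have c: "real (card (triangles I)) \<le> real (card I ^ 3)" "real (card ?K) \<le> real (9 * card I ^ 4)"
      using card_triangles_le[OF fin] card_overlapping_triangles[OF fin] by (simp_all only: of_nat_le_iff)
    have "(real M * lam) ^ 4 * real (card ?K) \<le> (real M * lam) ^ 4 * real (9 * card I ^ 4)"
      using c(2) by (rule mult_left_mono) simp
    then have "8 * real (card (triangles I)) + (real M * lam) ^ 4 * real (card ?K) \<le>
        8 * card I ^ 3 + 9 * (real M * lam) ^ 4 * card I ^ 4"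
      using mult_left_mono[OF c(1), of 8] by linarith
    then have "(8 * real (card (triangles I)) + (real M * lam) ^ 4 * real (card ?K)) / \<delta>'\<^sup>2 \<le>
        (8 * card I ^ 3 + 9 * (real M * lam) ^ 4 * card I ^ 4) / \<delta>'\<^sup>2"
      by (rule divide_right_mono) simp
    then show ?thesis by simp
  qed
  finally have T: "measure N {x \<in> space N. \<delta>' \<le> \<bar>triangle_sum I x - triangle_sum I \<mu>\<bar>} \<le>
      (8 * card I ^ 3 + 9 * (real M * lam) ^ 4 * card I ^ 4) / \<delta>'\<^sup>2" .
  have [measurable]: "(\<lambda>x. edge_sum I x) \<in> borel_measurable N" "(\<lambda>x. triangle_sum I x) \<in> borel_measurable N"
    using measurable_edge_triangle_sum[OF _ I, of "\<lambda>x. x" N] by (auto simp: N_def measurable_ident_sets sets_upper_given_labels)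
  have "measure N {x \<in> space N. \<delta> \<le> \<bar>edge_sum I x - edge_sum I \<mu>\<bar> \<or> \<delta>' \<le> \<bar>triangle_sum I x - triangle_sum I \<mu>\<bar>} =
    measure N ({x \<in> space N. \<delta> \<le> \<bar>edge_sum I x - edge_sum I \<mu>\<bar>} \<union> {x \<in> space N. \<delta>' \<le> \<bar>triangle_sum I x - triangle_sum I \<mu>\<bar>})"
    by (rule arg_cong[where f="measure N"]) auto
  also have "\<dots> \<le> measure N {x \<in> space N. \<delta> \<le> \<bar>edge_sum I x - edge_sum I \<mu>\<bar>} +
      measure N {x \<in> space N. \<delta>' \<le> \<bar>triangle_sum I x - triangle_sum I \<mu>\<bar>}"
    by (rule measure_Un_le) measurable
  finally show ?thesis using E T by linarith
qed

section \<open>Means of the edge and triangle sums\<close>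

lemma edge_sum_entry_mean:
  assumes "finite I"
  shows "edge_sum I (entry_mean lam M \<sigma>) =
    real M * lam * (\<Sum>l\<in>{1..M}. real (card {i \<in> I. \<sigma> i = Some l} choose 2))"
proof -
  let ?I = "\<lambda>l. {i \<in> I. \<sigma> i = Some l}"
  have "entry_mean lam M \<sigma> p = (\<Sum>l\<in>{1..M}. if p \<in> edges (?I l) then real M * lam else 0)"
    if "p \<in> edges I" for p
  proof -
    obtain i j where p: "p = (i, j)" by (cases p)
    have "(\<Sum>l\<in>{1..M}. if p \<in> edges (?I l) then real M * lam else 0) =
       (\<Sum>l\<in>{1..M}. if \<sigma> i = Some l then if \<sigma> j = Some l then real M * lam else 0 else 0)"
      using that by (intro sum.cong) (auto simp: p edges_def)
    also have "\<dots> = entry_mean lam M \<sigma> p"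
      by (cases "\<sigma> i") (auto simp: p entry_mean_def sum.delta' cong: if_cong)
    finally show ?thesis by simp
  qed
  then have "edge_sum I (entry_mean lam M \<sigma>) =
      (\<Sum>p\<in>edges I. \<Sum>l\<in>{1..M}. if p \<in> edges (?I l) then real M * lam else 0)"
    unfolding edge_sum_def by (rule sum.cong[OF refl])
  also have "\<dots> = (\<Sum>l\<in>{1..M}. \<Sum>p\<in>edges I. if p \<in> edges (?I l) then real M * lam else 0)"
    by (rule sum.swap)
  also have "\<dots> = (\<Sum>l\<in>{1..M}. \<Sum>p\<in>edges (?I l). real M * lam)"
    using assms by (intro sum.cong[OF refl] sum.mono_neutral_cong_right) (auto simp: finite_edges, auto simp: edges_def)
  finally show ?thesis
    using assms by (simp add: card_edges sum_distrib_left mult.commute)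
qed

text \<open>A product of three means can be nonzero only if all three vertices carry one label, so
  the communities contribute separately.\<close>

lemma triangle_sum_entry_mean:
  assumes "finite I"
  shows "triangle_sum I (entry_mean lam M \<sigma>) =
    (real M * lam) ^ 3 * (\<Sum>l\<in>{1..M}. real (card {i \<in> I. \<sigma> i = Some l} choose 3))"
proof -
  let ?I = "\<lambda>l. {i \<in> I. \<sigma> i = Some l}" and ?m = "entry_mean lam M \<sigma>"
  have "?m (i, j) * ?m (j, k) * ?m (i, k) = (\<Sum>l\<in>{1..M}. if (i, j, k) \<in> triangles (?I l) then (real M * lam) ^ 3 else 0)"
    if "(i, j, k) \<in> triangles I" for i j k
  proof -
    have "(\<Sum>l\<in>{1..M}. if (i, j, k) \<in> triangles (?I l) then (real M * lam) ^ 3 else 0) =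
       (\<Sum>l\<in>{1..M}. if \<sigma> i = Some l then if \<sigma> j = Some l \<and> \<sigma> k = Some l then (real M * lam) ^ 3 else 0 else 0)"
      using that by (intro sum.cong) (auto simp: triangles_def)
    also have "\<dots> = ?m (i, j) * ?m (j, k) * ?m (i, k)"
      by (cases "\<sigma> i") (auto simp: entry_mean_def power3_eq_cube sum.delta' cong: if_cong)
    finally show ?thesis by simp
  qed
  then have "triangle_sum I ?m =
      (\<Sum>p\<in>triangles I. \<Sum>l\<in>{1..M}. if p \<in> triangles (?I l) then (real M * lam) ^ 3 else 0)"
    unfolding triangle_sum_def by (intro sum.cong) auto
  also have "\<dots> = (\<Sum>l\<in>{1..M}. \<Sum>p\<in>triangles I. if p \<in> triangles (?I l) then (real M * lam) ^ 3 else 0)"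
    by (rule sum.swap)
  also have "\<dots> = (\<Sum>l\<in>{1..M}. \<Sum>p\<in>triangles (?I l). (real M * lam) ^ 3)"
    using assms by (intro sum.cong[OF refl] sum.mono_neutral_cong_right) (auto simp: finite_triangles, auto simp: triangles_def)
  finally show ?thesis
    using assms by (simp add: card_triangles sum_distrib_left mult.commute)
qed

section \<open>Separating one community from two\<close>

lemma real_choose_2: "real (a choose 2) = real a * (real a - 1) / 2"
proof (induction a)
  case (Suc a)
  have "Suc a choose 2 = a + (a choose 2)" by (simp add: numeral_2_eq_2)
  then show ?case using Suc by (simp add: field_simps)
qed simp

lemma real_choose_3: "real (a choose 3) = real a * (real a - 1) * (real a - 2) / 6"
proof (induction a)
  case (Suc a)
  have "Suc a choose 3 = (a choose 2) + (a choose 3)" by (simp add: numeral_2_eq_2 numeral_3_eq_3)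
  then show ?case using Suc by (simp add: real_choose_2 field_simps)
qed simp

text \<open>The overlap \<open>a\<close> is only known to be at least \<open>u\<close>, so every
  error is expressed in powers of \<open>a\<close>; then \<lambda>^6 a^6 cancels and the claim is
  numerical: 0.168^2 against 4/9 * 0.114, close to the limits 1/36 and 1/18.\<close>

lemma not_rejects_single_community:
  fixes lam u a E T :: real
  assumes lam: "0 < lam" and u: "100 \<le> u" "u \<le> a"
    and E: "\<bar>E - lam * (a * (a - 1) / 2)\<bar> < lam * u\<^sup>2 / 200"
    and T: "\<bar>T - lam ^ 3 * (a * (a - 1) * (a - 2) / 6)\<bar> < lam ^ 3 * u ^ 3 / 1000"
  shows "lam * u\<^sup>2 / 4 \<le> E" and "T\<^sup>2 \<le> 4 / 9 * lam ^ 3 * E ^ 3"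
proof -
  have a: "a \<ge> 100" using u by linarith
  have ua: "u\<^sup>2 \<le> a\<^sup>2" "u ^ 3 \<le> a ^ 3" using u by (auto intro!: power_mono)
  have "100 * a \<le> a * a" using a by (intro mult_right_mono) auto
  moreover have "a * (a - 1) / 2 = (a * a - a) / 2" by (simp add: algebra_simps)
  ultimately have "a * (a - 1) / 2 \<ge> 0.49 * a\<^sup>2" using a by (simp add: power2_eq_square)
  then have "lam * (0.49 * a\<^sup>2) \<le> lam * (a * (a - 1) / 2)"
    using lam by (intro mult_left_mono) auto
  then have "49 / 100 * (lam * a\<^sup>2) \<le> lam * (a * (a - 1) / 2)" by (simp add: mult_ac)
  moreover have "lam * u\<^sup>2 \<le> lam * a\<^sup>2" using ua lam by simp
  \<comment> \<open>The mean is at least 0.49 \<lambda> a^2 and the tolerance is 0.005 \<lambda>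
    u^2, which leaves 0.485.\<close>
  ultimately have E1: "97 / 200 * (lam * a\<^sup>2) \<le> E" using E unfolding abs_less_iff by linarith
  have "0 \<le> lam * a\<^sup>2" using lam by simp
  then show "lam * u\<^sup>2 / 4 \<le> E" using E1 \<open>lam * u\<^sup>2 \<le> lam * a\<^sup>2\<close> by linarith
  have "(97 / 200 * (lam * a\<^sup>2)) ^ 3 \<le> E ^ 3"
    using E1 lam by (intro power_mono) auto
  moreover have "(97 / 200 * (lam * a\<^sup>2)) ^ 3 = (97 / 200) ^ 3 * (lam ^ 3 * a ^ 6)"
    unfolding power_mult_distrib power_mult[symmetric] by simp
  moreover have "0.1140 * (lam ^ 3 * a ^ 6) \<le> (97 / 200) ^ 3 * (lam ^ 3 * a ^ 6)"
    using lam a by (intro mult_right_mono) (auto simp: power3_eq_cube)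
  ultimately have E3: "0.1140 * (lam ^ 3 * a ^ 6) \<le> E ^ 3" by linarith
  have l3: "0 < lam ^ 3" using lam by simp
  have t0: "0 \<le> a * (a - 1) * (a - 2) / 6" using a by simp
  have "a * (a - 1) * (a - 2) \<le> a * a * a" using a by (intro mult_mono) auto
  then have "a * (a - 1) * (a - 2) / 6 \<le> a ^ 3 / 6" by (simp add: power3_eq_cube)
  then have "lam ^ 3 * (a * (a - 1) * (a - 2) / 6) \<le> lam ^ 3 * (a ^ 3 / 6)"
    using l3 by (intro mult_left_mono) auto
  then have "lam ^ 3 * (a * (a - 1) * (a - 2) / 6) \<le> lam ^ 3 * a ^ 3 / 6" by simp
  moreover have "0 \<le> lam ^ 3 * (a * (a - 1) * (a - 2) / 6)" using t0 l3 by simp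
  moreover have "lam ^ 3 * u ^ 3 \<le> lam ^ 3 * a ^ 3" using ua l3 by simp
  \<comment> \<open>1/6 + 1/1000 is below 0.168.\<close>
  moreover have "\<bar>T\<bar> \<le> 168 / 1000 * v" if "\<tau> \<le> v / 6" "0 \<le> \<tau>" "w \<le> v" "\<bar>T - \<tau>\<bar> < w / 1000" for \<tau> v w :: real
    using that by linarith
  ultimately have "\<bar>T\<bar> \<le> 168 / 1000 * (lam ^ 3 * a ^ 3)"
    using T by blast
  then have "\<bar>T\<bar>\<^sup>2 \<le> (168 / 1000 * (lam ^ 3 * a ^ 3))\<^sup>2"
    by (intro power_mono) auto
  also have "\<dots> = 0.028224 * (lam ^ 3 * (lam ^ 3 * a ^ 6))"
    by (simp add: power_mult_distrib power_mult[symmetric] power2_eq_square power_add[symmetric] mult.assoc[symmetric])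
  also have "\<dots> \<le> 4 / 9 * (lam ^ 3 * (0.1140 * (lam ^ 3 * a ^ 6)))"
  proof -
    have "0 \<le> lam ^ 3 * (lam ^ 3 * a ^ 6)" using l3 by simp
    then show ?thesis by simp
  qed
  also have "\<dots> \<le> 4 / 9 * (lam ^ 3 * E ^ 3)"
    using E3 l3 by (intro mult_left_mono) auto
  finally show "T\<^sup>2 \<le> 4 / 9 * lam ^ 3 * E ^ 3" by simp
qed

text \<open>Equality holds at a = b, so the difference carries a factor (a - b)^2, and its cofactor
  has nonnegative coefficients. This is the power mean inequality for exponents 2 and 3; the
  extremal case is a set that meets both communities equally.\<close>

lemma power_mean_2_3:
  fixes a b :: real
  assumes "0 \<le> a" "0 \<le> b"
  shows "(a\<^sup>2 + b\<^sup>2) ^ 3 \<le> 2 * (a ^ 3 + b ^ 3)\<^sup>2"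
proof -
  have "2 * (a ^ 3 + b ^ 3)\<^sup>2 - (a\<^sup>2 + b\<^sup>2) ^ 3 =
      (a - b)\<^sup>2 * (a ^ 4 + 2 * (a ^ 3 * b) + 2 * (a * b ^ 3) + b ^ 4)"
    by algebra
  moreover have "0 \<le> (a - b)\<^sup>2 * (a ^ 4 + 2 * (a ^ 3 * b) + 2 * (a * b ^ 3) + b ^ 4)"
    using assms by (intro mult_nonneg_nonneg add_nonneg_nonneg) auto
  ultimately show ?thesis by linarith
qed

text \<open>No lower bound on the overlaps \<open>a\<close> and \<open>b\<close> is given. Their
  size comes from \<open>E0\<close>: such an edge sum forces Q to exceed 0.245 u^2, and then the
  lower order terms and tolerances are small fractions of Q and R. What remains is R^2 \<ge> Q^3 /
  2.\<close>

lemma rejects_two_communities: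
  fixes lam u a b E T :: real
  assumes lam: "0 < lam" and u: "1000 \<le> u" and ab: "0 \<le> a" "0 \<le> b"
    and E: "\<bar>E - 2 * lam * (a * (a - 1) / 2 + b * (b - 1) / 2)\<bar> < lam * u\<^sup>2 / 200"
    and T: "\<bar>T - (2 * lam) ^ 3 * (a * (a - 1) * (a - 2) / 6 + b * (b - 1) * (b - 2) / 6)\<bar> < lam ^ 3 * u ^ 3 / 1000"
    and E0: "lam * u\<^sup>2 / 4 \<le> E"
  shows "4 / 9 * lam ^ 3 * E ^ 3 < T\<^sup>2"
proof -
  define Q R where "Q = a\<^sup>2 + b\<^sup>2" and "R = a ^ 3 + b ^ 3"
  have l3: "0 < lam ^ 3" using lam by simp
  have R0: "0 \<le> R" using ab by (simp add: R_def)
  have pm: "Q ^ 3 \<le> 2 * R\<^sup>2" unfolding Q_def R_def using ab by (rule power_mean_2_3)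
  have "2 * lam * (a * (a - 1) / 2 + b * (b - 1) / 2) = lam * (Q - a - b)"
    by (simp add: Q_def power2_eq_square field_simps)
  also have "\<dots> \<le> lam * Q" using ab lam by (intro mult_left_mono) auto
  finally have E1: "E < lam * Q + lam * u\<^sup>2 / 200" using E by linarith
  then have "lam * (0.245 * u\<^sup>2) < lam * Q" using E0 by simp
  then have Qu: "0.245 * u\<^sup>2 < Q" using lam by simp
  have "1000\<^sup>2 \<le> u\<^sup>2" using u by (intro power_mono) auto
  \<comment> \<open>180000 is 2 * 300^2, which with \<open>pm\<close> gives R \<ge> 300 Q
    below.\<close>
  then have Q0: "180000 \<le> Q" using Qu by simp
  \<comment> \<open>1 / (200 * 0.245) is about 0.0204.\<close>
  have "lam * u\<^sup>2 / 200 \<le> 0.021 * (lam * Q)"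
  proof -
    have "lam * u\<^sup>2 \<le> lam * (Q / 0.245)" using Qu lam by (intro mult_left_mono) auto
    then show ?thesis using lam Q0 by simp
  qed
  then have "E \<le> 1.021 * (lam * Q)" using E1 by simp
  moreover have "0 \<le> lam * u\<^sup>2" using lam by simp
  then have "0 \<le> E" using E0 by linarith
  ultimately have "E ^ 3 \<le> (1.021 * (lam * Q)) ^ 3" by (intro power_mono) auto
  also have "\<dots> \<le> 1.065 * (lam ^ 3 * Q ^ 3)"
  proof -
    have "(1.021 * (lam * Q)) ^ 3 = 1.021 ^ 3 * (lam ^ 3 * Q ^ 3)"
      by (simp only: power_mult_distrib)
    also have "\<dots> \<le> 1.065 * (lam ^ 3 * Q ^ 3)"
      using l3 Q0 by (intro mult_right_mono) (auto simp: power3_eq_cube)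
    finally show ?thesis .
  qed
  finally have E3: "E ^ 3 \<le> 1.065 * (lam ^ 3 * Q ^ 3)" .
  \<comment> \<open>The tolerance for \<open>T\<close> is stated in u^3 and has to be compared with
    R. From 0.245^3 u^6 \<le> Q^3 \<le> 2 R^2 one gets u^6 \<le> 136 R^2, which is rounded up to the
    square 144.\<close>
  have u3: "u ^ 3 \<le> 12 * R"
  proof (rule power2_le_imp_le)
    have "(0.245 * u\<^sup>2) ^ 3 \<le> Q ^ 3" using Qu by (intro power_mono) auto
    moreover have "(0.245 * u\<^sup>2) ^ 3 = 0.245 ^ 3 * u ^ 6"
      unfolding power_mult_distrib power_mult[symmetric] by simp
    ultimately have "(0.245 :: real) ^ 3 * u ^ 6 \<le> 2 * R\<^sup>2"
      using pm by linarith
    then have "117649 * u ^ 6 \<le> 16000000 * R\<^sup>2" by (simp add: power3_eq_cube)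
    then have "u ^ 6 \<le> 144 * R\<^sup>2" using zero_le_power2[of R] by linarith
    then show "(u ^ 3)\<^sup>2 \<le> (12 * R)\<^sup>2" by (simp add: power_mult_distrib power_mult[symmetric])
  qed (use R0 in simp)
  have QR: "300 * Q \<le> R"
  proof (rule power2_le_imp_le)
    have "180000 * Q\<^sup>2 \<le> Q * Q\<^sup>2" using Q0 by (intro mult_right_mono) auto
    then show "(300 * Q)\<^sup>2 \<le> R\<^sup>2"
      using pm by (simp add: power_mult_distrib power2_eq_square power3_eq_cube)
  qed (rule R0)
  have Rpos: "0 < R" using QR Q0 by linarith
  have "(2 * lam) ^ 3 * (a * (a - 1) * (a - 2) / 6 + b * (b - 1) * (b - 2) / 6) =
      lam ^ 3 * (4 / 3 * (R - 3 * Q + 2 * a + 2 * b))"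
    by (simp add: Q_def R_def power2_eq_square power3_eq_cube field_simps)
  \<comment> \<open>3 Q is at most R / 100, and 4/3 * 0.99 = 1.32.\<close>
  moreover have "lam ^ 3 * (1.32 * R) \<le> lam ^ 3 * (4 / 3 * (R - 3 * Q + 2 * a + 2 * b))"
    using QR ab l3 by (intro mult_left_mono) auto
  moreover have "lam ^ 3 * u ^ 3 / 1000 \<le> lam ^ 3 * (0.012 * R)"
  proof -
    have "lam ^ 3 * u ^ 3 \<le> lam ^ 3 * (12 * R)" using u3 l3 by (intro mult_left_mono) auto
    then show ?thesis by simp
  qed
  ultimately have "lam ^ 3 * (1.32 * R) - lam ^ 3 * (0.012 * R) \<le> T"
    using T unfolding abs_less_iff by linarith
  moreover have "lam ^ 3 * (1.32 * R) = 1.32 * (lam ^ 3 * R)" "lam ^ 3 * (0.012 * R) = 0.012 * (lam ^ 3 * R)"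
    "0 < lam ^ 3 * R"
    using l3 Rpos by simp_all
  ultimately have "1.3 * (lam ^ 3 * R) \<le> T" by (simp add: mult.commute)
  then have "(1.3 * (lam ^ 3 * R))\<^sup>2 \<le> T\<^sup>2"
    using l3 R0 by (intro power_mono) auto
  then have T2: "1.69 * (lam ^ 3 * lam ^ 3 * R\<^sup>2) \<le> T\<^sup>2"
    by (simp add: power_mult_distrib power2_eq_square mult_ac)
  have "4 / 9 * lam ^ 3 * E ^ 3 \<le> 4 / 9 * lam ^ 3 * (1.065 * (lam ^ 3 * Q ^ 3))"
    using E3 l3 by (intro mult_left_mono) auto
  also have "\<dots> \<le> 4 / 9 * lam ^ 3 * (1.065 * (lam ^ 3 * (2 * R\<^sup>2)))"
    using pm l3 by (intro mult_left_mono) auto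
  \<comment> \<open>8/9 * 1.065 is below 1.69.\<close>
  also have "\<dots> < 1.69 * (lam ^ 3 * lam ^ 3 * R\<^sup>2)"
    using l3 Rpos by simp
  finally show ?thesis using T2 by linarith
qed

section \<open>The reduction\<close>

text \<open>The bound of \<open>edge_triangle_deviation\<close> for |I| \<le> 1.1 k and M \<lambda>
  \<le> 2 \<lambda>, at the tolerances of the two separation lemmas with u = \<epsilon> k. It serves
  both hypotheses at once.\<close>

definition deviation_bound :: "real \<Rightarrow> real \<Rightarrow> real \<Rightarrow> real" where
  "deviation_bound \<epsilon> k lam =
     2 * (1.1 * k)\<^sup>2 / (lam * (\<epsilon> * k)\<^sup>2 / 200)\<^sup>2 +
     (8 * (1.1 * k) ^ 3 + 9 * (2 * lam) ^ 4 * (1.1 * k) ^ 4) / (lam ^ 3 * (\<epsilon> * k) ^ 3 / 1000)\<^sup>2"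

lemma edge_triangle_deviation_le:
  fixes \<sigma> M n I \<epsilon> k lam
  defines "N \<equiv> upper_given_labels n lam M \<sigma>" and "\<mu> \<equiv> entry_mean lam M \<sigma>"
  defines "D \<equiv> {x \<in> space N. lam * (\<epsilon> * k)\<^sup>2 / 200 \<le> \<bar>edge_sum I x - edge_sum I \<mu>\<bar> \<or>
    lam ^ 3 * (\<epsilon> * k) ^ 3 / 1000 \<le> \<bar>triangle_sum I x - triangle_sum I \<mu>\<bar>}"
  assumes I: "I \<subseteq> {1..n}" "real (card I) \<le> 1.1 * k" and M: "M \<le> 2"
    and lam: "0 < lam" "2 * lam \<le> 1" and pos: "0 < \<epsilon>" "0 < k"
  shows "D \<in> sets N" and "emeasure N D \<le> ennreal (deviation_bound \<epsilon> k lam)"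
proof -
  interpret N: prob_space N
    unfolding N_def by (rule prob_space_upper_given_labels)
  have [measurable]: "(\<lambda>x. edge_sum I x) \<in> borel_measurable N" "(\<lambda>x. triangle_sum I x) \<in> borel_measurable N"
    using measurable_edge_triangle_sum[OF _ I(1), of "\<lambda>x. x" N]
    by (auto simp: N_def measurable_ident_sets sets_upper_given_labels)
  show "D \<in> sets N" unfolding D_def by measurable
  have Ml: "real M * lam \<le> 2 * lam" using M lam by simp
  then have "real M * lam \<le> 1" using lam by linarith
  then have "measure N D \<le> 2 * card I ^ 2 / (lam * (\<epsilon> * k)\<^sup>2 / 200)\<^sup>2 +
      (8 * card I ^ 3 + 9 * (real M * lam) ^ 4 * card I ^ 4) / (lam ^ 3 * (\<epsilon> * k) ^ 3 / 1000)\<^sup>2"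
    unfolding D_def N_def \<mu>_def using I lam pos by (intro edge_triangle_deviation) auto
  also have "\<dots> \<le> deviation_bound \<epsilon> k lam"
  proof -
    have p: "real (card I) ^ j \<le> (1.1 * k) ^ j" for j
      using I by (intro power_mono) auto
    have "(real M * lam) ^ 4 \<le> (2 * lam) ^ 4"
      using Ml lam by (intro power_mono) auto
    then have "(real M * lam) ^ 4 * real (card I) ^ 4 \<le> (2 * lam) ^ 4 * (1.1 * k) ^ 4"
      using p by (intro mult_mono) auto
    then have h1: "8 * real (card I) ^ 3 + 9 * (real M * lam) ^ 4 * real (card I) ^ 4 \<le>
        8 * (1.1 * k) ^ 3 + 9 * (2 * lam) ^ 4 * (1.1 * k) ^ 4"
      using p[of 3] by linarith
    have h2: "2 * real (card I) ^ 2 \<le> 2 * (1.1 * k)\<^sup>2"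
      using p[of 2] by linarith
    show ?thesis
      unfolding deviation_bound_def of_nat_add of_nat_mult of_nat_power of_nat_numeral
      by (rule add_mono[OF divide_right_mono[OF h2] divide_right_mono[OF h1]]) auto
  qed
  finally show "emeasure N D \<le> ennreal (deviation_bound \<epsilon> k lam)"
    by (simp add: N.emeasure_eq_measure ennreal_leI)
qed

text \<open>The set is arbitrary: if it is too large or its edge sum too small, the test rejects
  anyway, and otherwise acceptance puts \<open>x\<close> into the deviation event
  \<open>D\<close>.\<close>

lemma prob_not_rejects_two_communities:
  assumes I: "I \<subseteq> {1..n}" and lam: "0 < lam" "2 * lam \<le> 1" and pos: "0 < \<epsilon>" "0 < k" "1000 \<le> \<epsilon> * k"
  shows "(\<integral>\<^sup>+x. (if rejects (1.1 * k) (lam * (\<epsilon> * k)\<^sup>2 / 4) (4 / 9 * lam ^ 3) I x then 0 else 1)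
    \<partial>upper_given_labels n lam 2 \<sigma>) \<le> ennreal (deviation_bound \<epsilon> k lam)"
proof (cases "real (card I) \<le> 1.1 * k")
  case False
  then show ?thesis by (simp add: rejects_def)
next
  case True
  let ?N = "upper_given_labels n lam 2 \<sigma>" and ?\<mu> = "entry_mean lam 2 \<sigma>"
  define D where "D = {x \<in> space ?N. lam * (\<epsilon> * k)\<^sup>2 / 200 \<le> \<bar>edge_sum I x - edge_sum I ?\<mu>\<bar> \<or>
    lam ^ 3 * (\<epsilon> * k) ^ 3 / 1000 \<le> \<bar>triangle_sum I x - triangle_sum I ?\<mu>\<bar>}"
  note D = edge_triangle_deviation_le[OF I True, of 2 lam \<epsilon> \<sigma>, folded D_def]
  have fin: "finite I" using I finite_subset by blast
  define a b where "a = real (card {i \<in> I. \<sigma> i = Some 1})" and "b = real (card {i \<in> I. \<sigma> i = Some 2})"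
  have sum: "(\<Sum>l\<in>{1..2::nat}. f l) = f 1 + f 2" for f :: "nat \<Rightarrow> real"
    by (simp add: numeral_2_eq_2)
  have e: "edge_sum I ?\<mu> = 2 * lam * (a * (a - 1) / 2 + b * (b - 1) / 2)"
    unfolding edge_sum_entry_mean[OF fin] sum real_choose_2 a_def b_def by simp
  have t: "triangle_sum I ?\<mu> = (2 * lam) ^ 3 * (a * (a - 1) * (a - 2) / 6 + b * (b - 1) * (b - 2) / 6)"
    unfolding triangle_sum_entry_mean[OF fin] sum real_choose_3 a_def b_def by simp
  have "(\<integral>\<^sup>+x. (if rejects (1.1 * k) (lam * (\<epsilon> * k)\<^sup>2 / 4) (4 / 9 * lam ^ 3) I x then 0 else 1) \<partial>?N)
      \<le> (\<integral>\<^sup>+x. indicator D x \<partial>?N)"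
  proof (rule nn_integral_mono)
    fix x assume x: "x \<in> space ?N"
    show "(if rejects (1.1 * k) (lam * (\<epsilon> * k)\<^sup>2 / 4) (4 / 9 * lam ^ 3) I x then 0 else 1) \<le> (indicator D x :: ennreal)"
    proof (cases "x \<in> D \<or> edge_sum I x < lam * (\<epsilon> * k)\<^sup>2 / 4")
      case True
      then show ?thesis by (auto simp: rejects_def)
    next
      case False
      then have "\<bar>edge_sum I x - edge_sum I ?\<mu>\<bar> < lam * (\<epsilon> * k)\<^sup>2 / 200"
        "\<bar>triangle_sum I x - triangle_sum I ?\<mu>\<bar> < lam ^ 3 * (\<epsilon> * k) ^ 3 / 1000"
        "lam * (\<epsilon> * k)\<^sup>2 / 4 \<le> edge_sum I x"
        using x by (auto simp: D_def)
      from rejects_two_communities[OF lam(1) pos(3) _ _ this(1,2)[unfolded e t] this(3)]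
      show ?thesis by (simp add: rejects_def a_def b_def)
    qed
  qed
  also have "\<dots> = emeasure ?N D"
    using D lam pos by (intro nn_integral_indicator) auto
  also have "\<dots> \<le> ennreal (deviation_bound \<epsilon> k lam)"
    using D lam pos by auto
  finally show ?thesis .
qed

text \<open>Recovery makes the overlap at least \<epsilon> k, so outside the deviation event all
  three clauses of \<open>rejects\<close> fail.\<close>

lemma prob_rejects_single_community:
  assumes I: "I \<subseteq> {1..n}" "real (card I) \<le> 1.1 * k" "\<epsilon> * k \<le> real (card (I \<inter> community n \<sigma>))"
    and lam: "0 < lam" "2 * lam \<le> 1" and pos: "0 < \<epsilon>" "0 < k" "1000 \<le> \<epsilon> * k"
  shows "(\<integral>\<^sup>+x. (if rejects (1.1 * k) (lam * (\<epsilon> * k)\<^sup>2 / 4) (4 / 9 * lam ^ 3) I x then 1 else 0)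
    \<partial>upper_given_labels n lam 1 \<sigma>) \<le> ennreal (deviation_bound \<epsilon> k lam)"
proof -
  let ?N = "upper_given_labels n lam 1 \<sigma>" and ?\<mu> = "entry_mean lam 1 \<sigma>"
  define D where "D = {x \<in> space ?N. lam * (\<epsilon> * k)\<^sup>2 / 200 \<le> \<bar>edge_sum I x - edge_sum I ?\<mu>\<bar> \<or>
    lam ^ 3 * (\<epsilon> * k) ^ 3 / 1000 \<le> \<bar>triangle_sum I x - triangle_sum I ?\<mu>\<bar>}"
  note D = edge_triangle_deviation_le[OF I(1,2), of 1 lam \<epsilon> \<sigma>, folded D_def]
  have fin: "finite I" using I finite_subset by blast
  define a where "a = real (card {i \<in> I. \<sigma> i = Some 1})"
  have "I \<inter> community n \<sigma> = {i \<in> I. \<sigma> i = Some 1}"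
    using I(1) by (auto simp: community_def)
  then have a: "\<epsilon> * k \<le> a" using I(3) by (simp add: a_def)
  have e: "edge_sum I ?\<mu> = lam * (a * (a - 1) / 2)"
    unfolding edge_sum_entry_mean[OF fin] by (simp add: real_choose_2 a_def)
  have t: "triangle_sum I ?\<mu> = lam ^ 3 * (a * (a - 1) * (a - 2) / 6)"
    unfolding triangle_sum_entry_mean[OF fin] by (simp add: real_choose_3 a_def)
  have "(\<integral>\<^sup>+x. (if rejects (1.1 * k) (lam * (\<epsilon> * k)\<^sup>2 / 4) (4 / 9 * lam ^ 3) I x then 1 else 0) \<partial>?N)
      \<le> (\<integral>\<^sup>+x. indicator D x \<partial>?N)"
  proof (rule nn_integral_mono)
    fix x assume x: "x \<in> space ?N"
    show "(if rejects (1.1 * k) (lam * (\<epsilon> * k)\<^sup>2 / 4) (4 / 9 * lam ^ 3) I x then 1 else 0) \<le> (indicator D x :: ennreal)"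
    proof (cases "x \<in> D")
      case False
      then have "\<bar>edge_sum I x - edge_sum I ?\<mu>\<bar> < lam * (\<epsilon> * k)\<^sup>2 / 200"
        "\<bar>triangle_sum I x - triangle_sum I ?\<mu>\<bar> < lam ^ 3 * (\<epsilon> * k) ^ 3 / 1000"
        using x by (auto simp: D_def)
      from not_rejects_single_community[OF lam(1) _ a this[unfolded e t]] pos(3) I(2)
      show ?thesis by (simp add: rejects_def not_less)
    qed simp
  qed
  also have "\<dots> = emeasure ?N D"
    using D lam pos by (intro nn_integral_indicator) auto
  also have "\<dots> \<le> ennreal (deviation_bound \<epsilon> k lam)"
    using D lam pos by auto
  finally show ?thesis .
qed

section \<open>Error probabilities of the test\<close>

definition recovers :: "nat \<Rightarrow> real \<Rightarrow> real \<Rightarrow> (nat \<Rightarrow> nat option) \<Rightarrow> nat set \<Rightarrow> bool" where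
  "recovers n \<epsilon> k \<sigma> I \<longleftrightarrow> \<epsilon> * k \<le> real (card (I \<inter> community n \<sigma>)) \<and> real (card I) \<le> 1.1 * k"

text \<open>The failure probability of \<open>A\<close> is put into the same iterated form as the
  error of the test, so that the two integrands can be compared pointwise.\<close>

lemma nn_integral_not_recovers:
  fixes n k lam \<epsilon> A
  defines "H \<equiv> P_Gaussian_joint n k lam 1 \<Otimes>\<^sub>M random_tape"
  shows "(\<integral>\<^sup>+\<sigma>. \<integral>\<^sup>+x. \<integral>\<^sup>+\<omega>. (if recovers n \<epsilon> k \<sigma> (output_set n A (symmetrize n x) \<omega>) then 0 else 1)
      \<partial>random_tape \<partial>upper_given_labels n lam 1 \<sigma> \<partial>labels_pmf n k 1) =
    ennreal (1 - measure H {((\<sigma>, Y), \<omega>) \<in> space H. real (card (output_set n A Y \<omega> \<inter> community n \<sigma>)) \<ge> \<epsilon> * k \<and>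
      real (card (output_set n A Y \<omega>)) \<le> 1.1 * k})"
proof -
  interpret J: prob_space "P_Gaussian_joint n k lam 1" by (rule prob_space_P_Gaussian_joint)
  interpret T: prob_space random_tape by (rule prob_space_random_tape)
  interpret H: pair_prob_space "P_Gaussian_joint n k lam 1" random_tape ..
  let ?J = "count_space UNIV \<Otimes>\<^sub>M matrix_space n :: ((nat \<Rightarrow> nat option) \<times> _) measure"
  note [measurable_cong] = sets_P_Gaussian_joint
  let ?R = "\<lambda>x. recovers n \<epsilon> k (fst (fst x)) (output_set n A (snd (fst x)) (snd x))"
  have os: "(\<lambda>x. output_set n A (snd (fst x)) (snd x)) \<in> measurable (?J \<Otimes>\<^sub>M random_tape) (count_space (Pow {1..n}))"
    by (rule measurable_output_set) (simp_all add: matrix_space_def)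
  have R [measurable]: "Measurable.pred (?J \<Otimes>\<^sub>M random_tape) ?R"
  proof (rule measurable_compose_countable'[OF _ os])
    fix I
    have "(\<lambda>x. fst (fst x)) \<in> measurable (?J \<Otimes>\<^sub>M random_tape) (count_space UNIV)" by measurable
    then show "Measurable.pred (?J \<Otimes>\<^sub>M random_tape) (\<lambda>x. recovers n \<epsilon> k (fst (fst x)) I)"
      by (rule measurable_compose) simp
  qed (simp add: countable_finite)
  have Rc: "(\<lambda>x. if ?R x then 0 else 1 :: ennreal) \<in> borel_measurable (?J \<Otimes>\<^sub>M random_tape)"
    by measurable
  let ?W = "{x \<in> space H. ?R x}"
  have W: "?W \<in> sets H" unfolding H_def by measurable
  have "{((\<sigma>, Y), \<omega>) \<in> space H. real (card (output_set n A Y \<omega> \<inter> community n \<sigma>)) \<ge> \<epsilon> * k \<and>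
      real (card (output_set n A Y \<omega>)) \<le> 1.1 * k} = ?W"
    by (auto simp: recovers_def)
  then have "ennreal (1 - measure H {((\<sigma>, Y), \<omega>) \<in> space H. real (card (output_set n A Y \<omega> \<inter> community n \<sigma>)) \<ge> \<epsilon> * k \<and>
      real (card (output_set n A Y \<omega>)) \<le> 1.1 * k}) = ennreal (1 - measure H ?W)"
    by simp
  also have "\<dots> = emeasure H (space H - ?W)"
    using H.prob_compl[of ?W] W by (simp add: H.emeasure_eq_measure H_def del: One_nat_def)
  also have "\<dots> = (\<integral>\<^sup>+x. indicator (space H - ?W) x \<partial>H)"
    using W by (intro nn_integral_indicator[symmetric]) auto
  also have "\<dots> = (\<integral>\<^sup>+x. (if ?R x then 0 else 1) \<partial>H)"
    by (rule nn_integral_cong) auto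
  also have "\<dots> = (\<integral>\<^sup>+y. \<integral>\<^sup>+\<omega>. (if ?R (y, \<omega>) then 0 else 1) \<partial>random_tape \<partial>P_Gaussian_joint n k lam 1)"
    unfolding H_def using Rc
    by (intro T.nn_integral_fst[symmetric]) (simp add: measurable_cong_sets[OF sets_pair_measure_cong[OF sets_P_Gaussian_joint refl] refl])
  also have "\<dots> = (\<integral>\<^sup>+\<sigma>. \<integral>\<^sup>+x. \<integral>\<^sup>+\<omega>. (if ?R ((\<sigma>, symmetrize n x), \<omega>) then 0 else 1)
      \<partial>random_tape \<partial>upper_given_labels n lam 1 \<sigma> \<partial>labels_pmf n k 1)"
    using T.borel_measurable_nn_integral_fst[OF Rc] by (rule nn_integral_P_Gaussian_joint)
  finally show ?thesis by simp
qed

lemma nn_integral_prob_const_le: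
  assumes "prob_space N" "\<And>x. x \<in> space N \<Longrightarrow> f x \<le> c"
  shows "(\<integral>\<^sup>+x. f x \<partial>N) \<le> c"
proof -
  have "(\<integral>\<^sup>+x. f x \<partial>N) \<le> (\<integral>\<^sup>+x. c \<partial>N)" by (intro nn_integral_mono assms)
  then show ?thesis by (simp add: prob_space.emeasure_space_1[OF assms(1)])
qed

lemma deviation_bound_nonneg: "0 < k \<Longrightarrow> 0 < lam \<Longrightarrow> 0 \<le> deviation_bound \<epsilon> k lam"
  by (auto simp: deviation_bound_def)

text \<open>The inner integral is small for every outcome of labels, first matrix and tape, so that
  an arbitrary output of \<open>A\<close> on two communities is covered.\<close>

lemma test_error_two_communities:
  assumes A: "randomized_poly_time A"
    and lam: "0 < lam" "2 * lam \<le> 1" and pos: "0 < \<epsilon>" "0 < k" "1000 \<le> \<epsilon> * k"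
  shows "prob_output_bit n (test_program n (A n) (1.1 * k) (lam * (\<epsilon> * k)\<^sup>2 / 4) (4 / 9 * lam ^ 3))
    (P_Gaussian n k (sqrt 2 * lam) 2) 0 \<le> deviation_bound \<epsilon> k lam"
proof -
  have "ennreal (prob_output_bit n (test_program n (A n) (1.1 * k) (lam * (\<epsilon> * k)\<^sup>2 / 4) (4 / 9 * lam ^ 3))
    (P_Gaussian n k (sqrt 2 * lam) 2) 0) \<le> ennreal (deviation_bound \<epsilon> k lam)"
    unfolding prob_output_bit_test_program[OF A]
  proof (rule nn_integral_prob_const_le[OF prob_space_measure_pmf],
      rule nn_integral_prob_const_le[OF prob_space_upper_given_labels],
      rule nn_integral_prob_const_le[OF prob_space_random_tape])
    fix \<sigma> x \<omega>
    let ?rej = "rejects (1.1 * k) (lam * (\<epsilon> * k)\<^sup>2 / 4) (4 / 9 * lam ^ 3) (output_set n (A n) (symmetrize n x) \<omega>)"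
    have "(\<integral>\<^sup>+x'. (if (if ?rej x' then 1 else 0 :: nat) = 0 then 1 else 0) \<partial>upper_given_labels n lam 2 \<sigma>) =
        (\<integral>\<^sup>+x'. (if ?rej x' then 0 else 1) \<partial>upper_given_labels n lam 2 \<sigma>)"
      by (rule nn_integral_cong) simp
    also have "\<dots> \<le> ennreal (deviation_bound \<epsilon> k lam)"
      by (rule prob_not_rejects_two_communities[OF output_set_subset lam pos])
    finally show "(\<integral>\<^sup>+x'. (if (if ?rej x' then 1 else 0 :: nat) = 0 then 1 else 0)
      \<partial>upper_given_labels n lam 2 \<sigma>) \<le> ennreal (deviation_bound \<epsilon> k lam)" .
  qed
  then show ?thesis using deviation_bound_nonneg lam pos by (simp add: ennreal_le_iff)
qed

text \<open>Pointwise, either \<open>A\<close> fails to recover, which is charged its full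
  indicator, or the set is good and the test errs only by a deviation of the second matrix.\<close>

lemma test_error_single_community:
  fixes n k \<epsilon> lam
  assumes A: "randomized_poly_time A"
    and lam: "0 < lam" "2 * lam \<le> 1" and pos: "0 < \<epsilon>" "0 < k" "1000 \<le> \<epsilon> * k"
  defines "H \<equiv> P_Gaussian_joint n k lam 1 \<Otimes>\<^sub>M random_tape"
  shows "prob_output_bit n (test_program n (A n) (1.1 * k) (lam * (\<epsilon> * k)\<^sup>2 / 4) (4 / 9 * lam ^ 3))
    (P_Gaussian n k (sqrt 2 * lam) 1) 1 \<le> deviation_bound \<epsilon> k lam +
    (1 - measure H {((\<sigma>, Y), \<omega>) \<in> space H. real (card (output_set n (A n) Y \<omega> \<inter> community n \<sigma>)) \<ge> \<epsilon> * k \<and>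
      real (card (output_set n (A n) Y \<omega>)) \<le> 1.1 * k})" (is "?p \<le> ?\<beta> + (1 - ?q)")
proof -
  interpret J: prob_space "P_Gaussian_joint n k lam 1" by (rule prob_space_P_Gaussian_joint)
  interpret T: prob_space random_tape by (rule prob_space_random_tape)
  interpret HH: pair_prob_space "P_Gaussian_joint n k lam 1" random_tape ..
  have q: "?q \<le> 1" unfolding H_def by (rule HH.prob_le_1)
  have \<beta>: "0 \<le> ?\<beta>" using deviation_bound_nonneg lam pos by simp
  let ?rej = "rejects (1.1 * k) (lam * (\<epsilon> * k)\<^sup>2 / 4) (4 / 9 * lam ^ 3)"
  let ?O = "\<lambda>x \<omega>. output_set n (A n) (symmetrize n x) \<omega>"
  let ?g = "\<lambda>\<sigma> x \<omega>. if recovers n \<epsilon> k \<sigma> (?O x \<omega>) then 0 else 1 :: ennreal"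
  have g: "(\<lambda>y. ?g \<sigma> (f y) (w y)) \<in> borel_measurable N"
    if "f \<in> measurable N (PiM (upper_indices n) (\<lambda>_. borel))" "w \<in> measurable N (PiM UNIV (\<lambda>_. borel))" for \<sigma> f w N
  proof -
    have "(\<lambda>y. if recovers n \<epsilon> k \<sigma> I then 0 else 1 :: ennreal) \<in> borel_measurable N" for I by simp
    then show ?thesis
      by (rule measurable_compose_countable'[OF _ measurable_output_set_symmetrize[OF that]])
        (simp add: countable_finite)
  qed
  have g2: "(\<lambda>x. \<integral>\<^sup>+\<omega>. ?g \<sigma> x \<omega> \<partial>random_tape) \<in> borel_measurable (upper_given_labels n lam 1 \<sigma>)" for \<sigma>
  proof -
    have "fst \<in> measurable (upper_given_labels n lam 1 \<sigma> \<Otimes>\<^sub>M random_tape) (PiM (upper_indices n) (\<lambda>_. borel))"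
      "snd \<in> measurable (upper_given_labels n lam 1 \<sigma> \<Otimes>\<^sub>M random_tape) (PiM UNIV (\<lambda>_. borel))"
      by measurable
    from g[OF this, of \<sigma>] show ?thesis
      by (intro T.borel_measurable_nn_integral) (simp only: case_prod_beta')
  qed
  have "ennreal ?p = (\<integral>\<^sup>+\<sigma>. \<integral>\<^sup>+x. \<integral>\<^sup>+\<omega>. \<integral>\<^sup>+x'. (if (if ?rej (?O x \<omega>) x' then 1 else 0 :: nat) = 1 then 1 else 0)
       \<partial>upper_given_labels n lam 1 \<sigma> \<partial>random_tape \<partial>upper_given_labels n lam 1 \<sigma> \<partial>labels_pmf n k 1)"
    by (subst prob_output_bit_test_program[OF A]) simp
  also have "\<dots> \<le> (\<integral>\<^sup>+\<sigma>. \<integral>\<^sup>+x. \<integral>\<^sup>+\<omega>. ?g \<sigma> x \<omega> + ennreal ?\<beta>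
       \<partial>random_tape \<partial>upper_given_labels n lam 1 \<sigma> \<partial>labels_pmf n k 1)"
  proof (intro nn_integral_mono)
    fix \<sigma> x \<omega>
    let ?N = "upper_given_labels n lam 1 \<sigma>"
    let ?int = "\<integral>\<^sup>+x'. (if (if ?rej (?O x \<omega>) x' then 1 else 0 :: nat) = 1 then 1 else 0) \<partial>?N"
    have eq: "?int = (\<integral>\<^sup>+x'. (if ?rej (?O x \<omega>) x' then 1 else 0) \<partial>?N)"
      by (rule nn_integral_cong) simp
    show "?int \<le> ?g \<sigma> x \<omega> + ennreal ?\<beta>"
    proof (cases "recovers n \<epsilon> k \<sigma> (?O x \<omega>)")
      case True
      then show ?thesis
        unfolding eq using prob_rejects_single_community[OF output_set_subset _ _ lam pos]
        by (simp add: recovers_def)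
    next
      case False
      have "?int \<le> 1"
        by (intro nn_integral_prob_const_le prob_space_upper_given_labels) simp
      also have "\<dots> \<le> 1 + ennreal ?\<beta>" by simp
      finally show ?thesis using False by simp
    qed
  qed
  also have "\<dots> = (\<integral>\<^sup>+\<sigma>. \<integral>\<^sup>+x. (\<integral>\<^sup>+\<omega>. ?g \<sigma> x \<omega> \<partial>random_tape) + ennreal ?\<beta>
       \<partial>upper_given_labels n lam 1 \<sigma> \<partial>labels_pmf n k 1)"
  proof (intro nn_integral_cong)
    fix \<sigma> x assume "x \<in> space (upper_given_labels n lam 1 \<sigma>)"
    then have "x \<in> space (PiM (upper_indices n) (\<lambda>_. borel))"
      by (simp add: upper_given_labels_def space_PiM)
    then have "(\<lambda>\<omega>. ?g \<sigma> x \<omega>) \<in> borel_measurable random_tape"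
      by (intro g) (auto simp: measurable_ident_sets[OF sets_random_tape])
    then show "(\<integral>\<^sup>+\<omega>. ?g \<sigma> x \<omega> + ennreal ?\<beta> \<partial>random_tape) = (\<integral>\<^sup>+\<omega>. ?g \<sigma> x \<omega> \<partial>random_tape) + ennreal ?\<beta>"
      by (subst nn_integral_add) (simp_all add: T.emeasure_space_1)
  qed
  also have "\<dots> = (\<integral>\<^sup>+\<sigma>. (\<integral>\<^sup>+x. \<integral>\<^sup>+\<omega>. ?g \<sigma> x \<omega> \<partial>random_tape \<partial>upper_given_labels n lam 1 \<sigma>) + ennreal ?\<beta>
       \<partial>labels_pmf n k 1)"
    using g2 by (intro nn_integral_cong, subst nn_integral_add)
      (simp_all add: prob_space.emeasure_space_1[OF prob_space_upper_given_labels])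
  also have "\<dots> = (\<integral>\<^sup>+\<sigma>. \<integral>\<^sup>+x. \<integral>\<^sup>+\<omega>. ?g \<sigma> x \<omega> \<partial>random_tape \<partial>upper_given_labels n lam 1 \<sigma> \<partial>labels_pmf n k 1)
      + ennreal ?\<beta>"
    by (subst nn_integral_add) (simp_all add: measure_pmf.emeasure_space_1)
  also have "\<dots> = ennreal (1 - ?q) + ennreal ?\<beta>"
    unfolding H_def by (subst nn_integral_not_recovers) simp
  also have "\<dots> = ennreal (?\<beta> + (1 - ?q))"
    using q \<beta> by (subst add.commute, subst ennreal_plus) (simp_all only: diff_ge_0_iff_ge)
  finally show ?thesis
    using q \<beta> by (subst (asm) ennreal_le_iff) simp_all
qed

text \<open>In terms of y = \<lambda>^2 k, the edge noise and the overlapping triangles contribute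
  constants times 1 / (y k), the diagonal terms of the triangles a constant times 1 / y^3.\<close>

lemma deviation_bound_tendsto:
  fixes k lam :: "nat \<Rightarrow> real"
  assumes \<epsilon>: "0 < \<epsilon>" and pos: "\<forall>\<^sub>F n in sequentially. 0 < k n \<and> 0 < lam n"
    and y: "filterlim (\<lambda>n. (lam n)\<^sup>2 * k n) at_top sequentially"
    and k: "filterlim k at_top sequentially"
  shows "(\<lambda>n. deviation_bound \<epsilon> (k n) (lam n)) \<longlonglongrightarrow> 0"
proof -
  let ?y = "\<lambda>n. (lam n)\<^sup>2 * k n"
  \<comment> \<open>The decimals are powers of 1.1; 40000 and 10^6 are the squares of the tolerance
    denominators 200 and 1000.\<close>
  define c1 c2 :: real where "c1 = (2 * 1.21 * 40000) / \<epsilon> ^ 4 + (9 * 16 * 1.4641 * 10 ^ 6) / \<epsilon> ^ 6"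
    and "c2 = (8 * 1.331 * 10 ^ 6) / \<epsilon> ^ 6"
  have "(\<lambda>n. c1 / (?y n * k n) + c2 / ?y n ^ 3) \<longlonglongrightarrow> 0 + 0"
    by (intro tendsto_add tendsto_divide_0[OF tendsto_const] filterlim_at_top_imp_at_infinity
        filterlim_at_top_mult_at_top y k filterlim_pow_at_top) auto
  moreover have "\<forall>\<^sub>F n in sequentially. c1 / (?y n * k n) + c2 / ?y n ^ 3 = deviation_bound \<epsilon> (k n) (lam n)"
    using pos
  proof eventually_elim
    case (elim n)
    then have "k n \<noteq> 0" "lam n \<noteq> 0" "\<epsilon> \<noteq> 0" using \<epsilon> by auto
    then show ?case
      unfolding deviation_bound_def c1_def c2_def
      by (simp add: power_mult_distrib power_divide) (simp add: field_simps power2_eq_square power3_eq_cube power4_eq_xxxx eval_nat_numeral)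
  qed
  ultimately have "(\<lambda>n. deviation_bound \<epsilon> (k n) (lam n)) \<longlonglongrightarrow> 0 + 0"
    by (rule Lim_transform_eventually)
  then show ?thesis by simp
qed

theorem theorem7p3:
  assumes testing_hypothesis:
    "\<And>k lam :: nat \<Rightarrow> real.
       (\<And>n. n \<ge> 1 \<Longrightarrow> 0 < k n \<and> k n \<le> real n \<and> 0 < lam n) \<Longrightarrow>
       (\<lambda>n. (lam n)\<^sup>2 * max ((k n)\<^sup>2 / real n) 1) \<longlonglongrightarrow> 0 \<Longrightarrow>
       \<not> (\<exists>B. randomized_poly_time B \<and>
              strongly_distinguishes B (\<lambda>n. P_Gaussian n (k n) (lam n) 1)
                                       (\<lambda>n. P_Gaussian n (k n) (lam n) 2))"
  fixes k lamt :: "nat \<Rightarrow> real"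
  assumes params: "\<And>n. n \<ge> 1 \<Longrightarrow> 0 < k n \<and> k n \<le> real n \<and> 0 < lamt n"
    and k_lower: "\<forall>\<^sub>F n in sequentially. k n \<ge> ln (ln (real n))"
    and lamt_upper: "(\<lambda>n. (lamt n)\<^sup>2 * max ((k n)\<^sup>2 / real n) 1) \<longlonglongrightarrow> 0"
    and lamt_lower: "\<forall>\<^sub>F n in sequentially. lamt n \<ge> 2 * k n powr (-1/2) * ln (real n)"
  shows "\<not> (\<exists>A. randomized_poly_time A \<and> achieves_weak_recovery A k lamt)"
proof
  assume "\<exists>A. randomized_poly_time A \<and> achieves_weak_recovery A k lamt"
  then obtain A \<epsilon> where A: "randomized_poly_time A" and \<epsilon>: "\<epsilon> > 0"
    and rec: "(\<lambda>n. measure (P_Gaussian_joint n (k n) (lamt n) 1 \<Otimes>\<^sub>M random_tape)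
        {((\<sigma>, Y), \<omega>) \<in> space (P_Gaussian_joint n (k n) (lamt n) 1 \<Otimes>\<^sub>M random_tape).
           real (card (output_set n (A n) Y \<omega> \<inter> community n \<sigma>)) \<ge> \<epsilon> * k n \<and>
           real (card (output_set n (A n) Y \<omega>)) \<le> 1.1 * k n}) \<longlonglongrightarrow> 1" (is "?q \<longlonglongrightarrow> 1")
    unfolding achieves_weak_recovery_def by blast
  have pos: "\<forall>\<^sub>F n in sequentially. 0 < k n \<and> 0 < lamt n"
    using eventually_ge_at_top[of 1] by eventually_elim (use params in auto)
  have "(\<lambda>n. (lamt n)\<^sup>2) \<longlonglongrightarrow> 0"
  proof (rule tendsto_sandwich[OF _ _ tendsto_const lamt_upper])
    show "\<forall>\<^sub>F n in sequentially. (lamt n)\<^sup>2 \<le> (lamt n)\<^sup>2 * max ((k n)\<^sup>2 / real n) 1"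
      by (intro always_eventually allI) (auto intro!: mult_left_le[of 1, simplified] simp: mult_le_cancel_left1)
  qed auto
  then have "\<forall>\<^sub>F n in sequentially. (lamt n)\<^sup>2 < 1 / 4"
    by (rule order_tendstoD) simp
  \<comment> \<open>The deviation bounds need M \<lambda> \<le> 1 also for M = 2.\<close>
  then have small: "\<forall>\<^sub>F n in sequentially. 2 * lamt n \<le> 1"
  proof eventually_elim
    case (elim n)
    then have "(lamt n)\<^sup>2 \<le> (1 / 2)\<^sup>2" by (simp add: power2_eq_square)
    then have "lamt n \<le> 1 / 2" by (rule power2_le_imp_le) simp
    then show ?case by simp
  qed
  \<comment> \<open>Squaring the lower bound on \<lambda> gives \<lambda>^2 k \<ge> 4 (ln
    n)^2.\<close>
  have y: "filterlim (\<lambda>n. (lamt n)\<^sup>2 * k n) at_top sequentially"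
  proof (rule filterlim_at_top_mono)
    show "filterlim (\<lambda>n. 4 * (ln (real n))\<^sup>2) at_top sequentially" by real_asymp
    show "\<forall>\<^sub>F n in sequentially. 4 * (ln (real n))\<^sup>2 \<le> (lamt n)\<^sup>2 * k n"
      using lamt_lower pos eventually_ge_at_top[of 1]
    proof eventually_elim
      case (elim n)
      have "(k n powr (-1/2))\<^sup>2 * k n = 1"
      proof -
        have "(k n powr (-1/2))\<^sup>2 = k n powr (-1)"
          unfolding power2_eq_square powr_add[symmetric] by simp
        then show ?thesis using elim by (simp add: powr_minus)
      qed
      then have "4 * (ln (real n))\<^sup>2 = (2 * k n powr (-1/2) * ln (real n))\<^sup>2 * k n"
        by (simp add: power_mult_distrib mult_ac)
      also have "\<dots> \<le> (lamt n)\<^sup>2 * k n"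
        using elim by (intro mult_right_mono power_mono mult_nonneg_nonneg) auto
      finally show ?case .
    qed
  qed
  \<comment> \<open>Since \<lambda> \<le> 1/2 eventually, k dominates \<lambda>^2 k.\<close>
  have kk: "filterlim k at_top sequentially"
  proof (rule filterlim_at_top_mono[OF y])
    show "\<forall>\<^sub>F n in sequentially. (lamt n)\<^sup>2 * k n \<le> k n"
      using small pos
    proof eventually_elim
      case (elim n)
      then have "(lamt n)\<^sup>2 \<le> 1" by (intro power_le_one) auto
      then show ?case using elim by (simp add: mult_left_le_one_le)
    qed
  qed
  \<comment> \<open>1000 is the size that \<open>rejects_two_communities\<close> requires of u =
    \<epsilon> k.\<close>
  have large: "\<forall>\<^sub>F n in sequentially. 1000 \<le> \<epsilon> * k n"
    using kk[unfolded filterlim_at_top, rule_format, of "1000 / \<epsilon>"]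
    by eventually_elim (use \<epsilon> in \<open>simp add: field_simps\<close>)
  have dev: "(\<lambda>n. deviation_bound \<epsilon> (k n) (lamt n)) \<longlonglongrightarrow> 0"
    using \<epsilon> pos y kk by (rule deviation_bound_tendsto)
  define B where "B = (\<lambda>n. test_program n (A n) (1.1 * k n) (lamt n * (\<epsilon> * k n)\<^sup>2 / 4) (4 / 9 * lamt n ^ 3))"
  have "randomized_poly_time B"
    unfolding B_def using A by (rule randomized_poly_time_test_program)
  moreover have "(\<lambda>n. prob_output_bit n (B n) (P_Gaussian n (k n) (sqrt 2 * lamt n) 1) 1) \<longlonglongrightarrow> 0"
  proof (rule tendsto_sandwich[OF _ _ tendsto_const])
    show "(\<lambda>n. deviation_bound \<epsilon> (k n) (lamt n) + (1 - ?q n)) \<longlonglongrightarrow> 0"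
      using tendsto_add[OF dev tendsto_diff[OF tendsto_const rec, of 1]] by simp
    show "\<forall>\<^sub>F n in sequentially. prob_output_bit n (B n) (P_Gaussian n (k n) (sqrt 2 * lamt n) 1) 1
        \<le> deviation_bound \<epsilon> (k n) (lamt n) + (1 - ?q n)"
      using small pos large
      by eventually_elim (use A \<epsilon> in \<open>auto simp only: B_def intro!: test_error_single_community\<close>)
  qed (simp add: prob_output_bit_def)
  moreover have "(\<lambda>n. prob_output_bit n (B n) (P_Gaussian n (k n) (sqrt 2 * lamt n) 2) 0) \<longlonglongrightarrow> 0"
  proof (rule tendsto_sandwich[OF _ _ tendsto_const dev])
    show "\<forall>\<^sub>F n in sequentially. prob_output_bit n (B n) (P_Gaussian n (k n) (sqrt 2 * lamt n) 2) 0
        \<le> deviation_bound \<epsilon> (k n) (lamt n)"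
      using small pos large
      by eventually_elim (use A \<epsilon> in \<open>auto simp only: B_def intro!: test_error_two_communities\<close>)
  qed (simp add: prob_output_bit_def)
  moreover have "\<not> (\<exists>B. randomized_poly_time B \<and>
      strongly_distinguishes B (\<lambda>n. P_Gaussian n (k n) (sqrt 2 * lamt n) 1)
        (\<lambda>n. P_Gaussian n (k n) (sqrt 2 * lamt n) 2))"
  \<comment> \<open>Scaling by \<surd>2 doubles the quantity that tends to 0, so the hypothesis
    covers the pair of models on which \<open>B\<close> runs.\<close>
  proof (rule testing_hypothesis)
    show "0 < k n \<and> k n \<le> real n \<and> 0 < sqrt 2 * lamt n" if "n \<ge> 1" for n
      using params[OF that] by simp
    show "(\<lambda>n. (sqrt 2 * lamt n)\<^sup>2 * max ((k n)\<^sup>2 / real n) 1) \<longlonglongrightarrow> 0"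
      using tendsto_mult_right_zero[OF lamt_upper, of 2] by (simp add: power_mult_distrib mult.assoc)
  qed
  ultimately show False
    unfolding strongly_distinguishes_def by blast
qed

end
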